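(* Let $a<b$ and $\tau>0$ be fixed. Let $g:\mathbb{R}\to\mathbb{R}$ be locally Lipschitz continuous and suppose there is a constant $\sigma>0$ with $g(s)\ge\sigma$ for all $s\in\mathbb{R}$. Let $f=-F'$, where $F:\mathbb{R}\to\mathbb{R}$ satisfies: $F\in C^3(\mathbb{R})$ and $F(u)\to+\infty$ as $|u|\to\infty$; $F(\pm1)=F'(\pm1)=0$, $F''(-1)>0$, $F''(1)>0$; and $\{u\in\mathbb{R}: F'(u)=0,\ F(u)\le 0\}=\{-1,1\}$. Let $N\ge1$ be an integer, let $v:(a,b)\to\{-1,+1\}$ be a piecewise constant function with exactly $N$ discontinuities, and put $c_0:=\sqrt2\int_{-1}^1\sqrt{F(s)}\,ds$. For each sufficiently small $\varepsilon>0$ let $(u_0^\varepsilon,u_1^\varepsilon)\in H^1([a,b])\times L^2(a,b)$, and let $k$ be a positive integer. Assume $\lim_{\varepsilon\to0}\|u_0^\varepsilon-v\|_{L^1(a,b)}=0$ and that there exists $C>0$ such that for all sufficiently small $\varepsilon>0$ $$\int_a^b\left[\frac{\tau}{2\varepsilon}(u_1^\varepsilon)^2+\frac{\varepsilon}{2}\big((u_0^\varepsilon)_x\big)^2+\frac{F(u_0^\varepsilon)}{\varepsilon}\right]dx\le Nc_0+C\varepsilon^k.$$ Let $u^\varepsilon$ be the (mild) solution of $$\tau u_{tt}+g(u)u_t=\varepsilon^2u_{xx}+f(u)\quad (x\in[a,b],\ t>0),\qquad u_x(a,t)=u_x(b,t)=0\quad (t>0),$$ with $u(x,0)=u_0^\varepsilon(x)$,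 $u_t(x,0)=u_1^\varepsilon(x)$ for $x\in[a,b]$. Let $K\subset\mathbb{R}\setminus\{-1,1\}$ be a closed subset of $\mathbb{R}$ and, for $\delta_1>0$, let $$T_\varepsilon(\delta_1)=\inf\{t\geq 0:\ d(I_K[u^\varepsilon(\cdot,t)],I_K[u_0^\varepsilon])>\delta_1\}.$$ If $\delta_1>0$ is sufficiently small, then for any $m>0$ there is $\varepsilon_0=\varepsilon_0(m,\delta_1)>0$ such that $$T_\varepsilon(\delta_1)>m\varepsilon^{-k}\qquad\text{for all }\varepsilon<\varepsilon_0(m,\delta_1).$$
   Context: For a function $u:[a,b]\to\mathbb{R}$ the interface is $I_K[u]:=u^{-1}(K)$ ($H^1$ functions are identified with their continuous representatives on $[a,b]$). For $A,B\subset\mathbb{R}$ the Hausdorff distance is $d(A,B):=\max\{\sup_{\alpha\in A}d(\alpha,B),\ \sup_{\beta\in B}d(\beta,A)\}$, where $d(\beta,A):=\inf\{|\beta-\alpha|:\alpha\in A\}$. Conventions: suprema over the empty set of these nonnegative quantities equal $0$, and $\inf\emptyset=+\infty$. Mild solution: write $X=H^1([a,b])\times L^2(a,b)$ (real Hilbert space). Let $A$ be the operator $A(u,w)=(w-u,\ \varepsilon^2\tau^{-1}u_{xx}-w)$ with domain $D(A)=\{(u,w)\in H^2([a,b])\times H^1([a,b]): u_x(a)=u_x(b)=0\}$; it generates a contraction semigroup $(S(t))_{t\ge0}$ on $X$ with respect to the scalar product $\langle(u,w),(\tilde u,\tilde w)\rangle_X=\int_a^b(\varepsilon^2u_x\tilde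 u_x+\tau u\tilde u+\tau w\tilde w)\,dx$. Let $\Phi(u,w)=(u,\ w+\tau^{-1}(f(u)-g(u)w))$. The mild solution with initial data $(u_0,u_1)\in X$ is the function $y=(u,u_t)\in C([0,\infty),X)$ satisfying $y(t)=S(t)(u_0,u_1)+\int_0^tS(t-s)\Phi(y(s))\,ds$ for all $t\ge0$. Under the stated assumptions it exists and is unique. *)

theory Defs
  imports "HOL-Analysis.Analysis" "HOL-Library.Function_Algebras"
begin

text \<open>Pointwise vector space structure on functions, extending the pointwise addition of
  \<^theory>\<open>HOL-Library.Function_Algebras\<close>; pairs of functions are then a real vector space as well.\<close>

instantiation "fun" :: (type, real_vector) real_vector
begin

definition scaleR_fun :: "real \<Rightarrow> ('a \<Rightarrow> 'b) \<Rightarrow> 'a \<Rightarrow> 'b"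
  where "scaleR_fun r f = (\<lambda>x. r *\<^sub>R f x)"

instance
  by standard (simp_all add: scaleR_fun_def plus_fun_def fun_eq_iff scaleR_add_left scaleR_add_right)

end


section \<open>Function spaces on an interval\<close>

text \<open>Functions on \<open>(a,b)\<close> or \<open>[a,b]\<close> are represented by total functions whose values
  outside the interval are irrelevant. Elements of \<open>L\<^sup>2\<close> are representatives, not classes;
  equality in the Hilbert space \<open>X\<close> is the relation \<open>Xeq\<close> below.\<close>

definition L2 :: "real \<Rightarrow> real \<Rightarrow> (real \<Rightarrow> real) set"
  where "L2 a b = {w \<in> borel_measurable (lebesgue_on {a<..<b}).
           integrable (lebesgue_on {a<..<b}) (\<lambda>x. (w x)\<^sup>2)}"

text \<open>Closed support in \<open>(a,b)\<close> is automatically compact. Using \<open>C\<^sub>c\<^sup>1\<close> rather than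
  \<open>C\<^sub>c\<^sup>\<infinity>\<close> test functions gives the same weak derivatives.\<close>

definition test_functions :: "real \<Rightarrow> real \<Rightarrow> (real \<Rightarrow> real) set"
  where "test_functions a b = {\<phi>. \<phi> C1_differentiable_on UNIV \<and> closure {x. \<phi> x \<noteq> 0} \<subseteq> {a<..<b}}"

definition has_weak_deriv :: "real \<Rightarrow> real \<Rightarrow> (real \<Rightarrow> real) \<Rightarrow> (real \<Rightarrow> real) \<Rightarrow> bool"
  where "has_weak_deriv a b u p \<longleftrightarrow> u \<in> L2 a b \<and> p \<in> L2 a b \<and>
    (\<forall>\<phi>\<in>test_functions a b.
       (LINT x|lebesgue_on {a<..<b}. u x * deriv \<phi> x) = - (LINT x|lebesgue_on {a<..<b}. p x * \<phi> x))"

text \<open>A representative of the weak derivative, determined up to null sets of \<open>(a,b)\<close>.\<close>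

definition weak_deriv :: "real \<Rightarrow> real \<Rightarrow> (real \<Rightarrow> real) \<Rightarrow> (real \<Rightarrow> real)"
  where "weak_deriv a b u = (SOME p. has_weak_deriv a b u p)"

text \<open>Continuity on \<open>[a,b]\<close> selects the continuous representative.\<close>

definition H1 :: "real \<Rightarrow> real \<Rightarrow> (real \<Rightarrow> real) set"
  where "H1 a b = {u. continuous_on {a..b} u \<and> (\<exists>p. has_weak_deriv a b u p)}"


section \<open>The Hilbert space \<open>X\<close>, the operator \<open>A\<close> and its semigroup\<close>

type_synonym state = "(real \<Rightarrow> real) \<times> (real \<Rightarrow> real)"

definition X :: "real \<Rightarrow> real \<Rightarrow> state set"
  where "X a b = H1 a b \<times> L2 a b"

definition Xinner :: "real \<Rightarrow> real \<Rightarrow> real \<Rightarrow> real \<Rightarrow> state \<Rightarrow> state \<Rightarrow> real"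
  where "Xinner a b \<tau> \<epsilon> z z' =
    (LINT x|lebesgue_on {a<..<b}.
       \<epsilon>\<^sup>2 * weak_deriv a b (fst z) x * weak_deriv a b (fst z') x
       + \<tau> * fst z x * fst z' x + \<tau> * snd z x * snd z' x)"

definition Xnorm :: "real \<Rightarrow> real \<Rightarrow> real \<Rightarrow> real \<Rightarrow> state \<Rightarrow> real"
  where "Xnorm a b \<tau> \<epsilon> z = sqrt (Xinner a b \<tau> \<epsilon> z z)"

definition Xeq :: "real \<Rightarrow> real \<Rightarrow> real \<Rightarrow> real \<Rightarrow> state \<Rightarrow> state \<Rightarrow> bool"
  where "Xeq a b \<tau> \<epsilon> z z' \<longleftrightarrow> Xnorm a b \<tau> \<epsilon> (z - z') = 0"

text \<open>In \<open>dom_A\<close>, \<open>p\<close> is the continuous representative of \<open>u\<^sub>x\<close>; that \<open>p\<close> lies in \<open>H1\<close>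
  says that \<open>u\<close> is in \<open>H\<^sup>2\<close>.\<close>

definition dom_A :: "real \<Rightarrow> real \<Rightarrow> state set"
  where "dom_A a b = {(u, w). u \<in> H1 a b \<and> w \<in> H1 a b \<and>
           (\<exists>p\<in>H1 a b. has_weak_deriv a b u p \<and> p a = 0 \<and> p b = 0)}"

definition op_A :: "real \<Rightarrow> real \<Rightarrow> real \<Rightarrow> real \<Rightarrow> state \<Rightarrow> state"
  where "op_A a b \<tau> \<epsilon> = (\<lambda>(u, w).
    (\<lambda>x. w x - u x, \<lambda>x. \<epsilon>\<^sup>2 / \<tau> * weak_deriv a b (weak_deriv a b u) x - w x))"

text \<open>\<open>S\<close> is a strongly continuous semigroup of linear contractions on \<open>X\<close> whose
  infinitesimal generator has, up to \<open>Xeq\<close>, the same graph as \<open>A\<close> with domain \<open>dom_A\<close>.\<close>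

definition contraction_semigroup_of_A ::
    "real \<Rightarrow> real \<Rightarrow> real \<Rightarrow> real \<Rightarrow> (real \<Rightarrow> state \<Rightarrow> state) \<Rightarrow> bool"
  where "contraction_semigroup_of_A a b \<tau> \<epsilon> S \<longleftrightarrow>
    (\<forall>t\<ge>0. \<forall>z\<in>X a b. S t z \<in> X a b) \<and>
    (\<forall>t\<ge>0. \<forall>z\<in>X a b. \<forall>z'\<in>X a b. \<forall>c.
       Xeq a b \<tau> \<epsilon> (S t (c *\<^sub>R z + z')) (c *\<^sub>R S t z + S t z')) \<and>
    (\<forall>t\<ge>0. \<forall>z\<in>X a b. Xnorm a b \<tau> \<epsilon> (S t z) \<le> Xnorm a b \<tau> \<epsilon> z) \<and>
    (\<forall>z\<in>X a b. Xeq a b \<tau> \<epsilon> (S 0 z) z) \<and>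
    (\<forall>s\<ge>0. \<forall>t\<ge>0. \<forall>z\<in>X a b. Xeq a b \<tau> \<epsilon> (S (s + t) z) (S s (S t z))) \<and>
    (\<forall>z\<in>X a b. ((\<lambda>t. Xnorm a b \<tau> \<epsilon> (S t z - z)) \<longlongrightarrow> 0) (at_right 0)) \<and>
    (\<forall>z\<in>X a b. \<forall>\<zeta>\<in>X a b.
       ((\<lambda>h. Xnorm a b \<tau> \<epsilon> ((1 / h) *\<^sub>R (S h z - z) - \<zeta>)) \<longlongrightarrow> 0) (at_right 0) \<longleftrightarrow>
       (\<exists>z'\<in>dom_A a b. Xeq a b \<tau> \<epsilon> z z' \<and> Xeq a b \<tau> \<epsilon> \<zeta> (op_A a b \<tau> \<epsilon> z')))"


section \<open>Mild solutions\<close>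

text \<open>\<open>J\<close> is the \<open>X\<close>-valued Riemann integral of \<open>G\<close> over \<open>[0,t]\<close>, which for continuous
  integrands coincides with the Bochner integral.\<close>

definition has_X_integral ::
    "real \<Rightarrow> real \<Rightarrow> real \<Rightarrow> real \<Rightarrow> (real \<Rightarrow> state) \<Rightarrow> real \<Rightarrow> state \<Rightarrow> bool"
  where "has_X_integral a b \<tau> \<epsilon> G t J \<longleftrightarrow> J \<in> X a b \<and>
    (\<forall>e>0. \<exists>d>0. \<forall>\<D>. \<D> tagged_division_of {0..t} \<and> (\<lambda>s. ball s d) fine \<D> \<longrightarrow>
       Xnorm a b \<tau> \<epsilon> ((\<Sum>(s, k)\<in>\<D>. measure lborel k *\<^sub>R G s) - J) < e)"

definition Phi :: "real \<Rightarrow> (real \<Rightarrow> real) \<Rightarrow> (real \<Rightarrow> real) \<Rightarrow> state \<Rightarrow> state"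
  where "Phi \<tau> f g = (\<lambda>(u, w). (u, \<lambda>x. w x + (f (u x) - g (u x) * w x) / \<tau>))"

definition mild_solution ::
    "real \<Rightarrow> real \<Rightarrow> real \<Rightarrow> real \<Rightarrow> (real \<Rightarrow> real) \<Rightarrow> (real \<Rightarrow> real) \<Rightarrow> state \<Rightarrow> (real \<Rightarrow> state) \<Rightarrow> bool"
  where "mild_solution a b \<tau> \<epsilon> f g z0 y \<longleftrightarrow>
    (\<forall>t\<ge>0. y t \<in> X a b) \<and>
    (\<forall>t\<ge>0. ((\<lambda>s. Xnorm a b \<tau> \<epsilon> (y s - y t)) \<longlongrightarrow> 0) (at t within {0..})) \<and>
    (\<exists>S. contraction_semigroup_of_A a b \<tau> \<epsilon> S \<and>
       (\<forall>t\<ge>0. \<exists>J. has_X_integral a b \<tau> \<epsilon> (\<lambda>s. S (t - s) (Phi \<tau> f g (y s))) t J \<and>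
          Xeq a b \<tau> \<epsilon> (y t) (S t z0 + J)))"


section \<open>Data, energy and interfaces\<close>

definition locally_lipschitz :: "(real \<Rightarrow> real) \<Rightarrow> bool"
  where "locally_lipschitz g \<longleftrightarrow> (\<forall>s. \<exists>r>0. \<exists>L. L-lipschitz_on (ball s r) g)"

definition C3 :: "(real \<Rightarrow> real) \<Rightarrow> bool"
  where "C3 F \<longleftrightarrow> (\<forall>n<3. \<forall>x. (deriv ^^ n) F differentiable (at x)) \<and>
           continuous_on UNIV ((deriv ^^ 3) F)"

text \<open>One-sided continuity rules out isolated exceptional values at break points, so every
  discontinuity is a genuine jump.\<close>

definition piecewise_constant_on :: "real \<Rightarrow> real \<Rightarrow> (real \<Rightarrow> real) \<Rightarrow> bool"
  where "piecewise_constant_on a b v \<longleftrightarrow>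
    (\<exists>P. finite P \<and>
       (\<forall>x y. a < x \<and> x < y \<and> y < b \<and> {x..y} \<inter> P = {} \<longrightarrow> v x = v y)) \<and>
    (\<forall>x\<in>{a<..<b}. continuous (at_left x) v \<or> continuous (at_right x) v)"

definition discontinuities :: "real \<Rightarrow> real \<Rightarrow> (real \<Rightarrow> real) \<Rightarrow> real set"
  where "discontinuities a b v = {x \<in> {a<..<b}. \<not> isCont v x}"

definition energy ::
    "real \<Rightarrow> real \<Rightarrow> real \<Rightarrow> real \<Rightarrow> (real \<Rightarrow> real) \<Rightarrow> state \<Rightarrow> real"
  where "energy a b \<tau> \<epsilon> F = (\<lambda>(u, w). LINT x|lebesgue_on {a<..<b}.
    \<tau> / (2 * \<epsilon>) * (w x)\<^sup>2 + \<epsilon> / 2 * (weak_deriv a b u x)\<^sup>2 + F (u x) / \<epsilon>)"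

definition interface :: "real \<Rightarrow> real \<Rightarrow> real set \<Rightarrow> (real \<Rightarrow> real) \<Rightarrow> real set"
  where "interface a b K u = {x \<in> {a..b}. u x \<in> K}"

text \<open>In \<^typ>\<open>ennreal\<close>, empty suprema are \<open>0\<close> and empty infima are \<open>\<infinity>\<close>. This differs from
  \<^const>\<open>infdist\<close>, for which the distance to the empty set is \<open>0\<close>.\<close>

definition point_dist :: "real \<Rightarrow> real set \<Rightarrow> ennreal"
  where "point_dist \<beta> A = (INF \<alpha>\<in>A. ennreal \<bar>\<beta> - \<alpha>\<bar>)"

definition hausdorff_dist :: "real set \<Rightarrow> real set \<Rightarrow> ennreal"
  where "hausdorff_dist A B = max (SUP \<alpha>\<in>A. point_dist \<alpha> B) (SUP \<beta>\<in>B. point_dist \<beta> A)"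

definition exit_time ::
    "real \<Rightarrow> real \<Rightarrow> real set \<Rightarrow> (real \<Rightarrow> real) \<Rightarrow> (real \<Rightarrow> real \<Rightarrow> real) \<Rightarrow> real \<Rightarrow> ennreal"
  where "exit_time a b K u0 u \<delta> =
    (INF t \<in> {t. 0 \<le> t \<and> hausdorff_dist (interface a b K (u t)) (interface a b K u0) > ennreal \<delta>}.
       ennreal t)"

end

(* Only one-sided derivatives of the semigroup are needed: on the domain of A both the norm and the
   first component of S(t) z have right derivatives given by A, a one-sided growth criterion
   integrates them, and density transfers the estimates to all of X. Comparing Riemann sums over
   [0,t] and [0,t+h] gives y(t+h) = S(h) y(t) + h Phi(y(t)) + o(h) for a mild solution y = (u,w),
   hence  eps * energy(y(t)) + sigma * D(t) <= eps * energy(y(0)),  where D(t) is the integral of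
   ||w||^2 over [0,t], and a bound on ||u(t) - u(0)|| in terms of D(t) and t.

   For the energy, let G' = sqrt(2F). A transition of u between two points costs at least the
   difference of G there, and G(s) - G(+-1) = O(F(s)) near the wells. If the energy near the jumps of
   v is at least N c0 - O(eps^j), the remaining energy is O(eps^j), so close to every jump there are
   points with F(u) = O(eps^(j+1)), which improves the lower bound to N c0 - O(eps^(j+1)) on slightly
   larger neighbourhoods. After k steps the energy is at least N c0 - O(eps^k) as long as u stays
   L^1-close to v; so D(t) = O(eps^(k+1)) on such a time interval, u moves by o(1) in L^1 up to time
   2 m eps^(-k), and the closeness is never lost. The same energy estimates locate the interface. *)
theory Submission
  imports Defs "HOL-Real_Asymp.Real_Asymp"
begin

section \<open>Cauchy-Schwarz and norm calculus for a form that may be degenerate\<close>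

section \<open>Semi-inner products\<close>

text \<open>The obstacle is regularity: a mild solution need not lie in the domain of A, so its
  energy cannot be differentiated directly. On the domain, however, <z, Az> equals -|z|^2 + \<tau>
  <u, w> for z = (u, w). This expression makes sense and is continuous on all of X, so it bounds the
  one-sided growth of |S(h) z|^2 for every z. After adding <z, Phi z> and the increment of the
  potential, everything cancels except the damping.

  States are representatives, not classes. X therefore carries only a seminorm, and equality of
  states means distance zero.

  In the static estimate the gain of a power of \<epsilon> rests on nondegenerate wells: F is at
  least, and |G - G(+-1)| at most, a multiple of the squared distance to the well. An energy \<eta>
  on an interval of fixed length forces F = O(\<epsilon> \<eta>) somewhere in it. Since k steps
  suffice, their widths r/(k+1) can be fixed independently of \<epsilon>.

  The values of K decide which argument locates the interface: a value in (-1,1) is taken at every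
  jump, whereas without such a value any visit to K would cost energy beyond the budget.\<close>

locale semi_inner =
  fixes V :: "'v::real_vector set" and ip :: "'v \<Rightarrow> 'v \<Rightarrow> real"
  assumes subspace_V: "subspace V"
    and ip_add: "\<lbrakk>x \<in> V; y \<in> V; z \<in> V\<rbrakk> \<Longrightarrow> ip (x + y) z = ip x z + ip y z"
    and ip_scale: "\<lbrakk>x \<in> V; z \<in> V\<rbrakk> \<Longrightarrow> ip (c *\<^sub>R x) z = c * ip x z"
    and ip_commute: "\<lbrakk>x \<in> V; y \<in> V\<rbrakk> \<Longrightarrow> ip x y = ip y x"
    and ip_nonneg: "x \<in> V \<Longrightarrow> 0 \<le> ip x x"
begin

definition nm :: "'v \<Rightarrow> real" where "nm x = sqrt (ip x x)"

lemma V_zero: "0 \<in> V"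
  and V_add: "x \<in> V \<Longrightarrow> y \<in> V \<Longrightarrow> x + y \<in> V"
  and V_scale: "x \<in> V \<Longrightarrow> c *\<^sub>R x \<in> V"
  and V_diff: "x \<in> V \<Longrightarrow> y \<in> V \<Longrightarrow> x - y \<in> V"
  using subspace_V by (auto simp: subspace_0 subspace_add subspace_scale subspace_diff)

lemma V_sum: "(\<And>i. i \<in> A \<Longrightarrow> f i \<in> V) \<Longrightarrow> sum f A \<in> V"
  using subspace_V by (rule subspace_sum)

lemma ip_add_right: "\<lbrakk>x \<in> V; y \<in> V; z \<in> V\<rbrakk> \<Longrightarrow> ip z (x + y) = ip z x + ip z y"
  using ip_add ip_commute V_add by metis

lemma ip_scale_right: "\<lbrakk>x \<in> V; z \<in> V\<rbrakk> \<Longrightarrow> ip z (c *\<^sub>R x) = c * ip z x"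
  using ip_scale ip_commute V_scale by metis

lemma ip_diff: "\<lbrakk>x \<in> V; y \<in> V; z \<in> V\<rbrakk> \<Longrightarrow> ip (x - y) z = ip x z - ip y z"
  using ip_add[of "x - y" y z] by (simp add: V_diff)

lemma ip_diff_right: "\<lbrakk>x \<in> V; y \<in> V; z \<in> V\<rbrakk> \<Longrightarrow> ip z (x - y) = ip z x - ip z y"
  using ip_diff ip_commute V_diff by metis

lemma nm_nonneg: "0 \<le> nm x" if "x \<in> V"
  using that by (simp add: nm_def ip_nonneg)

lemma nm_square: "(nm x)\<^sup>2 = ip x x" if "x \<in> V"
  using that by (simp add: nm_def ip_nonneg)

lemma nm_scale: "nm (c *\<^sub>R x) = \<bar>c\<bar> * nm x" if "x \<in> V"
proof -
  have "ip (c *\<^sub>R x) (c *\<^sub>R x) = c\<^sup>2 * ip x x"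
    using that by (simp add: ip_scale ip_scale_right V_scale power2_eq_square)
  then show ?thesis
    by (simp add: nm_def real_sqrt_mult)
qed

text \<open>The quadratic c -> |x + c y|^2 is nonnegative; inserting its minimiser gives the
  inequality. Since the form may be degenerate, |y| = 0 needs its own argument: the quadratic is
  then affine in c and bounded below, hence <x, y> = 0.\<close>

lemma ip_abs_le: "\<bar>ip x y\<bar> \<le> nm x * nm y" if x: "x \<in> V" and y: "y \<in> V"
proof -
  have q: "0 \<le> ip x x + 2 * c * ip x y + c\<^sup>2 * ip y y" for c
  proof -
    have "0 \<le> ip (x + c *\<^sub>R y) (x + c *\<^sub>R y)"
      using x y by (intro ip_nonneg V_add V_scale)
    also have "\<dots> = ip x x + 2 * c * ip x y + c\<^sup>2 * ip y y"
      using x y ip_commute[OF x y]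
      by (simp add: ip_add ip_add_right ip_scale ip_scale_right V_add V_scale algebra_simps power2_eq_square)
    finally show ?thesis .
  qed
  have "(ip x y)\<^sup>2 \<le> ip x x * ip y y"
  proof (cases "ip y y = 0")
    case True
    have "ip x y = 0"
    proof (rule ccontr)
      assume n: "ip x y \<noteq> 0"
      \<comment> \<open>At this value of c the affine function equals -1.\<close>
      show False
        using q[of "- (ip x x + 1) / (2 * ip x y)"] True n by (simp add: field_simps)
    qed
    then show ?thesis using True by simp
  next
    case False
    then have pos: "ip y y > 0" using ip_nonneg[OF y] by simp
    have "0 \<le> ip x x - (ip x y)\<^sup>2 / ip y y"
      using q[of "- ip x y / ip y y"] pos by (simp add: field_simps power2_eq_square)
    then show ?thesis using pos by (simp add: field_simps)
  qed
  then have "\<bar>ip x y\<bar> \<le> sqrt (ip x x * ip y y)"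
    using real_le_rsqrt real_sqrt_abs real_sqrt_le_mono by fastforce
  then show ?thesis by (simp add: nm_def real_sqrt_mult)
qed

lemma nm_triangle: "nm (x + y) \<le> nm x + nm y" if x: "x \<in> V" and y: "y \<in> V"
proof -
  have "(nm (x + y))\<^sup>2 = (nm x)\<^sup>2 + 2 * ip x y + (nm y)\<^sup>2"
    using x y ip_commute[OF x y] by (simp add: nm_square V_add ip_add ip_add_right)
  also have "\<dots> \<le> (nm x)\<^sup>2 + 2 * (nm x * nm y) + (nm y)\<^sup>2"
    using ip_abs_le[OF x y] by simp
  also have "\<dots> = (nm x + nm y)\<^sup>2" by (simp add: power2_sum)
  finally show ?thesis
    by (rule power2_le_imp_le) (simp add: nm_nonneg x y)
qed

lemma nm_minus: "nm (- x) = nm x" if "x \<in> V"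
  using nm_scale[OF that, of "-1"] by simp

lemma nm_minus_commute: "nm (x - y) = nm (y - x)" if "x \<in> V" "y \<in> V"
  using nm_minus[OF V_diff[OF that]] by simp

lemma nm_zero: "nm 0 = 0"
  using nm_scale[OF V_zero, of 0] by simp

lemma nm_triangle3: "nm (x - z) \<le> nm (x - y) + nm (y - z)" if "x \<in> V" "y \<in> V" "z \<in> V"
  using nm_triangle[of "x - y" "y - z"] that by (simp add: V_diff)

lemma nm_diff_le: "nm (x - y) \<le> nm x + nm y" if "x \<in> V" "y \<in> V"
  using nm_triangle3[of x 0 y] that nm_minus[of y] by (simp add: V_zero)

lemma nm_diff_abs: "\<bar>nm x - nm y\<bar> \<le> nm (x - y)" if "x \<in> V" "y \<in> V"
  using nm_triangle[of "x - y" y] nm_triangle[of "y - x" x] nm_minus_commute[of x y] that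
  by (simp add: V_diff)

lemma nm_sum: "nm (sum f A) \<le> (\<Sum>i\<in>A. nm (f i))" if "\<And>i. i \<in> A \<Longrightarrow> f i \<in> V"
  using that
proof (induction A rule: infinite_finite_induct)
  case (insert i A)
  then have "nm (f i + sum f A) \<le> nm (f i) + nm (sum f A)"
    by (intro nm_triangle V_sum) auto
  with insert show ?case by fastforce
qed (auto simp: nm_zero)

lemma nm_eq_0_add: "nm (x + y) = nm x" if "x \<in> V" "y \<in> V" "nm y = 0"
  using nm_diff_abs[of "x + y" x] that by (simp add: V_add)

lemma nm_cong0: "nm x = nm y" if "x \<in> V" "y \<in> V" "nm (x - y) = 0"
  using nm_eq_0_add[of y "x - y"] that by (simp add: V_diff)

text \<open>The form sees only classes modulo seminorm zero; this is how one choice of weak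
  derivative is exchanged for another.\<close>

lemma ip_cong0: "ip x z = ip y z" if "x \<in> V" "y \<in> V" "z \<in> V" "nm (x - y) = 0"
  using ip_abs_le[of "x - y" z] that by (simp add: V_diff ip_diff)

lemma ip_tendsto:
  assumes "\<And>i. f i \<in> V" "\<And>i. g i \<in> V" "x \<in> V" "y \<in> V"
    and "((\<lambda>i. nm (f i - x)) \<longlongrightarrow> 0) Q" "((\<lambda>i. nm (g i - y)) \<longlongrightarrow> 0) Q"
  shows "((\<lambda>i. ip (f i) (g i)) \<longlongrightarrow> ip x y) Q"
proof -
  have e: "ip (f i) (g i) - ip x y = ip (f i - x) (g i - y) + ip (f i - x) y + ip x (g i - y)" for i
    using assms(1-4) by (simp add: ip_diff ip_diff_right V_diff algebra_simps)
  have "norm (ip (f i) (g i) - ip x y) \<le> nm (f i - x) * nm (g i - y) + nm (f i - x) * nm y + nm x * nm (g i - y)" for i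
  proof -
    have "\<bar>ip (f i - x) (g i - y)\<bar> \<le> nm (f i - x) * nm (g i - y)"
      "\<bar>ip (f i - x) y\<bar> \<le> nm (f i - x) * nm y" "\<bar>ip x (g i - y)\<bar> \<le> nm x * nm (g i - y)"
      using assms(1-4) by (auto intro!: ip_abs_le V_diff)
    then show ?thesis unfolding e by simp
  qed
  moreover have "((\<lambda>i. nm (f i - x) * nm (g i - y) + nm (f i - x) * nm y + nm x * nm (g i - y)) \<longlongrightarrow> 0 * 0 + 0 * nm y + nm x * 0) Q"
    by (intro tendsto_intros assms)
  ultimately have "((\<lambda>i. ip (f i) (g i) - ip x y) \<longlongrightarrow> 0) Q"
    by (intro Lim_null_comparison[where f="\<lambda>i. ip (f i) (g i) - ip x y"]) auto
  then show ?thesis by (simp add: LIM_zero_iff)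
qed

lemma nm_tendsto:
  assumes "\<And>i. f i \<in> V" "x \<in> V" "((\<lambda>i. nm (f i - x)) \<longlongrightarrow> 0) Q"
  shows "((\<lambda>i. nm (f i)) \<longlongrightarrow> nm x) Q"
  unfolding nm_def by (intro tendsto_intros ip_tendsto assms)

lemma V_minus: "x \<in> V \<Longrightarrow> - x \<in> V"
  using V_scale[of x "-1"] by simp

lemma half_square:
  assumes "x \<in> V" "y \<in> V"
  shows "(nm y)\<^sup>2 / 2 = (nm x)\<^sup>2 / 2 + ip x (y - x) + (nm (y - x))\<^sup>2 / 2"
  using assms ip_commute[of x y]
  by (simp add: nm_square V_diff ip_diff ip_diff_right field_simps)

lemma nm_replace:
  assumes "x \<in> V" "x' \<in> V" "y \<in> V" "y' \<in> V" "r \<in> V" "nm (x - x') = 0" "nm (y - y') = 0"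
  shows "nm (x - y - r) = nm (x' - y' - r)"
proof (rule nm_cong0)
  have "nm ((x - x') - (y - y')) \<le> 0"
    using nm_diff_le[of "x - x'" "y - y'"] assms by (simp add: V_diff)
  then have "nm ((x - x') - (y - y')) = 0"
    using nm_nonneg[of "(x - x') - (y - y')"] assms by (simp add: V_diff)
  also have "(x - x') - (y - y') = (x - y - r) - (x' - y' - r)" by (simp add: algebra_simps)
  finally show "nm ((x - y - r) - (x' - y' - r)) = 0" .
qed (use assms in \<open>auto intro!: V_diff\<close>)

text \<open>Expansion of the square for an increment k \<zeta> with error at most k e: the growth is
  k <x, \<zeta>> up to terms of size k e and k^2. It is used with \<zeta> = Az along semigroup
  orbits, and with \<zeta> = Phi(y(t)) and x = S(h) y(t) along the mild solution.\<close>

lemma half_square_step: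
  assumes V: "x \<in> V" "y \<in> V" "\<zeta> \<in> V" and k: "0 \<le> k" and le: "nm (y - x - k *\<^sub>R \<zeta>) \<le> k * e"
  shows "(nm y)\<^sup>2 / 2 \<le> (nm x)\<^sup>2 / 2 + k * (ip x \<zeta> + nm x * e + k * (nm \<zeta> + e)\<^sup>2 / 2)"
proof -
  define \<rho> where "\<rho> = y - x - k *\<^sub>R \<zeta>"
  have \<rho>: "\<rho> \<in> V" "nm \<rho> \<le> k * e" using V le by (auto simp: \<rho>_def intro!: V_diff V_scale)
  have yx: "y - x = k *\<^sub>R \<zeta> + \<rho>" by (simp add: \<rho>_def)
  have 1: "ip x (y - x) \<le> k * ip x \<zeta> + nm x * (k * e)"
  proof -
    have "ip x (y - x) = k * ip x \<zeta> + ip x \<rho>"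
      unfolding yx using V \<rho> by (simp add: ip_add_right ip_scale_right V_scale)
    also have "ip x \<rho> \<le> nm x * nm \<rho>" using ip_abs_le[OF V(1) \<rho>(1)] by simp
    also have "\<dots> \<le> nm x * (k * e)" using \<rho> nm_nonneg[OF V(1)] by (intro mult_left_mono)
    finally show ?thesis by simp
  qed
  have "nm (y - x) \<le> nm (k *\<^sub>R \<zeta>) + nm \<rho>" unfolding yx using V \<rho> by (intro nm_triangle V_scale)
  also have "\<dots> \<le> k * (nm \<zeta> + e)" using \<rho> k V by (simp add: nm_scale algebra_simps)
  finally have "(nm (y - x))\<^sup>2 \<le> (k * (nm \<zeta> + e))\<^sup>2"
    using nm_nonneg[of "y - x"] V by (intro power_mono) (auto simp: V_diff)
  then have "(nm y)\<^sup>2 / 2 \<le> (nm x)\<^sup>2 / 2 + (k * ip x \<zeta> + nm x * (k * e)) + (k * (nm \<zeta> + e))\<^sup>2 / 2"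
    unfolding half_square[OF V(1,2)] using 1 by (intro add_mono) auto
  also have "\<dots> = (nm x)\<^sup>2 / 2 + k * (ip x \<zeta> + nm x * e + k * (nm \<zeta> + e)\<^sup>2 / 2)"
    by (simp add: algebra_simps power2_eq_square)
  finally show ?thesis .
qed

text \<open>Curves in time are controlled only for t >= 0, so membership in V holds only eventually
  along the filter.\<close>

lemma nm_tendsto_eventually:
  assumes "\<forall>\<^sub>F i in Q. f i \<in> V" "x \<in> V" "((\<lambda>i. nm (f i - x)) \<longlongrightarrow> 0) Q"
  shows "((\<lambda>i. nm (f i)) \<longlongrightarrow> nm x) Q"
proof -
  have "((\<lambda>i. nm (f i) - nm x) \<longlongrightarrow> 0) Q"
    by (rule Lim_null_comparison[OF _ assms(3)], rule eventually_mono[OF assms(1)])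
      (use nm_diff_abs[OF _ assms(2)] in simp)
  then show ?thesis by (simp add: LIM_zero_iff)
qed

end

section \<open>L2 on the open interval as a seminormed space\<close>

section \<open>Square-integrable functions\<close>

abbreviation Mab :: "real \<Rightarrow> real \<Rightarrow> real measure"
  where "Mab a b \<equiv> lebesgue_on {a<..<b}"

definition l2ip :: "real \<Rightarrow> real \<Rightarrow> (real \<Rightarrow> real) \<Rightarrow> (real \<Rightarrow> real) \<Rightarrow> real"
  where "l2ip a b u w = (LINT x|Mab a b. u x * w x)"

lemma L2_measurable: "u \<in> L2 a b \<Longrightarrow> u \<in> borel_measurable (Mab a b)"
  by (simp add: L2_def)

lemma L2_square: "u \<in> L2 a b \<Longrightarrow> integrable (Mab a b) (\<lambda>x. (u x)\<^sup>2)"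
  by (simp add: L2_def)

lemma L2_mult:
  assumes "u \<in> L2 a b" "w \<in> L2 a b"
  shows "integrable (Mab a b) (\<lambda>x. u x * w x)"
proof (rule Bochner_Integration.integrable_bound)
  show "integrable (Mab a b) (\<lambda>x. (u x)\<^sup>2 + (w x)\<^sup>2)"
    using assms by (simp add: L2_square)
  show "(\<lambda>x. u x * w x) \<in> borel_measurable (Mab a b)"
    using assms[THEN L2_measurable] by measurable
  have "\<bar>s * t\<bar> \<le> s\<^sup>2 + t\<^sup>2" for s t :: real
  proof -
    have "2 * \<bar>s * t\<bar> \<le> s\<^sup>2 + t\<^sup>2"
      using sum_squares_bound[of "\<bar>s\<bar>" "\<bar>t\<bar>"] by (simp add: abs_mult mult.assoc)
    then show ?thesis using abs_ge_zero[of "s * t"] by linarith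
  qed
  then show "AE x in Mab a b. norm (u x * w x) \<le> norm ((u x)\<^sup>2 + (w x)\<^sup>2)"
    by simp
qed

lemma L2_add: "u \<in> L2 a b \<Longrightarrow> w \<in> L2 a b \<Longrightarrow> u + w \<in> L2 a b"
proof -
  assume a: "u \<in> L2 a b" "w \<in> L2 a b"
  have "integrable (Mab a b) (\<lambda>x. (u x)\<^sup>2 + 2 * (u x * w x) + (w x)\<^sup>2)"
    using a by (intro Bochner_Integration.integrable_add L2_square integrable_mult_right L2_mult)
  moreover have "(u + w) = (\<lambda>x. u x + w x)" by (simp add: fun_eq_iff)
  ultimately show ?thesis
    using a[THEN L2_measurable] unfolding L2_def by (simp add: power2_sum algebra_simps borel_measurable_add)
qed

lemma L2_scale: "u \<in> L2 a b \<Longrightarrow> c *\<^sub>R u \<in> L2 a b"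
  by (auto simp: L2_def scaleR_fun_def power_mult_distrib)

lemma L2_subspace: "subspace (L2 a b)"
  by (rule subspaceI) (auto simp: L2_add L2_scale, simp add: L2_def zero_fun_def)

global_interpretation l2: semi_inner "L2 a b" "l2ip a b" for a b
  defines l2nm = "semi_inner.nm (l2ip a b)"
proof
  show "l2ip a b (x + y) z = l2ip a b x z + l2ip a b y z"
    if "x \<in> L2 a b" "y \<in> L2 a b" "z \<in> L2 a b" for x y z :: "real \<Rightarrow> real"
    using that by (simp add: l2ip_def distrib_right L2_mult)
  show "l2ip a b (c *\<^sub>R x) z = c * l2ip a b x z" for x z :: "real \<Rightarrow> real" and c
    by (simp add: l2ip_def scaleR_fun_def mult.assoc)
qed (auto simp: L2_subspace l2ip_def mult.commute)

lemma l2nm_square: "u \<in> L2 a b \<Longrightarrow> (l2nm a b u)\<^sup>2 = (LINT x|Mab a b. (u x)\<^sup>2)"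
  by (simp add: l2.nm_square) (simp add: l2ip_def power2_eq_square)

lemma finite_measure_Mab: "finite_measure (Mab a b)"
  by (rule finite_measure_lebesgue_on) simp

lemma const_L2: "(\<lambda>x. c) \<in> L2 a b"
  using finite_measure.integrable_const[OF finite_measure_Mab] by (simp add: L2_def)

lemma L2_integrable: "u \<in> L2 a b \<Longrightarrow> integrable (Mab a b) u"
  using L2_mult[OF _ const_L2[of 1], of u] by simp

lemma L2_integrable_abs: "u \<in> L2 a b \<Longrightarrow> integrable (Mab a b) (\<lambda>x. \<bar>u x\<bar>)"
  using L2_integrable integrable_abs by blast

lemma bounded_L2:
  assumes "u \<in> borel_measurable (Mab a b)" "\<And>x. x \<in> {a<..<b} \<Longrightarrow> \<bar>u x\<bar> \<le> B"
  shows "u \<in> L2 a b"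
proof -
  have "integrable (Mab a b) (\<lambda>x. (u x)\<^sup>2)"
  proof (rule Bochner_Integration.integrable_bound)
    show "integrable (Mab a b) (\<lambda>x. B\<^sup>2)"
      using finite_measure.integrable_const[OF finite_measure_Mab] .
    show "AE x in Mab a b. norm ((u x)\<^sup>2) \<le> norm (B\<^sup>2)"
    proof (intro AE_I2)
      fix x assume "x \<in> space (Mab a b)"
      then have "\<bar>u x\<bar>\<^sup>2 \<le> B\<^sup>2" using assms(2)[of x] by (intro power_mono) auto
      then show "norm ((u x)\<^sup>2) \<le> norm (B\<^sup>2)" by simp
    qed
  qed (use assms in measurable)
  then show ?thesis using assms by (simp add: L2_def)
qed

lemma L2_mult_bounded:
  assumes "w \<in> L2 a b" "u \<in> borel_measurable (Mab a b)" "\<And>x. x \<in> {a<..<b} \<Longrightarrow> \<bar>u x\<bar> \<le> B"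
  shows "(\<lambda>x. u x * w x) \<in> L2 a b"
    and "l2nm a b (\<lambda>x. u x * w x) \<le> B * l2nm a b w"
proof -
  have le: "(u x * w x)\<^sup>2 \<le> B\<^sup>2 * (w x)\<^sup>2" if "x \<in> {a<..<b}" for x
    using power_mono[OF assms(3)[OF that] abs_ge_zero, of 2] unfolding power_mult_distrib
    by (intro mult_right_mono) auto
  have int: "integrable (Mab a b) (\<lambda>x. B\<^sup>2 * (w x)\<^sup>2)"
    using assms(1) by (simp add: L2_square)
  have int2: "integrable (Mab a b) (\<lambda>x. (u x * w x)\<^sup>2)"
  proof (rule Bochner_Integration.integrable_bound[OF int])
    show "(\<lambda>x. (u x * w x)\<^sup>2) \<in> borel_measurable (Mab a b)"
      using assms(2) L2_measurable[OF assms(1)] by measurable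
    show "AE x in Mab a b. norm ((u x * w x)\<^sup>2) \<le> norm (B\<^sup>2 * (w x)\<^sup>2)"
      by (rule AE_I2) (use le in simp)
  qed
  then show L: "(\<lambda>x. u x * w x) \<in> L2 a b"
    using assms(2) L2_measurable[OF assms(1)] unfolding L2_def by (simp add: borel_measurable_times)
  have "(l2nm a b (\<lambda>x. u x * w x))\<^sup>2 \<le> (LINT x|Mab a b. B\<^sup>2 * (w x)\<^sup>2)"
    unfolding l2nm_square[OF L] by (rule integral_mono[OF int2 int]) (use le in simp)
  also have "\<dots> = (B * l2nm a b w)\<^sup>2"
    using assms(1) by (simp add: l2nm_square power_mult_distrib)
  finally have q: "(l2nm a b (\<lambda>x. u x * w x))\<^sup>2 \<le> (B * l2nm a b w)\<^sup>2" .
  show "l2nm a b (\<lambda>x. u x * w x) \<le> B * l2nm a b w"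
  \<comment> \<open>On an empty interval the bound says nothing about the sign of B, but then all
    norms vanish.\<close>
  proof (cases "a < b")
    case True
    then have "B \<ge> 0" using assms(3)[of "(a+b)/2"] by force
    then show ?thesis
      using power2_le_imp_le[OF q] l2.nm_nonneg[OF assms(1)] by simp
  next
    case False
    then have "l2nm a b u = 0" for u
      by (simp add: l2.nm_def l2ip_def integral_lebesgue_on_empty)
    then show ?thesis by simp
  qed
qed

lemma continuous_measurable_Mab: "continuous_on {a..b} u \<Longrightarrow> u \<in> borel_measurable (Mab a b)"
  by (rule continuous_imp_measurable_on_sets_lebesgue) (auto elim: continuous_on_subset)

lemma continuous_bounded_ivl:
  fixes u :: "real \<Rightarrow> real"
  assumes "continuous_on {a..b} u"
  obtains B where "B \<ge> 0" "\<And>x. x \<in> {a..b} \<Longrightarrow> \<bar>u x\<bar> \<le> B"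
proof -
  have "bounded (u ` {a..b})"
    using compact_continuous_image[OF assms] compact_imp_bounded by blast
  then obtain B where "B > 0" "\<And>x. x \<in> {a..b} \<Longrightarrow> \<bar>u x\<bar> \<le> B"
    unfolding bounded_pos by auto
  then show ?thesis using that[of B] by simp
qed

lemma continuous_L2: "continuous_on {a..b} u \<Longrightarrow> u \<in> L2 a b"
proof -
  assume c: "continuous_on {a..b} u"
  obtain B where "\<And>x. x \<in> {a..b} \<Longrightarrow> \<bar>u x\<bar> \<le> B"
    using continuous_bounded_ivl[OF c] by blast
  then show ?thesis
    by (intro bounded_L2[OF continuous_measurable_Mab[OF c], of B]) auto
qed

text \<open>Cauchy-Schwarz against the constant function 1.\<close>

lemma L1_le_l2nm:
  assumes "u \<in> L2 a b" "a < b"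
  shows "(LINT x|Mab a b. \<bar>u x\<bar>) \<le> sqrt (b - a) * l2nm a b u"
proof -
  have ab: "(\<lambda>x. \<bar>u x\<bar>) \<in> L2 a b"
    using assms(1) borel_measurable_abs[OF L2_measurable[OF assms(1)]] by (simp add: L2_def)
  have "l2nm a b (\<lambda>x. \<bar>u x\<bar>) = l2nm a b u"
    unfolding l2.nm_def l2ip_def abs_mult_self_eq ..
  moreover have "l2nm a b (\<lambda>x. 1) = sqrt (b - a)"
    using assms(2) unfolding l2.nm_def l2ip_def by (simp add: measure_restrict_space)
  moreover have "\<bar>l2ip a b (\<lambda>x. 1) (\<lambda>x. \<bar>u x\<bar>)\<bar> \<le> l2nm a b (\<lambda>x. 1) * l2nm a b (\<lambda>x. \<bar>u x\<bar>)"
    by (intro l2.ip_abs_le const_L2 ab)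
  ultimately show ?thesis by (simp add: l2ip_def)
qed

section \<open>Density in L2 by cutoff, Weierstrass approximation and truncation\<close>

section \<open>Density of test functions\<close>

text \<open>Squaring the positive part removes its corner at 0, which makes it a C1 building block
  for \<open>ramp\<close>.\<close>

lemma DERIV_pos_part_square: "((\<lambda>s. (max 0 s)\<^sup>2) has_real_derivative 2 * max 0 s) (at (s::real))"
proof -
  consider "s > 0" | "s < 0" | "s = 0" by linarith
  then show ?thesis
  proof cases
    case 1
    have "((\<lambda>s. s\<^sup>2) has_real_derivative 2 * s) (at s)"
      by (auto intro!: derivative_eq_intros)
    then show ?thesis
      using 1 by (subst DERIV_cong_ev[OF refl _ refl, of _ "\<lambda>s. s\<^sup>2"])
        (auto intro!: eventually_mono[OF eventually_nhds_in_open[of "{0<..}"]])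
  next
    case 2
    have "((\<lambda>s. 0) has_real_derivative 0) (at s)" by simp
    then show ?thesis
      using 2 by (subst DERIV_cong_ev[OF refl _ refl, of _ "\<lambda>s. 0"])
        (auto intro!: eventually_mono[OF eventually_nhds_in_open[of "{..<0}"]])
  next
    case 3
    have "((\<lambda>h. (max 0 h)\<^sup>2 / h) \<longlongrightarrow> 0) (at (0::real))"
    proof (rule Lim_null_comparison)
      show "\<forall>\<^sub>F h in at 0. norm ((max 0 h)\<^sup>2 / h) \<le> \<bar>h\<bar>"
        by (intro always_eventually allI) (auto simp: max_def power2_eq_square)
      show "((\<lambda>h. \<bar>h\<bar>) \<longlongrightarrow> 0) (at (0::real))" by real_asymp
    qed
    then show ?thesis using 3 by (simp add: DERIV_def)
  qed
qed

text \<open>A monotone \<open>C\<^sup>1\<close> transition from \<open>0\<close> on \<open>s \<le> 0\<close> to \<open>1\<close> on \<open>s \<ge> 1\<close>.\<close>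

definition ramp :: "real \<Rightarrow> real" where "ramp s = 1 - (max 0 (1 - (max 0 s)\<^sup>2))\<^sup>2"

definition ramp' :: "real \<Rightarrow> real" where "ramp' s = 4 * max 0 (1 - (max 0 s)\<^sup>2) * max 0 s"

lemma DERIV_ramp: "(ramp has_real_derivative ramp' s) (at s)"
proof -
  have "((\<lambda>s. 1 - (max 0 (1 - (max 0 s)\<^sup>2))\<^sup>2) has_real_derivative
      0 - 2 * max 0 (1 - (max 0 s)\<^sup>2) * (0 - 2 * max 0 s)) (at s)"
    by (intro DERIV_diff DERIV_const DERIV_chain2[OF DERIV_pos_part_square] DERIV_pos_part_square)
  then show ?thesis
    unfolding ramp_def[abs_def] ramp'_def by (simp add: algebra_simps)
qed

lemma continuous_ramp': "continuous_on S ramp'"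
  unfolding ramp'_def by (intro continuous_intros)

lemma continuous_ramp: "continuous_on S ramp"
  unfolding ramp_def by (intro continuous_intros)

lemma ramp_0: "s \<le> 0 \<Longrightarrow> ramp s = 0"
  by (simp add: ramp_def)

lemma ramp_1: "s \<ge> 1 \<Longrightarrow> ramp s = 1"
  using power_mono[of 1 s 2] by (simp add: ramp_def)

lemma ramp'_0: "s \<notin> {0<..<1} \<Longrightarrow> ramp' s = 0"
proof -
  assume s: "s \<notin> {0<..<1}"
  have "max 0 (1 - s\<^sup>2) = 0" if "1 \<le> s" using power_mono[OF that, of 2] by simp
  with s show ?thesis by (cases "1 \<le> s") (auto simp: ramp'_def)
qed

lemma ramp'_nonneg: "ramp' s \<ge> 0"
  by (simp add: ramp'_def)

lemma ramp_bounds: "0 \<le> ramp s" "ramp s \<le> 1"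
proof -
  have "max 0 (1 - (max 0 s)\<^sup>2) \<le> 1" by simp
  then have "(max 0 (1 - (max 0 s)\<^sup>2))\<^sup>2 \<le> 1\<^sup>2" by (intro power_mono) auto
  then show "0 \<le> ramp s" "ramp s \<le> 1" by (auto simp: ramp_def)
qed

lemma C1_UNIV_iff:
  "(f::real\<Rightarrow>real) C1_differentiable_on UNIV \<longleftrightarrow>
    (\<exists>D. (\<forall>x. (f has_real_derivative D x) (at x)) \<and> continuous_on UNIV D)"
  by (auto simp: C1_differentiable_on_def has_real_derivative_iff_has_vector_derivative)

lemma test_functionsI:
  assumes "\<And>x. (\<phi> has_real_derivative D x) (at x)" "continuous_on UNIV D"
    and "\<And>x. x \<notin> {c..d} \<Longrightarrow> \<phi> x = 0" "a < c" "d < b"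
  shows "\<phi> \<in> test_functions a b"
proof -
  have "closure {x. \<phi> x \<noteq> 0} \<subseteq> {c..d}"
    using assms(3) by (intro closure_minimal subsetI) (blast, simp)
  then show ?thesis
    using assms unfolding test_functions_def C1_UNIV_iff by fastforce
qed

lemma test_functionsE:
  assumes "\<phi> \<in> test_functions a b"
  obtains "\<And>x. (\<phi> has_real_derivative deriv \<phi> x) (at x)" "continuous_on UNIV (deriv \<phi>)"
    "continuous_on UNIV \<phi>" "\<And>x. x \<notin> {a<..<b} \<Longrightarrow> \<phi> x = 0"
proof -
  obtain D where D: "\<And>x. (\<phi> has_real_derivative D x) (at x)" "continuous_on UNIV D"
    using assms unfolding test_functions_def C1_UNIV_iff by blast
  then have "deriv \<phi> = D" using DERIV_imp_deriv by blast
  moreover have "continuous_on UNIV \<phi>"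
    using D(1) DERIV_isCont continuous_at_imp_continuous_on by blast
  moreover have "\<phi> x = 0" if "x \<notin> {a<..<b}" for x
  proof (rule ccontr)
    assume "\<phi> x \<noteq> 0"
    then have "x \<in> closure {x. \<phi> x \<noteq> 0}" by (intro subsetD[OF closure_subset]) auto
    then show False using assms that by (auto simp: test_functions_def)
  qed
  ultimately show ?thesis using that D by blast
qed

lemma test_L2: "\<phi> \<in> test_functions a b \<Longrightarrow> \<phi> \<in> L2 a b"
  by (elim test_functionsE, intro continuous_L2) (auto elim: continuous_on_subset)

lemma test_deriv_L2: "\<phi> \<in> test_functions a b \<Longrightarrow> deriv \<phi> \<in> L2 a b"
  by (elim test_functionsE, intro continuous_L2) (auto elim: continuous_on_subset)

lemma l2nm_tendsto_dominated:
  assumes "\<And>n. f n \<in> borel_measurable (Mab a b)" "g \<in> borel_measurable (Mab a b)"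
    and "integrable (Mab a b) H" "AE x in Mab a b. (\<lambda>n. f n x) \<longlonglongrightarrow> g x"
    and "\<And>n. AE x in Mab a b. (f n x - g x)\<^sup>2 \<le> H x"
  shows "(\<lambda>n::nat. l2nm a b (g - f n)) \<longlonglongrightarrow> 0"
proof -
  have "(\<lambda>n. LINT x|Mab a b. (f n x - g x)\<^sup>2) \<longlonglongrightarrow> (LINT x|Mab a b. 0)"
  proof (rule integral_dominated_convergence[OF _ _ assms(3)])
    show "(\<lambda>x. (f n x - g x)\<^sup>2) \<in> borel_measurable (Mab a b)" for n
      using assms(1)[of n] assms(2) by measurable
    show "AE x in Mab a b. (\<lambda>n. (f n x - g x)\<^sup>2) \<longlonglongrightarrow> 0"
      using assms(4)
    proof eventually_elim
      case (elim x)
      from tendsto_power[OF tendsto_diff[OF elim tendsto_const[of "g x"]], of 2] show ?case by simp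
    qed
    show "AE x in Mab a b. norm ((f n x - g x)\<^sup>2) \<le> H x" for n
      using assms(5)[of n] by simp
  qed simp
  then have "(\<lambda>n. sqrt (LINT x|Mab a b. (f n x - g x)\<^sup>2)) \<longlonglongrightarrow> sqrt 0"
    by (intro tendsto_real_sqrt) simp
  moreover have "l2nm a b (g - f n) = sqrt (LINT x|Mab a b. (f n x - g x)\<^sup>2)" for n
    by (simp add: l2.nm_def l2ip_def power2_eq_square algebra_simps)
  ultimately show ?thesis by simp
qed

definition test_approx :: "real \<Rightarrow> real \<Rightarrow> (real \<Rightarrow> real) \<Rightarrow> bool" where
  "test_approx a b w \<longleftrightarrow> (\<forall>e>0. \<exists>\<phi>\<in>test_functions a b. l2nm a b (w - \<phi>) < e)"

lemma test_approx_closed: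
  assumes "w \<in> L2 a b" "\<And>e. e > 0 \<Longrightarrow> \<exists>w'\<in>L2 a b. test_approx a b w' \<and> l2nm a b (w - w') < e"
  shows "test_approx a b w"
  unfolding test_approx_def
proof (intro allI impI)
  fix e :: real assume "e > 0"
  then obtain w' where w': "w' \<in> L2 a b" "test_approx a b w'" "l2nm a b (w - w') < e / 2"
    using assms(2)[of "e/2"] by auto
  then obtain \<phi> where \<phi>: "\<phi> \<in> test_functions a b" "l2nm a b (w' - \<phi>) < e / 2"
    using \<open>e > 0\<close> half_gt_zero unfolding test_approx_def by blast
  have "l2nm a b (w - \<phi>) \<le> l2nm a b (w - w') + l2nm a b (w' - \<phi>)"
    using assms(1) w'(1) test_L2[OF \<phi>(1)] by (rule l2.nm_triangle3)
  with w' \<phi> show "\<exists>\<phi>\<in>test_functions a b. l2nm a b (w - \<phi>) < e" by force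
qed

lemma test_approx_limit:
  assumes "w \<in> L2 a b" "\<And>n::nat. f n \<in> L2 a b" "\<And>n. test_approx a b (f n)"
    "(\<lambda>n. l2nm a b (w - f n)) \<longlonglongrightarrow> 0"
  shows "test_approx a b w"
proof (rule test_approx_closed[OF assms(1)])
  fix e :: real assume "e > 0"
  then have "\<forall>\<^sub>F n in sequentially. l2nm a b (w - f n) < e"
    using order_tendstoD(2)[OF assms(4)] by blast
  then obtain n where "l2nm a b (w - f n) < e" using eventually_happens by force
  then show "\<exists>w'\<in>L2 a b. test_approx a b w' \<and> l2nm a b (w - w') < e"
    using assms by blast
qed

text \<open>Cutting off near both endpoints turns a C1 function into a test function. The cutoffs
  lie between 0 and 1 and are eventually 1 at every interior point, so P^2 dominates the squared
  error.\<close>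

lemma test_approx_C1:
  assumes P: "\<And>x. (P has_real_derivative D x) (at x)" "continuous_on UNIV D"
  shows "test_approx a b P"
proof -
  \<comment> \<open>The shift by 1 makes the cutoff vanish on a strip of width 1/(n+1) at each end,
    which keeps the support at positive distance from a and b.\<close>
  define cut where "cut n x = ramp (real (Suc n) * (x - a) - 1) * ramp (real (Suc n) * (b - x) - 1)" for n x
  have cP: "continuous_on UNIV P"
    using P(1) DERIV_isCont continuous_at_imp_continuous_on by blast
  have ccut: "continuous_on S (cut n)" for n S
    unfolding cut_def by (intro continuous_intros continuous_on_compose2[OF continuous_ramp[of UNIV]]) auto
  have PL: "P \<in> L2 a b" by (intro continuous_L2 continuous_on_subset[OF cP]) auto
  have L: "(\<lambda>x. P x * cut n x) \<in> L2 a b" for n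
    by (intro continuous_L2 continuous_intros ccut continuous_on_subset[OF cP]) auto
  have t: "(\<lambda>x. P x * cut n x) \<in> test_functions a b" for n
  proof (rule test_functionsI)
    let ?n = "real (Suc n)"
    show "((\<lambda>x. P x * cut n x) has_real_derivative
      (D x * cut n x + ((ramp' (?n * (x - a) - 1) * ?n) * ramp (?n * (b - x) - 1) +
       (ramp' (?n * (b - x) - 1) * (- ?n)) * ramp (?n * (x - a) - 1)) * P x)) (at x)" for x
      unfolding cut_def
      by (intro DERIV_mult P DERIV_chain2[OF DERIV_ramp]) (auto intro!: derivative_eq_intros)
    show "continuous_on UNIV (\<lambda>x. D x * cut n x + ((ramp' (?n * (x - a) - 1) * ?n) * ramp (?n * (b - x) - 1) +
       (ramp' (?n * (b - x) - 1) * (- ?n)) * ramp (?n * (x - a) - 1)) * P x)"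
      by (intro continuous_intros P cP ccut continuous_on_compose2[OF continuous_ramp[of UNIV]]
          continuous_on_compose2[OF continuous_ramp'[of UNIV]]) auto
    show "P x * cut n x = 0" if "x \<notin> {a + 1 / ?n .. b - 1 / ?n}" for x
    proof -
      have "?n * (x - a) - 1 \<le> 0 \<or> ?n * (b - x) - 1 \<le> 0"
        using that by (auto simp: field_simps)
      then show ?thesis by (auto simp: cut_def ramp_0)
    qed
  qed auto
  have cutb: "\<bar>cut n x - 1\<bar> \<le> 1" for n x
  proof -
    have "0 \<le> cut n x" "cut n x \<le> 1"
      unfolding cut_def by (auto intro!: mult_nonneg_nonneg mult_le_one ramp_bounds)
    then show ?thesis by simp
  qed
  show ?thesis
  proof (rule test_approx_limit[OF PL L])
    show "test_approx a b (\<lambda>x. P x * cut n x)" for n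
      unfolding test_approx_def by (intro allI impI bexI[OF _ t[of n]]) (simp add: l2.nm_zero)
    show "(\<lambda>n. l2nm a b (P - (\<lambda>x. P x * cut n x))) \<longlonglongrightarrow> 0"
    proof (rule l2nm_tendsto_dominated[OF L2_measurable[OF L] L2_measurable[OF PL] L2_square[OF PL]])
      have "(\<lambda>n. P x * cut n x) \<longlonglongrightarrow> P x" if "x \<in> {a<..<b}" for x
      proof (rule tendsto_eventually)
        have "\<forall>\<^sub>F n in sequentially. real (Suc n) * (x - a) - 1 \<ge> 1"
          using that by (simp, real_asymp)
        moreover have "\<forall>\<^sub>F n in sequentially. real (Suc n) * (b - x) - 1 \<ge> 1"
          using that by (simp, real_asymp)
        ultimately show "\<forall>\<^sub>F n in sequentially. P x * cut n x = P x"
          by eventually_elim (simp add: cut_def ramp_1)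
      qed
      then show "AE x in Mab a b. (\<lambda>n. P x * cut n x) \<longlonglongrightarrow> P x" by (intro AE_I2) auto
      have "(P x * cut n x - P x)\<^sup>2 \<le> (P x)\<^sup>2" for n x
      proof -
        have "(P x * cut n x - P x)\<^sup>2 = (P x)\<^sup>2 * (cut n x - 1)\<^sup>2"
          by (simp add: power2_eq_square algebra_simps)
        also have "\<dots> \<le> (P x)\<^sup>2 * 1"
          using power_mono[OF cutb[of n x], of 2] by (intro mult_left_mono) auto
        finally show ?thesis by simp
      qed
      then show "AE x in Mab a b. (P x * cut n x - P x)\<^sup>2 \<le> (P x)\<^sup>2" for n by simp
    qed
  qed
qed

lemma l2nm_le_bound:
  assumes "u \<in> L2 a b" "a < b" "\<And>x. x \<in> {a<..<b} \<Longrightarrow> \<bar>u x\<bar> \<le> B"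
  shows "l2nm a b u \<le> sqrt (b - a) * B"
proof -
  have "l2nm a b (\<lambda>x. u x * 1) \<le> B * l2nm a b (\<lambda>x. 1)"
    by (intro L2_mult_bounded const_L2 L2_measurable assms)
  moreover have "l2nm a b (\<lambda>x. 1) = sqrt (b - a)"
    using assms(2) unfolding l2.nm_def l2ip_def by (simp add: measure_restrict_space)
  ultimately show ?thesis by (simp add: mult.commute)
qed

text \<open>Weierstrass: a uniformly close polynomial is C1, and on a bounded interval uniform
  closeness controls the L2 norm.\<close>

lemma test_approx_continuous:
  assumes "continuous_on {a..b} g" "a < b"
  shows "test_approx a b g"
proof (rule test_approx_closed)
  show gL: "g \<in> L2 a b" using assms(1) by (rule continuous_L2)
  fix e :: real assume e: "e > 0"
  \<comment> \<open>A uniform error e' costs sqrt (b - a) * e' = e / 2 in L2.\<close>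
  define e' where "e' = e / (2 * sqrt (b - a))"
  have "e' > 0" using e assms by (simp add: e'_def)
  then obtain P where P: "polynomial_function P" "\<And>x. x \<in> {a..b} \<Longrightarrow> norm (g x - P x) < e'"
    using Stone_Weierstrass_polynomial_function[OF compact_Icc assms(1)] by metis
  obtain P' where P': "polynomial_function P'" "\<And>x. (P has_vector_derivative P' x) (at x)"
    using has_vector_derivative_polynomial_function[OF P(1)] by metis
  have cont: "continuous_on S P" "continuous_on S P'" for S
    by (rule continuous_on_polymonial_function[OF P(1)], rule continuous_on_polymonial_function[OF P'(1)])
  then have PL: "P \<in> L2 a b" by (intro continuous_L2)
  have "test_approx a b P"
    by (rule test_approx_C1[of _ P'])
      (auto simp: has_real_derivative_iff_has_vector_derivative P' cont)
  moreover have "l2nm a b (g - P) \<le> sqrt (b - a) * e'"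
    by (rule l2nm_le_bound) (use gL PL assms P(2) in \<open>auto intro!: l2.V_diff less_imp_le\<close>)
  moreover have "sqrt (b - a) * e' < e" using e assms by (simp add: e'_def)
  ultimately show "\<exists>w'\<in>L2 a b. test_approx a b w' \<and> l2nm a b (g - w') < e"
    using PL by (intro bexI[of _ P]) auto
qed

definition trunc :: "real \<Rightarrow> real \<Rightarrow> real" where "trunc B s = max (- B) (min B s)"

lemma continuous_trunc: "continuous_on UNIV (trunc B)"
  unfolding trunc_def by (intro continuous_intros)

lemma trunc_bound: "B \<ge> 0 \<Longrightarrow> \<bar>trunc B s\<bar> \<le> B"
  by (auto simp: trunc_def)

lemma trunc_eq: "\<bar>s\<bar> \<le> B \<Longrightarrow> trunc B s = s"
  by (auto simp: trunc_def)

text \<open>A measurable function is an almost everywhere limit of continuous ones. Truncating these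
  at the bound B of w leaves the limit unchanged and makes the constant (2 B)^2 a dominating
  function.\<close>

lemma test_approx_bounded:
  assumes w: "w \<in> borel_measurable (Mab a b)" "\<And>x. x \<in> {a<..<b} \<Longrightarrow> \<bar>w x\<bar> \<le> B" and ab: "a < b" and "B \<ge> 0"
  shows "test_approx a b w"
proof -
  have "w measurable_on {a<..<b}"
    using w(1) by (subst measurable_on_iff_borel_measurable) simp_all
  then obtain N g where N: "negligible N" and g: "\<And>n. continuous_on UNIV (g n)"
    and lim: "\<And>x. x \<notin> N \<Longrightarrow> (\<lambda>n. g n x) \<longlonglongrightarrow> (if x \<in> {a<..<b} then w x else 0)"
    unfolding measurable_on_def by blast
  define h where "h n = (\<lambda>x. trunc B (g n x))" for n :: nat
  have ch: "continuous_on S (h n)" for n S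
    unfolding h_def by (intro continuous_on_compose2[OF continuous_trunc] continuous_on_subset[OF g]) auto
  have hL: "h n \<in> L2 a b" for n by (intro continuous_L2 ch)
  show ?thesis
  proof (rule test_approx_limit[OF bounded_L2[OF w] hL])
    show "test_approx a b (h n)" for n by (intro test_approx_continuous ch ab)
    show "(\<lambda>n. l2nm a b (w - h n)) \<longlonglongrightarrow> 0"
    proof (rule l2nm_tendsto_dominated[OF L2_measurable[OF hL] w(1), of "\<lambda>x. (2 * B)\<^sup>2"])
      show "integrable (Mab a b) (\<lambda>x. (2 * B)\<^sup>2)"
        using finite_measure.integrable_const[OF finite_measure_Mab] .
      have "AE x in lebesgue. x \<notin> N"
        using N by (simp add: negligible_iff_null_sets AE_not_in)
      then have "AE x in Mab a b. x \<notin> N"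
        by (simp add: AE_restrict_space_iff) (auto elim: eventually_mono)
      moreover have "AE x in Mab a b. x \<in> {a<..<b}" by (intro AE_I2) auto
      ultimately show "AE x in Mab a b. (\<lambda>n. h n x) \<longlonglongrightarrow> w x"
      proof eventually_elim
        case (elim x)
        have "(\<lambda>n. trunc B (g n x)) \<longlonglongrightarrow> trunc B (w x)"
          using lim[OF elim(1)] elim(2) continuous_trunc[of B]
          by (intro isCont_tendsto_compose[of _ "trunc B"]) (auto simp: continuous_on_eq_continuous_at)
        then show ?case using w(2)[OF elim(2)] by (simp add: h_def trunc_eq)
      qed
      show "AE x in Mab a b. (h n x - w x)\<^sup>2 \<le> (2 * B)\<^sup>2" for n
      proof (rule AE_I2)
        fix x assume "x \<in> space (Mab a b)"
        then have "\<bar>h n x - w x\<bar> \<le> 2 * B"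
          using w(2)[of x] trunc_bound[OF \<open>B \<ge> 0\<close>, of "g n x"] unfolding h_def by auto
        then have "\<bar>h n x - w x\<bar>\<^sup>2 \<le> (2 * B)\<^sup>2" by (intro power_mono) auto
        then show "(h n x - w x)\<^sup>2 \<le> (2 * B)\<^sup>2" by simp
      qed
    qed
  qed auto
qed

text \<open>Truncation at level n reduces to bounded functions; the truncation error is at most |w|
  pointwise, so w^2 dominates its square.\<close>

theorem test_functions_dense:
  assumes w: "w \<in> L2 a b" and ab: "a < b"
  shows "test_approx a b w"
proof -
  define h where "h n = (\<lambda>x. trunc (real n) (w x))" for n
  have tm: "trunc B \<in> borel_measurable borel" for B
    using continuous_trunc by (rule borel_measurable_continuous_onI)
  have hm: "h n \<in> borel_measurable (Mab a b)" for n
    unfolding h_def using tm L2_measurable[OF w] by measurable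
  have hb: "\<bar>h n x\<bar> \<le> real n" for n x unfolding h_def by (rule trunc_bound) simp
  show ?thesis
  proof (rule test_approx_limit[OF w bounded_L2[OF hm hb]])
    show "test_approx a b (h n)" for n by (rule test_approx_bounded[OF hm hb ab]) simp
    show "(\<lambda>n. l2nm a b (w - h n)) \<longlonglongrightarrow> 0"
    proof (rule l2nm_tendsto_dominated[OF hm L2_measurable[OF w] L2_square[OF w]])
      have "(\<lambda>n. h n x) \<longlonglongrightarrow> w x" for x
      proof (rule tendsto_eventually)
        have "\<forall>\<^sub>F n in sequentially. real n \<ge> \<bar>w x\<bar>" by real_asymp
        then show "\<forall>\<^sub>F n in sequentially. h n x = w x"
          by eventually_elim (simp add: h_def trunc_eq)
      qed
      then show "AE x in Mab a b. (\<lambda>n. h n x) \<longlonglongrightarrow> w x" by simp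
      have "\<bar>trunc (real n) s - s\<bar> \<le> \<bar>s\<bar>" for n s by (auto simp: trunc_def)
      then have "(h n x - w x)\<^sup>2 \<le> (w x)\<^sup>2" for n x
        unfolding h_def abs_le_square_iff[symmetric] .
      then show "AE x in Mab a b. (h n x - w x)\<^sup>2 \<le> (w x)\<^sup>2" for n by simp
    qed
  qed
qed

section \<open>Uniqueness, fundamental theorem, embedding and integration by parts\<close>

section \<open>Weak derivatives in one dimension\<close>

lemma LINT_eq_integral:
  fixes f :: "real \<Rightarrow> real"
  shows "continuous_on {a..b} f \<Longrightarrow> (LINT x|Mab a b. f x) = integral {a..b} f"
  using lebesgue_integral_eq_integral[OF L2_integrable[OF continuous_L2], of a b f]
  by (simp add: integral_open_interval_real)

lemma LINT_deriv:
  assumes "a \<le> b" "\<And>x. x \<in> {a..b} \<Longrightarrow> (f has_real_derivative f' x) (at x within {a..b})"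
    "continuous_on {a..b} f'"
  shows "(LINT x|Mab a b. f' x) = f b - f a"
proof -
  have "(f' has_integral (f b - f a)) {a..b}"
    using assms by (intro fundamental_theorem_of_calculus)
      (auto simp: has_real_derivative_iff_has_vector_derivative)
  then show ?thesis using assms(3) by (simp add: LINT_eq_integral integral_unique)
qed

lemma has_weak_deriv_iff:
  "has_weak_deriv a b u p \<longleftrightarrow> u \<in> L2 a b \<and> p \<in> L2 a b \<and>
    (\<forall>\<phi>\<in>test_functions a b. l2ip a b u (deriv \<phi>) = - l2ip a b p \<phi>)"
  by (simp add: has_weak_deriv_def l2ip_def)

lemma has_weak_deriv_L2: "has_weak_deriv a b u p \<Longrightarrow> u \<in> L2 a b" "has_weak_deriv a b u p \<Longrightarrow> p \<in> L2 a b"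
  by (auto simp: has_weak_deriv_def)

lemma has_weak_deriv_add:
  assumes "has_weak_deriv a b u p" "has_weak_deriv a b v q"
  shows "has_weak_deriv a b (u + v) (p + q)"
  using assms unfolding has_weak_deriv_iff
  by (simp add: l2.ip_add test_L2 test_deriv_L2 L2_add)

lemma has_weak_deriv_scale:
  assumes "has_weak_deriv a b u p"
  shows "has_weak_deriv a b (c *\<^sub>R u) (c *\<^sub>R p)"
  using assms unfolding has_weak_deriv_iff
  by (simp add: l2.ip_scale test_L2 test_deriv_L2 L2_scale)

lemma has_weak_deriv_diff:
  assumes "has_weak_deriv a b u p" "has_weak_deriv a b v q"
  shows "has_weak_deriv a b (u - v) (p - q)"
  using assms unfolding has_weak_deriv_iff
  by (simp add: l2.ip_diff test_L2 test_deriv_L2 l2.V_diff)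

lemma has_weak_deriv_cong:
  assumes "has_weak_deriv a b u p" "u' \<in> L2 a b" "p' \<in> L2 a b" "l2nm a b (u - u') = 0" "l2nm a b (p - p') = 0"
  shows "has_weak_deriv a b u' p'"
  using assms l2.ip_cong0[of u a b u'] l2.ip_cong0[of p a b p'] unfolding has_weak_deriv_iff
  by (metis test_L2 test_deriv_L2)

text \<open>The difference d = p - q is orthogonal to every test function. If |d| > 0, a test
  function \<phi> closer to d than |d| gives |d|^2 = <d, d - \<phi>> < |d|^2.\<close>

lemma has_weak_deriv_unique:
  assumes "has_weak_deriv a b u p" "has_weak_deriv a b u q" "a < b"
  shows "l2nm a b (p - q) = 0"
proof (rule ccontr)
  assume n: "l2nm a b (p - q) \<noteq> 0"
  have pq: "p - q \<in> L2 a b" using assms by (auto simp: has_weak_deriv_L2 l2.V_diff)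
  then have pos: "l2nm a b (p - q) > 0" using n l2.nm_nonneg[OF pq] by simp
  then obtain \<phi> where \<phi>: "\<phi> \<in> test_functions a b" "l2nm a b (p - q - \<phi>) < l2nm a b (p - q)"
    using test_functions_dense[OF pq assms(3)] unfolding test_approx_def by blast
  have \<phi>L: "\<phi> \<in> L2 a b" using \<phi>(1) by (rule test_L2)
  have "l2ip a b (p - q) \<phi> = l2ip a b p \<phi> - l2ip a b q \<phi>"
    using assms \<phi>L by (auto simp: has_weak_deriv_L2 l2.ip_diff)
  also have "\<dots> = 0"
    using assms \<phi>(1) by (auto simp: has_weak_deriv_iff)
  finally have "(l2nm a b (p - q))\<^sup>2 = l2ip a b (p - q) (p - q - \<phi>)"
    using pq \<phi>L by (simp add: l2.nm_square l2.ip_diff_right)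
  also have "\<dots> \<le> l2nm a b (p - q) * l2nm a b (p - q - \<phi>)"
    using l2.ip_abs_le[OF pq l2.V_diff[OF pq \<phi>L]] by simp
  also have "\<dots> < l2nm a b (p - q) * l2nm a b (p - q)"
    using pos \<phi>(2) by (rule mult_strict_left_mono[rotated])
  finally show False by (simp add: power2_eq_square)
qed

lemma has_weak_deriv_weak_deriv: "has_weak_deriv a b u p \<Longrightarrow> has_weak_deriv a b u (weak_deriv a b u)"
  unfolding weak_deriv_def by (rule someI[of "has_weak_deriv a b u"])

lemma weak_deriv_eq:
  assumes "has_weak_deriv a b u p" "a < b"
  shows "l2nm a b (weak_deriv a b u - p) = 0"
  using has_weak_deriv_unique[OF has_weak_deriv_weak_deriv[OF assms(1)] assms] .

lemma test_seq:
  assumes "w \<in> L2 a b" "a < b"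
  obtains \<phi> :: "nat \<Rightarrow> real \<Rightarrow> real" where "\<And>n. \<phi> n \<in> test_functions a b" "(\<lambda>n. l2nm a b (\<phi> n - w)) \<longlonglongrightarrow> 0"
proof -
  have "\<exists>\<phi>\<in>test_functions a b. l2nm a b (w - \<phi>) < inverse (real (Suc n))" for n
    using test_functions_dense[OF assms] by (simp add: test_approx_def)
  then obtain \<phi> where \<phi>: "\<And>n. \<phi> n \<in> test_functions a b" "\<And>n. l2nm a b (w - \<phi> n) < inverse (real (Suc n))"
    by metis
  have "(\<lambda>n. l2nm a b (\<phi> n - w)) \<longlonglongrightarrow> 0"
  proof (rule Lim_null_comparison[OF always_eventually LIMSEQ_inverse_real_of_nat], rule allI)
    show "norm (l2nm a b (\<phi> n - w)) \<le> inverse (real (Suc n))" for n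
      using \<phi>(2)[of n] l2.nm_minus_commute[OF assms(1) test_L2[OF \<phi>(1)], of n]
        l2.nm_nonneg[OF l2.V_diff[OF test_L2[OF \<phi>(1)] assms(1)], of n] by simp
  qed
  with \<phi>(1) show ?thesis by (rule that)
qed

subsection \<open>The fundamental theorem of calculus\<close>

text \<open>The kernel is a rescaled \<open>ramp'\<close>: nonnegative, of integral 1, and zero off
  the window from c + \<alpha>/\<nu> to c + (\<alpha>+1)/\<nu>. An average against it deviates from
  m no more than u does on the window.\<close>

lemma ramp_average:
  assumes u: "continuous_on {a..b} u" and ab: "a < b" and \<nu>: "\<nu> > 0"
    and W: "a \<le> c + \<alpha> / \<nu>" "c + (\<alpha> + 1) / \<nu> \<le> b"
    and e: "\<And>x. x \<in> {c + \<alpha> / \<nu> .. c + (\<alpha> + 1) / \<nu>} \<Longrightarrow> \<bar>u x - m\<bar> \<le> e"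
  shows "\<bar>l2ip a b u (\<lambda>x. \<nu> * ramp' (\<nu> * (x - c) - \<alpha>)) - m\<bar> \<le> e"
proof -
  define \<rho> where "\<rho> x = \<nu> * ramp' (\<nu> * (x - c) - \<alpha>)" for x
  have c\<rho>: "continuous_on S \<rho>" for S
    unfolding \<rho>_def by (intro continuous_intros continuous_on_compose2[OF continuous_ramp'[of UNIV]]) auto
  have \<rho>0: "\<rho> x \<ge> 0" for x using \<nu> ramp'_nonneg by (simp add: \<rho>_def)
  have "(LINT x|Mab a b. \<rho> x) = ramp (\<nu> * (b - c) - \<alpha>) - ramp (\<nu> * (a - c) - \<alpha>)"
  proof (rule LINT_deriv)
    show "((\<lambda>x. ramp (\<nu> * (x - c) - \<alpha>)) has_real_derivative \<rho> x) (at x within {a..b})" for x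
    proof (rule has_field_derivative_at_within)
      have "((\<lambda>x. ramp (\<nu> * (x - c) - \<alpha>)) has_real_derivative ramp' (\<nu> * (x - c) - \<alpha>) * \<nu>) (at x)"
        by (rule DERIV_chain2[OF DERIV_ramp]) (auto intro!: derivative_eq_intros)
      then show "((\<lambda>x. ramp (\<nu> * (x - c) - \<alpha>)) has_real_derivative \<rho> x) (at x)"
        by (simp add: \<rho>_def mult.commute)
    qed
  qed (use ab c\<rho> in auto)
  moreover have "\<nu> * (a - c) - \<alpha> \<le> 0" "\<nu> * (b - c) - \<alpha> \<ge> 1"
    using W \<nu> by (auto simp: field_simps)
  ultimately have one: "(LINT x|Mab a b. \<rho> x) = 1" by (simp add: ramp_0 ramp_1)
  have i\<rho>: "integrable (Mab a b) (\<lambda>x. c * \<rho> x)" for c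
    by (intro L2_integrable continuous_L2 continuous_intros c\<rho>)
  have i1: "integrable (Mab a b) (\<lambda>x. (u x - m) * \<rho> x)"
    by (intro L2_integrable continuous_L2 continuous_intros c\<rho> u)
  have "l2ip a b u \<rho> = (LINT x|Mab a b. (u x - m) * \<rho> x + m * \<rho> x)"
    by (simp add: l2ip_def algebra_simps)
  also have "\<dots> = (LINT x|Mab a b. (u x - m) * \<rho> x) + m"
    using i1 i\<rho>[of m] one by simp
  finally have "\<bar>l2ip a b u \<rho> - m\<bar> = \<bar>LINT x|Mab a b. (u x - m) * \<rho> x\<bar>" by simp
  also have "\<dots> \<le> (LINT x|Mab a b. \<bar>(u x - m) * \<rho> x\<bar>)"
    by (rule integral_abs_bound)
  also have "\<dots> \<le> (LINT x|Mab a b. e * \<rho> x)"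
  proof (rule integral_mono[OF integrable_abs[OF i1] i\<rho>])
    fix x
    show "\<bar>(u x - m) * \<rho> x\<bar> \<le> e * \<rho> x"
    proof (cases "x \<in> {c + \<alpha> / \<nu> .. c + (\<alpha> + 1) / \<nu>}")
      case True
      then show ?thesis using e \<rho>0 by (simp add: abs_mult mult_right_mono)
    next
      case False
      then have "\<nu> * (x - c) - \<alpha> \<notin> {0<..<1}" using \<nu> by (auto simp: field_simps)
      then have "\<rho> x = 0" by (simp add: \<rho>_def ramp'_0)
      then show ?thesis by simp
    qed
  qed
  also have "\<dots> = e" using one by simp
  finally show ?thesis by (simp add: \<rho>_def[abs_def])
qed

text \<open>The window shrinks to c as \<nu> grows. The offset \<alpha> puts it on either side of c,
  so point values are recovered at the endpoints of [a, b] as well.\<close>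

lemma ramp_average_tendsto:
  assumes u: "continuous_on {a..b} u" and ab: "a < b" and c: "c \<in> {a..b}"
    and \<nu>: "\<And>n. \<nu> n > 0" "filterlim \<nu> at_top sequentially"
    and W: "\<And>n. a \<le> c + \<alpha> / \<nu> n" "\<And>n. c + (\<alpha> + 1) / \<nu> n \<le> b"
  shows "(\<lambda>n::nat. l2ip a b u (\<lambda>x. \<nu> n * ramp' (\<nu> n * (x - c) - \<alpha>))) \<longlonglongrightarrow> u c"
proof (rule LIMSEQ_I)
  fix r :: real assume r: "r > 0"
  obtain d where d: "d > 0" "\<And>x. x \<in> {a..b} \<Longrightarrow> dist x c < d \<Longrightarrow> dist (u x) (u c) < r / 2"
    using u c half_gt_zero[OF r] unfolding continuous_on_iff by metis
  have "\<forall>\<^sub>F n in sequentially. \<nu> n > (\<bar>\<alpha>\<bar> + 1) / d"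
    using \<nu>(2) filterlim_at_top_dense by blast
  then have "\<forall>\<^sub>F n in sequentially. norm (l2ip a b u (\<lambda>x. \<nu> n * ramp' (\<nu> n * (x - c) - \<alpha>)) - u c) < r"
  proof eventually_elim
    case (elim n)
    have s: "(\<bar>\<alpha>\<bar> + 1) / \<nu> n < d" using elim d(1) \<nu>(1)[of n] by (simp add: field_simps)
    have "\<bar>l2ip a b u (\<lambda>x. \<nu> n * ramp' (\<nu> n * (x - c) - \<alpha>)) - u c\<bar> \<le> r / 2"
    proof (rule ramp_average[OF u ab \<nu>(1) W])
      fix x assume x: "x \<in> {c + \<alpha> / \<nu> n..c + (\<alpha> + 1) / \<nu> n}"
      have "\<alpha> / \<nu> n \<ge> - ((\<bar>\<alpha>\<bar> + 1) / \<nu> n)" "(\<alpha> + 1) / \<nu> n \<le> (\<bar>\<alpha>\<bar> + 1) / \<nu> n"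
        unfolding minus_divide_left using \<nu>(1)[of n] by (intro divide_right_mono; simp)+
      then have "dist x c < d" using x s by (auto simp: dist_real_def)
      moreover have "x \<in> {a..b}" using x W[of n] by auto
      ultimately show "\<bar>u x - u c\<bar> \<le> r / 2" using d(2)[of x] by (simp add: dist_real_def)
    qed
    then show ?case using r by simp
  qed
  then show "\<exists>no. \<forall>n\<ge>no. norm (l2ip a b u (\<lambda>x. \<nu> n * ramp' (\<nu> n * (x - c) - \<alpha>)) - u c) < r"
    by (simp add: eventually_sequentially)
qed

text \<open>Test with smoothed indicators of (c, d). Their derivatives are differences of two
  averaging kernels, whose pairings with u tend to u c - u d by continuity, while the smoothed
  indicators converge boundedly to the indicator.\<close>

lemma weak_deriv_FTC:
  assumes wd: "has_weak_deriv a b u p" and u: "continuous_on {a..b} u" and cd: "a \<le> c" "c < d" "d \<le> b"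
  shows "u d - u c = (LINT x|Mab a b. indicator {c<..<d} x * p x)"
proof -
  \<comment> \<open>The offset keeps \<nu> (d - c) at least 3. To the left of c + 1/\<nu> both ramps
    below are then 0, to the right of d - 1/\<nu> both are 1, and they cancel; the support avoids a
    and b even if c = a or d = b.\<close>
  define \<nu> where "\<nu> n = real n + 3 / (d - c)" for n
  have \<nu>: "\<nu> n > 0" for n using cd by (simp add: \<nu>_def add_nonneg_pos)
  have \<nu>3: "\<nu> n * (d - c) \<ge> 3" for n
  proof -
    have "3 / L * L = 3" if "L > 0" for L :: real using that by simp
    from this[of "d - c"] have "\<nu> n * (d - c) = real n * (d - c) + 3"
      using cd unfolding \<nu>_def distrib_right by simp
    then show ?thesis using cd by simp
  qed
  have \<nu>lim: "filterlim \<nu> at_top sequentially"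
    unfolding \<nu>_def by real_asymp
  define \<phi> where "\<phi> n x = ramp (\<nu> n * (x - c) - 1) - ramp (\<nu> n * (x - d) - (-2))" for n x
  define D where "D n = (\<lambda>x. \<nu> n * ramp' (\<nu> n * (x - c) - 1)) - (\<lambda>x. \<nu> n * ramp' (\<nu> n * (x - d) - (-2)))" for n
  have c0: "continuous_on S (\<lambda>x. \<nu> n * ramp' (\<nu> n * (x - c) - \<alpha>))" for n c \<alpha> S
    by (intro continuous_intros continuous_on_compose2[OF continuous_ramp'[of UNIV]]) auto
  have cD: "continuous_on S (D n)" for n S
    unfolding D_def fun_diff_def by (intro continuous_intros continuous_on_compose2[OF continuous_ramp'[of UNIV]]) auto
  have DD: "(\<phi> n has_real_derivative D n x) (at x)" for n x
  proof -
    have "(\<phi> n has_real_derivative (ramp' (\<nu> n * (x - c) - 1) * \<nu> n - ramp' (\<nu> n * (x - d) - (-2)) * \<nu> n)) (at x)"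
      unfolding \<phi>_def by (intro DERIV_diff DERIV_chain2[OF DERIV_ramp]) (auto intro!: derivative_eq_intros)
    then show ?thesis by (simp add: D_def mult.commute)
  qed
  have test: "\<phi> n \<in> test_functions a b" for n
  proof (rule test_functionsI[OF DD cD])
    show "\<phi> n x = 0" if x: "x \<notin> {c + 1 / \<nu> n .. d - 1 / \<nu> n}" for x
    proof -
      consider "x < c + 1 / \<nu> n" | "x > d - 1 / \<nu> n" using x by fastforce
      then show ?thesis
      proof cases
        case 1
        then have l: "\<nu> n * (x - c) < 1" using \<nu>[of n] by (simp add: field_simps)
        then have "\<nu> n * (x - d) \<le> -2" using \<nu>3[of n] by (simp add: algebra_simps)
        with l show ?thesis by (simp add: \<phi>_def ramp_0)
      next
        case 2
        then have l: "\<nu> n * (x - d) > -1" using \<nu>[of n] by (simp add: field_simps)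
        then have "\<nu> n * (x - c) \<ge> 2" using \<nu>3[of n] by (simp add: algebra_simps)
        with l show ?thesis by (simp add: \<phi>_def ramp_1)
      qed
    qed
    show "a < c + 1 / \<nu> n" "d - 1 / \<nu> n < b"
      using divide_pos_pos[OF zero_less_one \<nu>[of n]] cd by linarith+
  qed
  have dD: "deriv (\<phi> n) = D n" for n using DD DERIV_imp_deriv by blast
  have uL: "u \<in> L2 a b" and pL: "p \<in> L2 a b" using wd by (auto simp: has_weak_deriv_def)
  have eq: "l2ip a b u (D n) = - l2ip a b p (\<phi> n)" for n
    using wd test[of n] unfolding has_weak_deriv_iff dD[symmetric] by blast
  have "(\<lambda>n. l2ip a b u (\<lambda>x. \<nu> n * ramp' (\<nu> n * (x - c) - 1)) - l2ip a b u (\<lambda>x. \<nu> n * ramp' (\<nu> n * (x - d) - (-2)))) \<longlonglongrightarrow> u c - u d"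
  proof (intro tendsto_diff ramp_average_tendsto[OF u])
    show "a \<le> c + 1 / \<nu> n" for n using \<nu>[of n] cd by (simp add: add_increasing2)
    show "d + (-2 + 1) / \<nu> n \<le> b" for n
    proof -
      have "d - 1 / \<nu> n \<le> b" using divide_pos_pos[OF zero_less_one \<nu>[of n]] cd by linarith
      then show ?thesis by simp
    qed
    show "c + (1 + 1) / \<nu> n \<le> b" for n
    proof -
      have "c + 2 / \<nu> n \<le> d" using \<nu>[of n] \<nu>3[of n] by (simp add: field_simps)
      then show ?thesis using cd by simp
    qed
    show "a \<le> d + (-2) / \<nu> n" for n
    proof -
      have "c + 2 / \<nu> n \<le> d" using \<nu>[of n] \<nu>3[of n] by (simp add: field_simps)
      then show ?thesis using cd by simp
    qed
  qed (use cd \<nu> \<nu>lim in auto)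
  moreover have "l2ip a b u (\<lambda>x. \<nu> n * ramp' (\<nu> n * (x - c) - 1)) - l2ip a b u (\<lambda>x. \<nu> n * ramp' (\<nu> n * (x - d) - (-2)))
      = l2ip a b u (D n)" for n
    unfolding D_def by (rule l2.ip_diff_right[symmetric]) (intro continuous_L2 c0 uL)+
  ultimately have lim1: "(\<lambda>n. l2ip a b u (D n)) \<longlonglongrightarrow> u c - u d" by simp
  have "(\<lambda>n. LINT x|Mab a b. p x * \<phi> n x) \<longlonglongrightarrow> (LINT x|Mab a b. indicator {c<..<d} x * p x)"
  proof (rule integral_dominated_convergence)
    show "integrable (Mab a b) (\<lambda>x. \<bar>p x\<bar>)" by (rule L2_integrable_abs[OF pL])
    show "(\<lambda>x. p x * \<phi> n x) \<in> borel_measurable (Mab a b)" for n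
      using L2_measurable[OF pL] L2_measurable[OF test_L2[OF test]] by measurable
    have "{c<..<d} \<in> sets (Mab a b)" using cd by (auto simp: sets_restrict_space image_iff intro!: exI[of _ "{c<..<d}"])
    then show "(\<lambda>x. indicator {c<..<d} x * p x) \<in> borel_measurable (Mab a b)"
      using L2_measurable[OF pL] by measurable
    have "(\<lambda>n. \<phi> n x) \<longlonglongrightarrow> indicator {c<..<d} x" for x
    proof (rule tendsto_eventually)
      consider "x \<le> c" | "c < x" "x < d" | "d \<le> x" by linarith
      then show "\<forall>\<^sub>F n in sequentially. \<phi> n x = indicator {c<..<d} x"
      proof cases
        case 1
        have l: "\<nu> n * (x - c) \<le> 0" for n using 1 \<nu>[of n] by (simp add: mult_nonneg_nonpos)
        have "\<nu> n * (x - c) - 1 \<le> 0" "\<nu> n * (x - d) - (-2) \<le> 0" for n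
          using l[of n] \<nu>3[of n] by (simp_all add: algebra_simps)
        with 1 show ?thesis unfolding \<phi>_def by (simp only: ramp_0) simp
      next
        case 3
        have l: "\<nu> n * (x - d) \<ge> 0" for n using 3 \<nu>[of n] by simp
        have "\<nu> n * (x - c) - 1 \<ge> 1" "\<nu> n * (x - d) - (-2) \<ge> 1" for n
          using l[of n] \<nu>3[of n] by (simp_all add: algebra_simps)
        with 3 show ?thesis unfolding \<phi>_def by (simp only: ramp_1) simp
      next
        case 2
        have "\<forall>\<^sub>F n in sequentially. \<nu> n > 2 / (x - c)" "\<forall>\<^sub>F n in sequentially. \<nu> n > 2 / (d - x)"
          using \<nu>lim filterlim_at_top_dense by blast+
        then show ?thesis
        proof eventually_elim
          case (elim n)
          have "\<nu> n * (x - c) \<ge> 2" "\<nu> n * (d - x) \<ge> 2"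
            using elim 2 by (auto simp: field_simps)
          then have "\<nu> n * (x - c) - 1 \<ge> 1" "\<nu> n * (x - d) - (-2) \<le> 0"
            by (auto simp: algebra_simps)
          with 2 show ?case by (simp add: \<phi>_def ramp_0 ramp_1)
        qed
      qed
    qed
    then have "(\<lambda>n. p x * \<phi> n x) \<longlonglongrightarrow> indicator {c<..<d} x * p x" for x
      using tendsto_mult_left by (subst mult.commute[of _ "p x"]) blast
    then show "AE x in Mab a b. (\<lambda>n. p x * \<phi> n x) \<longlonglongrightarrow> indicator {c<..<d} x * p x" by simp
    have "\<bar>\<phi> n x\<bar> \<le> 1" for n x
      using ramp_bounds[of "\<nu> n * (x - c) - 1"] ramp_bounds[of "\<nu> n * (x - d) - (-2)"] unfolding \<phi>_def by linarith
    then have "\<bar>p x\<bar> * \<bar>\<phi> n x\<bar> \<le> \<bar>p x\<bar>" for n x by (simp add: mult_left_le)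
    then show "AE x in Mab a b. norm (p x * \<phi> n x) \<le> \<bar>p x\<bar>" for n by (simp add: abs_mult)
  qed
  then have lim2: "(\<lambda>n. l2ip a b u (D n)) \<longlonglongrightarrow> - (LINT x|Mab a b. indicator {c<..<d} x * p x)"
    unfolding eq unfolding l2ip_def by (rule tendsto_minus)
  from LIMSEQ_unique[OF lim1 lim2] show ?thesis by simp
qed

lemma weak_deriv_diff_le:
  assumes wd: "has_weak_deriv a b u p" and u: "continuous_on {a..b} u" and ab: "a < b"
    and xy: "x \<in> {a..b}" "y \<in> {a..b}"
  shows "\<bar>u x - u y\<bar> \<le> sqrt (b - a) * l2nm a b p"
proof -
  have pL: "p \<in> L2 a b" using wd by (rule has_weak_deriv_L2)
  have *: "\<bar>u d - u c\<bar> \<le> sqrt (b - a) * l2nm a b p" if cd: "a \<le> c" "c < d" "d \<le> b" for c d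
  proof -
    have m: "{c<..<d} \<in> sets (Mab a b)" using that by (auto simp: sets_restrict_space image_iff intro!: exI[of _ "{c<..<d}"])
    have i: "integrable (Mab a b) (\<lambda>x. indicator {c<..<d} x * p x)"
      using integrable_mult_indicator[OF m L2_integrable[OF pL]] by simp
    have "\<bar>u d - u c\<bar> \<le> (LINT x|Mab a b. \<bar>indicator {c<..<d} x * p x\<bar>)"
      unfolding weak_deriv_FTC[OF wd u cd] by (rule integral_abs_bound)
    also have "\<dots> \<le> (LINT x|Mab a b. \<bar>p x\<bar>)"
      by (rule integral_mono[OF integrable_abs[OF i] L2_integrable_abs[OF pL]]) (auto simp: indicator_def)
    also have "\<dots> \<le> sqrt (b - a) * l2nm a b p" by (rule L1_le_l2nm[OF pL ab])
    finally show ?thesis .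
  qed
  consider "x < y" | "x = y" | "y < x" by linarith
  then show ?thesis
  proof cases
    case 1
    then show ?thesis using *[of x y] xy by (simp add: abs_minus_commute)
  next
    case 2
    then show ?thesis using l2.nm_nonneg[OF pL] ab by simp
  next
    case 3
    then show ?thesis using *[of y x] xy by simp
  qed
qed

text \<open>One-dimensional Sobolev embedding: average |u x| <= |u y| + oscillation over y, and
  bound the mean of |u| by Cauchy-Schwarz.\<close>

lemma weak_deriv_sup_le:
  assumes wd: "has_weak_deriv a b u p" and u: "continuous_on {a..b} u" and ab: "a < b"
    and x: "x \<in> {a..b}"
  shows "\<bar>u x\<bar> \<le> l2nm a b u / sqrt (b - a) + sqrt (b - a) * l2nm a b p"
proof -
  let ?K = "sqrt (b - a) * l2nm a b p"
  have uL: "u \<in> L2 a b" using wd by (rule has_weak_deriv_L2)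
  have i: "integrable (Mab a b) (\<lambda>y. c)" for c :: real
    using finite_measure.integrable_const[OF finite_measure_Mab] .
  have "(b - a) * \<bar>u x\<bar> = (LINT y|Mab a b. \<bar>u x\<bar>)"
    using ab by (simp add: measure_restrict_space)
  also have "\<dots> \<le> (LINT y|Mab a b. \<bar>u y\<bar> + ?K)"
  proof (rule integral_mono[OF i])
    show "integrable (Mab a b) (\<lambda>y. \<bar>u y\<bar> + ?K)"
      using L2_integrable_abs[OF uL] i by simp
    show "\<bar>u x\<bar> \<le> \<bar>u y\<bar> + ?K" if "y \<in> space (Mab a b)" for y
      using weak_deriv_diff_le[OF wd u ab x, of y] that by auto
  qed
  also have "\<dots> = (LINT y|Mab a b. \<bar>u y\<bar>) + (b - a) * ?K"
    using ab L2_integrable_abs[OF uL] i by (simp add: measure_restrict_space)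
  also have "\<dots> \<le> sqrt (b - a) * l2nm a b u + (b - a) * ?K"
    using L1_le_l2nm[OF uL ab] by simp
  also have "\<dots> = (b - a) * (l2nm a b u / sqrt (b - a) + ?K)"
    using ab real_div_sqrt[of "b - a"]
    unfolding distrib_left times_divide_eq_right mult.commute[of "b - a" "l2nm a b u"]
    by (simp flip: times_divide_eq_right)
  finally show ?thesis using ab by (simp only: mult_le_cancel_left_pos diff_gt_0_iff_gt)
qed

lemma C1_has_weak_deriv:
  assumes ab: "a < b" and u: "\<And>x. x \<in> {a..b} \<Longrightarrow> (u has_real_derivative p x) (at x within {a..b})"
    and p: "continuous_on {a..b} p"
  shows "has_weak_deriv a b u p"
  unfolding has_weak_deriv_iff
proof (intro conjI ballI)
  have cu: "continuous_on {a..b} u"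
    using u by (meson DERIV_continuous continuous_on_eq_continuous_within)
  show "u \<in> L2 a b" "p \<in> L2 a b" using cu p by (auto intro: continuous_L2)
  fix \<phi> assume t: "\<phi> \<in> test_functions a b"
  have c1: "continuous_on {a..b} \<phi>" and c2: "continuous_on {a..b} (deriv \<phi>)"
    by (rule test_functionsE[OF t]; auto elim: continuous_on_subset)+
  have ends: "\<phi> a = 0" "\<phi> b = 0" by (rule test_functionsE[OF t]; auto)+
  have D: "(\<phi> has_real_derivative deriv \<phi> x) (at x)" for x by (rule test_functionsE[OF t])
  have "(LINT x|Mab a b. p x * \<phi> x + deriv \<phi> x * u x) = u b * \<phi> b - u a * \<phi> a"
  proof (rule LINT_deriv)
    show "((\<lambda>x. u x * \<phi> x) has_real_derivative (p x * \<phi> x + deriv \<phi> x * u x)) (at x within {a..b})"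
      if "x \<in> {a..b}" for x
      using u[OF that] has_field_derivative_at_within[OF D] by (rule DERIV_mult)
  qed (use ab in \<open>auto intro!: continuous_intros c1 c2 cu p\<close>)
  moreover have "(LINT x|Mab a b. p x * \<phi> x + deriv \<phi> x * u x) = l2ip a b p \<phi> + l2ip a b (deriv \<phi>) u"
    unfolding l2ip_def
    by (intro Bochner_Integration.integral_add L2_integrable continuous_L2 continuous_intros c1 c2 cu p)
  ultimately show "l2ip a b u (deriv \<phi>) = - l2ip a b p \<phi>"
    using ends by (simp add: l2ip_def mult.commute)
qed

lemma antiderivative:
  fixes q :: "real \<Rightarrow> real"
  assumes q: "continuous_on UNIV q" and "a < b" and U_def: "U = (\<lambda>x. A + integral {a..x} q)"
  shows "\<And>x. x \<in> {a..b} \<Longrightarrow> (U has_real_derivative q x) (at x within {a..b})"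
    and "continuous_on {a..b} U" and "has_weak_deriv a b U q" and "U a = A"
proof -
  have cq: "continuous_on {a..b} q" using q by (rule continuous_on_subset) simp
  show D: "(U has_real_derivative q x) (at x within {a..b})" if "x \<in> {a..b}" for x
    using DERIV_add[OF DERIV_const integral_has_real_derivative[OF cq that]] by (simp add: U_def)
  then show "continuous_on {a..b} U"
    by (meson DERIV_continuous continuous_on_eq_continuous_within)
  show "has_weak_deriv a b U q" using \<open>a < b\<close> D cq by (rule C1_has_weak_deriv)
  show "U a = A" by (simp add: U_def)
qed

text \<open>An H1 function is approximated by approximating its derivative and integrating from the
  same initial value. The error is then uniform on [a, b], which also controls boundary
  values.\<close>

lemma antiderivative_dist:
  assumes wd: "has_weak_deriv a b u p" and u: "continuous_on {a..b} u" and ab: "a < b"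
    and q: "continuous_on UNIV q" and U_def: "U = (\<lambda>x. u a + integral {a..x} q)"
  shows "\<And>x. x \<in> {a..b} \<Longrightarrow> \<bar>U x - u x\<bar> \<le> sqrt (b - a) * l2nm a b (q - p)"
    and "l2nm a b (U - u) \<le> (b - a) * l2nm a b (q - p)"
proof -
  note U = antiderivative[OF q ab U_def]
  have d: "has_weak_deriv a b (U - u) (q - p)" using U(3) wd by (rule has_weak_deriv_diff)
  have c: "continuous_on {a..b} (U - u)" unfolding fun_diff_def by (intro continuous_intros U u)
  show b: "\<bar>U x - u x\<bar> \<le> sqrt (b - a) * l2nm a b (q - p)" if "x \<in> {a..b}" for x
    using weak_deriv_diff_le[OF d c ab that, of a] U(4) ab by simp
  have "l2nm a b (U - u) \<le> sqrt (b - a) * (sqrt (b - a) * l2nm a b (q - p))"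
    by (rule l2nm_le_bound[OF continuous_L2[OF c] ab]) (use b in auto)
  then show "l2nm a b (U - u) \<le> (b - a) * l2nm a b (q - p)"
    using ab by (simp flip: mult.assoc)
qed

text \<open>Both factors are replaced by antiderivatives of test functions close to their
  derivatives, for which the product rule is classical. L2 convergence carries the integrals to the
  limit, uniform convergence the boundary terms.\<close>

lemma weak_integration_by_parts:
  assumes p: "has_weak_deriv a b p q" "continuous_on {a..b} p"
    and w: "has_weak_deriv a b w \<omega>" "continuous_on {a..b} w" and ab: "a < b"
  shows "l2ip a b q w + l2ip a b p \<omega> = p b * w b - p a * w a"
proof -
  have L: "p \<in> L2 a b" "q \<in> L2 a b" "w \<in> L2 a b" "\<omega> \<in> L2 a b"
    using p w by (auto intro: has_weak_deriv_L2)
  obtain qn where qn: "\<And>n. qn n \<in> test_functions a b" "(\<lambda>n. l2nm a b (qn n - q)) \<longlonglongrightarrow> 0"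
    using test_seq[OF L(2) ab] by blast
  obtain \<omega>n where \<omega>n: "\<And>n. \<omega>n n \<in> test_functions a b" "(\<lambda>n. l2nm a b (\<omega>n n - \<omega>)) \<longlonglongrightarrow> 0"
    using test_seq[OF L(4) ab] by blast
  have c: "continuous_on UNIV (qn n)" "continuous_on UNIV (\<omega>n n)" for n
    by (rule test_functionsE[OF qn(1)], assumption, rule test_functionsE[OF \<omega>n(1)], assumption)
  define P where "P n = (\<lambda>x. p a + integral {a..x} (qn n))" for n
  define W where "W n = (\<lambda>x. w a + integral {a..x} (\<omega>n n))" for n
  note PA = antiderivative[OF c(1) ab P_def]
    and WA = antiderivative[OF c(2) ab W_def]
    and PD = antiderivative_dist[OF p ab c(1) P_def]
    and WD = antiderivative_dist[OF w ab c(2) W_def]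
  have lim0: "(\<lambda>n. K * l2nm a b (qn n - q)) \<longlonglongrightarrow> 0" "(\<lambda>n. K * l2nm a b (\<omega>n n - \<omega>)) \<longlonglongrightarrow> 0" for K
    using tendsto_mult_right_zero[OF qn(2)] tendsto_mult_right_zero[OF \<omega>n(2)] by auto
  have PL: "P n \<in> L2 a b" and WL: "W n \<in> L2 a b" for n by (auto intro: continuous_L2 PA WA)
  have limP: "(\<lambda>n. l2nm a b (P n - p)) \<longlonglongrightarrow> 0"
    by (rule Lim_null_comparison[OF always_eventually lim0(1)])
      (use PD(2) l2.nm_nonneg[OF l2.V_diff[OF PL L(1)]] in auto)
  have limW: "(\<lambda>n. l2nm a b (W n - w)) \<longlonglongrightarrow> 0"
    by (rule Lim_null_comparison[OF always_eventually lim0(2)])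
      (use WD(2) l2.nm_nonneg[OF l2.V_diff[OF WL L(3)]] in auto)
  have Pb: "(\<lambda>n. P n x) \<longlonglongrightarrow> p x" and Wb: "(\<lambda>n. W n x) \<longlonglongrightarrow> w x" if "x \<in> {a..b}" for x
  proof -
    have "(\<lambda>n. P n x - p x) \<longlonglongrightarrow> 0"
      by (rule Lim_null_comparison[OF always_eventually lim0(1)]) (use PD(1)[OF that] in auto)
    then show "(\<lambda>n. P n x) \<longlonglongrightarrow> p x" by (simp add: LIM_zero_iff)
    have "(\<lambda>n. W n x - w x) \<longlonglongrightarrow> 0"
      by (rule Lim_null_comparison[OF always_eventually lim0(2)]) (use WD(1)[OF that] in auto)
    then show "(\<lambda>n. W n x) \<longlonglongrightarrow> w x" by (simp add: LIM_zero_iff)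
  qed
  have eq: "l2ip a b (qn n) (W n) + l2ip a b (P n) (\<omega>n n) = P n b * W n b - P n a * W n a" for n
  proof -
    have cc: "continuous_on {a..b} (qn n)" "continuous_on {a..b} (\<omega>n n)"
      by (rule continuous_on_subset[OF c(1)], simp, rule continuous_on_subset[OF c(2)], simp)
    have "(LINT x|Mab a b. qn n x * W n x + \<omega>n n x * P n x) = P n b * W n b - P n a * W n a"
    proof (rule LINT_deriv)
      show "((\<lambda>x. P n x * W n x) has_real_derivative (qn n x * W n x + \<omega>n n x * P n x)) (at x within {a..b})"
        if "x \<in> {a..b}" for x
        using PA(1)[OF that] WA(1)[OF that] by (rule DERIV_mult)
    qed (use ab in \<open>auto intro!: continuous_intros cc PA WA\<close>)
    moreover have "(LINT x|Mab a b. qn n x * W n x + \<omega>n n x * P n x) = l2ip a b (qn n) (W n) + l2ip a b (\<omega>n n) (P n)"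
      unfolding l2ip_def
      by (intro Bochner_Integration.integral_add L2_integrable continuous_L2 continuous_intros cc PA WA)
    ultimately show ?thesis using l2.ip_commute[OF PL test_L2[OF \<omega>n(1)]] by simp
  qed
  have "(\<lambda>n. l2ip a b (qn n) (W n) + l2ip a b (P n) (\<omega>n n)) \<longlonglongrightarrow> l2ip a b q w + l2ip a b p \<omega>"
    by (intro tendsto_add l2.ip_tendsto test_L2 qn \<omega>n PL WL L limP limW)
  moreover have "(\<lambda>n. P n b * W n b - P n a * W n a) \<longlonglongrightarrow> p b * w b - p a * w a"
    using ab by (intro tendsto_intros Pb Wb) auto
  ultimately show ?thesis unfolding eq by (rule LIMSEQ_unique)
qed

section \<open>The seminorm of X, and dissipativity of A\<close>

section \<open>The space \<open>X\<close>\<close>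

lemma sum_squares3_le: "x\<^sup>2 + y\<^sup>2 + z\<^sup>2 \<le> (x + y + z)\<^sup>2" if "0 \<le> x" "0 \<le> y" "0 \<le> z" for x y z :: real
proof -
  have "(x + y + z)\<^sup>2 = x\<^sup>2 + y\<^sup>2 + z\<^sup>2 + 2 * (x * y + x * z + y * z)"
    by (simp add: power2_eq_square algebra_simps)
  moreover have "0 \<le> x * y + x * z + y * z" using that by simp
  ultimately show ?thesis by simp
qed

lemma H1_iff: "u \<in> H1 a b \<longleftrightarrow> continuous_on {a..b} u \<and> has_weak_deriv a b u (weak_deriv a b u)"
  unfolding H1_def using has_weak_deriv_weak_deriv by blast

lemma H1_subspace: "subspace (H1 a b)"
proof (rule subspaceI)
  show "0 \<in> H1 a b"
    unfolding H1_def has_weak_deriv_iff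
    by (auto simp: zero_fun_def const_L2 l2ip_def intro!: exI[of _ 0])
  show "u + v \<in> H1 a b" if uv: "u \<in> H1 a b" "v \<in> H1 a b" for u v
  proof -
    have "continuous_on {a..b} (u + v)"
      using uv unfolding H1_iff plus_fun_def by (intro continuous_intros) auto
    moreover have "has_weak_deriv a b (u + v) (weak_deriv a b u + weak_deriv a b v)"
      using uv by (intro has_weak_deriv_add) (auto simp: H1_iff)
    ultimately show ?thesis unfolding H1_def by blast
  qed
  show "c *\<^sub>R u \<in> H1 a b" if u: "u \<in> H1 a b" for c u
  proof -
    have "continuous_on {a..b} (c *\<^sub>R u)"
      using u unfolding H1_iff scaleR_fun_def by (intro continuous_intros) auto
    moreover have "has_weak_deriv a b (c *\<^sub>R u) (c *\<^sub>R weak_deriv a b u)"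
      using u by (intro has_weak_deriv_scale) (auto simp: H1_iff)
    ultimately show ?thesis unfolding H1_def by blast
  qed
qed

lemma X_subspace: "subspace (X a b)"
  unfolding X_def using subspace_Times[OF H1_subspace L2_subspace] .

lemma H1_L2: "u \<in> H1 a b \<Longrightarrow> u \<in> L2 a b" "u \<in> H1 a b \<Longrightarrow> weak_deriv a b u \<in> L2 a b"
  by (auto simp: H1_iff has_weak_deriv_L2)

lemma X_D:
  assumes "z \<in> X a b"
  shows "fst z \<in> H1 a b" "fst z \<in> L2 a b" "weak_deriv a b (fst z) \<in> L2 a b" "snd z \<in> L2 a b"
    "continuous_on {a..b} (fst z)" "has_weak_deriv a b (fst z) (weak_deriv a b (fst z))"
  using assms H1_L2 by (auto simp: X_def H1_iff has_weak_deriv_L2)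

lemma Xinner_l2:
  assumes "z \<in> X a b" "z' \<in> X a b"
  shows "Xinner a b \<tau> \<epsilon> z z' = \<epsilon>\<^sup>2 * l2ip a b (weak_deriv a b (fst z)) (weak_deriv a b (fst z'))
    + \<tau> * l2ip a b (fst z) (fst z') + \<tau> * l2ip a b (snd z) (snd z')"
proof -
  note D = X_D[OF assms(1)] X_D[OF assms(2)]
  have "integrable (Mab a b) (\<lambda>x. weak_deriv a b (fst z) x * weak_deriv a b (fst z') x)"
    "integrable (Mab a b) (\<lambda>x. fst z x * fst z' x)" "integrable (Mab a b) (\<lambda>x. snd z x * snd z' x)"
    by (intro L2_mult D)+
  then show ?thesis unfolding Xinner_def l2ip_def by (simp add: mult.assoc)
qed

locale wave_space =
  fixes a b \<tau> \<epsilon> :: real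
  assumes ab: "a < b" and \<tau>: "0 < \<tau>" and \<epsilon>: "0 < \<epsilon>"
begin

text \<open>\<open>weak_deriv\<close> is a choice of representative, so it is additive only modulo
  null functions; pairing with r hides the ambiguity.\<close>

lemma weak_deriv_add:
  assumes "u \<in> H1 a b" "v \<in> H1 a b" "r \<in> L2 a b"
  shows "l2ip a b (weak_deriv a b (u + v)) r = l2ip a b (weak_deriv a b u) r + l2ip a b (weak_deriv a b v) r"
proof -
  have uv: "u + v \<in> H1 a b" using assms subspace_add[OF H1_subspace] by blast
  have "has_weak_deriv a b (u + v) (weak_deriv a b u + weak_deriv a b v)"
    using assms by (intro has_weak_deriv_add) (auto simp: H1_iff)
  from weak_deriv_eq[OF this ab] show ?thesis
    using assms uv by (subst l2.ip_cong0[where y="weak_deriv a b u + weak_deriv a b v"])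
      (auto simp: H1_L2 L2_add l2.ip_add)
qed

lemma weak_deriv_scale:
  assumes "u \<in> H1 a b" "r \<in> L2 a b"
  shows "l2ip a b (weak_deriv a b (c *\<^sub>R u)) r = c * l2ip a b (weak_deriv a b u) r"
proof -
  have uv: "c *\<^sub>R u \<in> H1 a b" using assms subspace_scale[OF H1_subspace] by blast
  have "has_weak_deriv a b (c *\<^sub>R u) (c *\<^sub>R weak_deriv a b u)"
    using assms by (intro has_weak_deriv_scale) (auto simp: H1_iff)
  from weak_deriv_eq[OF this ab] show ?thesis
    using assms uv by (subst l2.ip_cong0[where y="c *\<^sub>R weak_deriv a b u"])
      (auto simp: H1_L2 L2_scale l2.ip_scale)
qed

lemma semi_inner_X: "semi_inner (X a b) (Xinner a b \<tau> \<epsilon>)"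
proof
  show "subspace (X a b)" by (rule X_subspace)
  show "Xinner a b \<tau> \<epsilon> (x + y) z = Xinner a b \<tau> \<epsilon> x z + Xinner a b \<tau> \<epsilon> y z"
    if "x \<in> X a b" "y \<in> X a b" "z \<in> X a b" for x y z
    using that subspace_add[OF X_subspace that(1,2)]
    by (simp add: Xinner_l2 weak_deriv_add X_D l2.ip_add distrib_left)
  show "Xinner a b \<tau> \<epsilon> (c *\<^sub>R x) z = c * Xinner a b \<tau> \<epsilon> x z"
    if "x \<in> X a b" "z \<in> X a b" for x z c
    using that subspace_scale[OF X_subspace that(1), of c]
    by (simp add: Xinner_l2 weak_deriv_scale X_D l2.ip_scale algebra_simps)
  show "Xinner a b \<tau> \<epsilon> x y = Xinner a b \<tau> \<epsilon> y x" for x y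
    by (simp add: Xinner_def mult.commute mult.left_commute)
  show "0 \<le> Xinner a b \<tau> \<epsilon> x x" if "x \<in> X a b" for x
    using that \<tau> by (simp add: Xinner_l2 X_D l2.ip_nonneg)
qed

sublocale xs: semi_inner "X a b" "Xinner a b \<tau> \<epsilon>"
  rewrites "semi_inner.nm (Xinner a b \<tau> \<epsilon>) = Xnorm a b \<tau> \<epsilon>"
proof -
  show s: "semi_inner (X a b) (Xinner a b \<tau> \<epsilon>)" by (rule semi_inner_X)
  show "semi_inner.nm (Xinner a b \<tau> \<epsilon>) = Xnorm a b \<tau> \<epsilon>"
    by (simp add: fun_eq_iff Xnorm_def semi_inner.nm_def[OF s])
qed

abbreviation "N2 \<equiv> l2nm a b"
abbreviation "NX \<equiv> Xnorm a b \<tau> \<epsilon>"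

lemma NX_square:
  assumes "z \<in> X a b"
  shows "(NX z)\<^sup>2 = \<epsilon>\<^sup>2 * (N2 (weak_deriv a b (fst z)))\<^sup>2 + \<tau> * (N2 (fst z))\<^sup>2 + \<tau> * (N2 (snd z))\<^sup>2"
  using assms by (simp add: xs.nm_square Xinner_l2 l2.nm_square X_D)

lemma NX_ge:
  assumes z: "z \<in> X a b"
  shows "\<epsilon> * N2 (weak_deriv a b (fst z)) \<le> NX z" "sqrt \<tau> * N2 (fst z) \<le> NX z" "sqrt \<tau> * N2 (snd z) \<le> NX z"
  using \<tau> by (auto intro!: power2_le_imp_le[OF _ xs.nm_nonneg[OF z]] simp: NX_square[OF z] power_mult_distrib)

lemma NX_le:
  assumes z: "z \<in> X a b"
  shows "NX z \<le> \<epsilon> * N2 (weak_deriv a b (fst z)) + sqrt \<tau> * N2 (fst z) + sqrt \<tau> * N2 (snd z)"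
proof -
  let ?A = "\<epsilon> * N2 (weak_deriv a b (fst z))" and ?B = "sqrt \<tau> * N2 (fst z)" and ?C = "sqrt \<tau> * N2 (snd z)"
  have n: "0 \<le> ?A" "0 \<le> ?B" "0 \<le> ?C" using z \<epsilon> \<tau> by (auto simp: l2.nm_nonneg X_D)
  have "(NX z)\<^sup>2 = ?A\<^sup>2 + ?B\<^sup>2 + ?C\<^sup>2" using \<tau> by (simp add: NX_square[OF z] power_mult_distrib)
  also have "\<dots> \<le> (?A + ?B + ?C)\<^sup>2"
    using n by (rule sum_squares3_le)
  finally show ?thesis by (rule power2_le_imp_le) (use n in linarith)
qed

text \<open>The embedding constant of X into the continuous functions, read off from
  \<open>weak_deriv_sup_le\<close>. It blows up as \<epsilon> tends to 0, which is harmless because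
  it enters only continuity arguments at fixed \<epsilon>.\<close>

definition "Csup = 1 / (sqrt (b - a) * sqrt \<tau>) + sqrt (b - a) / \<epsilon>"

lemma Csup_pos: "Csup > 0"
  using ab \<tau> \<epsilon> by (simp add: Csup_def add_pos_pos)

lemma sup_le_NX:
  assumes z: "z \<in> X a b" and x: "x \<in> {a..b}"
  shows "\<bar>fst z x\<bar> \<le> Csup * NX z"
proof -
  have "\<bar>fst z x\<bar> \<le> N2 (fst z) / sqrt (b - a) + sqrt (b - a) * N2 (weak_deriv a b (fst z))"
    by (rule weak_deriv_sup_le[OF X_D(6)[OF z] X_D(5)[OF z] ab x])
  also have "\<dots> \<le> (NX z / sqrt \<tau>) / sqrt (b - a) + sqrt (b - a) * (NX z / \<epsilon>)"
    using NX_ge[OF z] \<tau> \<epsilon> ab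
    by (intro add_mono divide_right_mono mult_left_mono) (auto simp: field_simps)
  also have "\<dots> = Csup * NX z" by (simp add: Csup_def distrib_left distrib_right mult.commute)
  finally show ?thesis .
qed

text \<open>First components are continuous representatives, so for them distance zero in X means
  equality at every point.\<close>

lemma Xeq_fst:
  assumes "z \<in> X a b" "z' \<in> X a b" "Xeq a b \<tau> \<epsilon> z z'" "x \<in> {a..b}"
  shows "fst z x = fst z' x"
  using sup_le_NX[of "z - z'" x] assms by (simp add: Xeq_def xs.V_diff)

lemma Xeq_N2:
  assumes "z \<in> X a b" "z' \<in> X a b" "Xeq a b \<tau> \<epsilon> z z'"
  shows "N2 (fst z - fst z') = 0" "N2 (snd z - snd z') = 0"
  using NX_ge(2,3)[of "z - z'"] l2.nm_nonneg[of "fst z - fst z'" a b] l2.nm_nonneg[of "snd z - snd z'" a b] assms \<tau>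
  by (auto simp: Xeq_def xs.V_diff X_D l2.V_diff mult_le_0_iff not_less)

lemma Xeq_NX:
  assumes "z \<in> X a b" "z' \<in> X a b" "Xeq a b \<tau> \<epsilon> z z'"
  shows "NX z = NX z'"
  using assms xs.nm_cong0 by (auto simp: Xeq_def)

subsection \<open>The operator \<open>A\<close>\<close>

lemma dom_A_X: "z \<in> dom_A a b \<Longrightarrow> z \<in> X a b"
  by (auto simp: dom_A_def X_def H1_L2)

text \<open>Approximating u_x by a test function q and integrating gives a function whose derivative
  vanishes at both ends, so the Neumann condition comes for free. The velocity is approximated by a
  test function directly.\<close>

lemma dom_A_dense:
  assumes z: "z \<in> X a b" and e: "e > 0"
  obtains z' where "z' \<in> dom_A a b" "NX (z' - z) < e"
proof -
  note D = X_D[OF z]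
  \<comment> \<open>An error e / K in both approximations enters the three parts of the X norm with
    the factors \<epsilon>, sqrt \<tau> * (b - a) and sqrt \<tau>.\<close>
  define K where "K = \<epsilon> + sqrt \<tau> * (b - a) + sqrt \<tau>"
  have K: "K > 0" using \<epsilon> \<tau> ab by (simp add: K_def add_pos_pos)
  obtain q where q: "q \<in> test_functions a b" "N2 (weak_deriv a b (fst z) - q) < e / K"
    using test_functions_dense[OF D(3) ab] e K unfolding test_approx_def by (meson divide_pos_pos)
  obtain \<omega> where \<omega>: "\<omega> \<in> test_functions a b" "N2 (snd z - \<omega>) < e / K"
    using test_functions_dense[OF D(4) ab] e K unfolding test_approx_def by (meson divide_pos_pos)
  have tH: "\<phi> \<in> H1 a b" if t: "\<phi> \<in> test_functions a b" for \<phi>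
  proof -
    have "has_weak_deriv a b \<phi> (deriv \<phi>)"
      by (rule test_functionsE[OF t], rule C1_has_weak_deriv[OF ab])
        (auto intro: has_field_derivative_at_within continuous_on_subset)
    moreover have "continuous_on {a..b} \<phi>" by (rule test_functionsE[OF t]) (auto elim: continuous_on_subset)
    ultimately show ?thesis unfolding H1_def by blast
  qed
  have cq: "continuous_on UNIV q" "q a = 0" "q b = 0"
    using test_functionsE[OF q(1)] by (metis greaterThanLessThan_iff less_irrefl)+
  define U where "U = (\<lambda>x. fst z a + integral {a..x} q)"
  note A = antiderivative[OF cq(1) ab U_def]
  have UH: "U \<in> H1 a b" using A by (auto simp: H1_def)
  have dA: "(U, \<omega>) \<in> dom_A a b"
    using UH tH[OF \<omega>(1)] tH[OF q(1)] A(3) cq by (auto simp: dom_A_def)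
  have d: "(U, \<omega>) - z \<in> X a b" using dom_A_X[OF dA] z by (rule xs.V_diff)
  have wdU: "has_weak_deriv a b (U - fst z) (q - weak_deriv a b (fst z))"
    using A(3) D(6) by (rule has_weak_deriv_diff)
  have "N2 (weak_deriv a b (U - fst z)) = N2 (q - weak_deriv a b (fst z))"
    using weak_deriv_eq[OF wdU ab] wdU has_weak_deriv_weak_deriv[OF wdU]
    by (intro l2.nm_cong0) (auto dest: has_weak_deriv_L2)
  also have q': "\<dots> < e / K" using q l2.nm_minus_commute[OF D(3) test_L2[OF q(1)]] by simp
  finally have 1: "N2 (weak_deriv a b (U - fst z)) < e / K" .
  have "N2 (U - fst z) \<le> (b - a) * N2 (q - weak_deriv a b (fst z))"
    by (rule antiderivative_dist[OF D(6,5) ab cq(1) U_def])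
  also have "\<dots> \<le> (b - a) * (e / K)" using q' ab by (intro mult_left_mono) auto
  finally have 2: "N2 (U - fst z) \<le> (b - a) * (e / K)" .
  have 3: "N2 (\<omega> - snd z) < e / K" using \<omega> l2.nm_minus_commute[OF D(4) test_L2[OF \<omega>(1)]] by simp
  have "NX ((U, \<omega>) - z) \<le> \<epsilon> * N2 (weak_deriv a b (U - fst z)) + sqrt \<tau> * N2 (U - fst z) + sqrt \<tau> * N2 (\<omega> - snd z)"
    using NX_le[OF d] by simp
  also have "\<dots> < \<epsilon> * (e / K) + sqrt \<tau> * ((b - a) * (e / K)) + sqrt \<tau> * (e / K)"
    using 1 2 3 \<epsilon> \<tau> by (intro add_less_le_mono add_le_less_mono mult_left_mono mult_strict_left_mono add_strict_mono) auto
  also have "\<epsilon> * E + sqrt \<tau> * ((b - a) * E) + sqrt \<tau> * E = K * E" for E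
    by (simp add: K_def algebra_simps)
  also have "K * (e / K) = e" using K by simp
  finally show ?thesis using dA that by blast
qed

text \<open>Integration by parts with u_x = 0 at the ends cancels the \<epsilon>^2 terms containing
  w_x and u_xx. What remains involves only quantities that the X norm controls, which allows its
  extension to all of X as \<open>Qform\<close>.\<close>

lemma op_A_dissipative:
  assumes "z \<in> dom_A a b"
  shows "op_A a b \<tau> \<epsilon> z \<in> X a b"
    and "fst (op_A a b \<tau> \<epsilon> z) = snd z - fst z"
    and "Xinner a b \<tau> \<epsilon> z (op_A a b \<tau> \<epsilon> z) = - (NX z)\<^sup>2 + \<tau> * l2ip a b (fst z) (snd z)"
proof -
  obtain u w where z: "z = (u, w)" by force
  obtain p where uH: "u \<in> H1 a b" and wH: "w \<in> H1 a b" and p: "p \<in> H1 a b" "has_weak_deriv a b u p" "p a = 0" "p b = 0"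
    using assms unfolding z dom_A_def by blast
  have zX: "z \<in> X a b" using assms by (rule dom_A_X)
  let ?u' = "weak_deriv a b u" and ?w' = "weak_deriv a b w" and ?q = "weak_deriv a b p"
  have L: "u \<in> L2 a b" "w \<in> L2 a b" "?u' \<in> L2 a b" "?w' \<in> L2 a b" "p \<in> L2 a b" "?q \<in> L2 a b"
    using uH wH p H1_L2 by auto
  have up: "N2 (p - ?u') = 0" using weak_deriv_eq[OF p(2) ab] l2.nm_minus_commute[OF L(3,5)] by simp
  have pq: "has_weak_deriv a b p ?q" using p(1) by (simp add: H1_iff)
  \<comment> \<open>\<open>op_A\<close> differentiates the chosen representative ?u' of u_x rather
    than the continuous one p. They differ by a null function, so a weak derivative of p is one of
    ?u' too.\<close>
  have "has_weak_deriv a b ?u' ?q"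
    by (rule has_weak_deriv_cong[OF pq L(3) L(6) up]) (simp add: l2.nm_zero)
  note this' = has_weak_deriv_weak_deriv[OF this] weak_deriv_eq[OF this ab]
  let ?q' = "weak_deriv a b ?u'"
  have q'L: "?q' \<in> L2 a b" using this'(1) by (rule has_weak_deriv_L2)
  have A: "op_A a b \<tau> \<epsilon> z = (w - u, (\<epsilon>\<^sup>2 / \<tau>) *\<^sub>R ?q' - w)"
    by (simp add: op_A_def z fun_eq_iff scaleR_fun_def)
  show "fst (op_A a b \<tau> \<epsilon> z) = snd z - fst z" unfolding A by (simp add: z)
  have wu: "w - u \<in> H1 a b" using uH wH subspace_diff[OF H1_subspace] by blast
  have sL: "(\<epsilon>\<^sup>2 / \<tau>) *\<^sub>R ?q' - w \<in> L2 a b" using L q'L by (intro l2.V_diff l2.V_scale)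
  show AX: "op_A a b \<tau> \<epsilon> z \<in> X a b" unfolding A X_def using wu sL by simp
  have wwu: "l2ip a b ?u' (weak_deriv a b (w - u)) = l2ip a b ?u' ?w' - l2ip a b ?u' ?u'"
  proof -
    have "has_weak_deriv a b (w - u) (?w' - ?u')"
      using uH wH by (intro has_weak_deriv_diff) (auto simp: H1_iff)
    from weak_deriv_eq[OF this ab] have "l2ip a b (weak_deriv a b (w - u)) ?u' = l2ip a b (?w' - ?u') ?u'"
      using L H1_L2[OF wu] by (intro l2.ip_cong0 l2.V_diff)
    then show ?thesis
      using L l2.ip_commute[OF H1_L2(2)[OF wu] L(3)] l2.ip_commute[OF L(4,3)] by (simp add: l2.ip_diff)
  qed
  have parts: "l2ip a b ?q' w + l2ip a b ?u' ?w' = 0"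
  proof -
    have "l2ip a b ?q' w = l2ip a b ?q w" using this'(2) L q'L by (intro l2.ip_cong0)
    moreover have "l2ip a b ?u' ?w' = l2ip a b p ?w'"
      using weak_deriv_eq[OF p(2) ab] L by (intro l2.ip_cong0)
    moreover have "l2ip a b ?q w + l2ip a b p ?w' = 0"
      using weak_integration_by_parts[OF pq _ _ _ ab, of w ?w'] p(1,3,4) wH by (simp add: H1_iff)
    ultimately show ?thesis by simp
  qed
  have "Xinner a b \<tau> \<epsilon> z (op_A a b \<tau> \<epsilon> z) = \<epsilon>\<^sup>2 * (l2ip a b ?u' ?w' - l2ip a b ?u' ?u') + \<tau> * l2ip a b u (w - u)
      + \<tau> * l2ip a b w ((\<epsilon>\<^sup>2 / \<tau>) *\<^sub>R ?q' - w)"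
    unfolding Xinner_l2[OF zX AX] unfolding A by (simp add: z wwu)
  also have "\<dots> = \<epsilon>\<^sup>2 * (l2ip a b ?u' ?w' - l2ip a b ?u' ?u') + \<tau> * (l2ip a b u w - l2ip a b u u)
      + \<tau> * ((\<epsilon>\<^sup>2 / \<tau>) * l2ip a b ?q' w - l2ip a b w w)"
    using L q'L l2.ip_commute[OF L(2) q'L] by (simp add: l2.ip_diff_right l2.ip_scale_right l2.V_scale)
  also have "\<dots> = \<epsilon>\<^sup>2 * (l2ip a b ?q' w + l2ip a b ?u' ?w') - (\<epsilon>\<^sup>2 * l2ip a b ?u' ?u' + \<tau> * l2ip a b u u + \<tau> * l2ip a b w w) + \<tau> * l2ip a b u w"
    using \<tau> by (simp add: algebra_simps)
  also have "\<dots> = - (NX z)\<^sup>2 + \<tau> * l2ip a b u w"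
    unfolding parts xs.nm_square[OF zX] Xinner_l2[OF zX zX] by (simp add: z)
  finally show "Xinner a b \<tau> \<epsilon> z (op_A a b \<tau> \<epsilon> z) = - (NX z)\<^sup>2 + \<tau> * l2ip a b (fst z) (snd z)"
    by (simp add: z)
qed

end

section \<open>Growth bounds from right difference quotients\<close>

section \<open>A one-sided growth criterion\<close>

text \<open>With a slack e per unit of time, the set of t such that \<psi> s <= \<psi> 0 + e s on
  [0, t] contains its supremum by continuity, and the hypothesis applied there pushes the supremum
  further unless it is T.\<close>

lemma dini_nonincreasing:
  fixes \<psi> :: "real \<Rightarrow> real"
  assumes T: "0 \<le> T" and c: "continuous_on {0..T} \<psi>"
    and D: "\<And>t e. 0 \<le> t \<Longrightarrow> t < T \<Longrightarrow> e > 0 \<Longrightarrow> \<forall>\<^sub>F h in at_right 0. \<psi> (t + h) \<le> \<psi> t + h * e"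
  shows "\<psi> T \<le> \<psi> 0"
proof (rule field_le_epsilon)
  fix e0 :: real assume e0: "e0 > 0"
  \<comment> \<open>The denominator T + 1 keeps e defined and positive also for T = 0.\<close>
  define e where "e = e0 / (T + 1)"
  have e: "e > 0" "e * T \<le> e0" using e0 T by (auto simp: e_def field_simps)
  define A where "A = {t \<in> {0..T}. \<forall>s\<in>{0..t}. \<psi> s \<le> \<psi> 0 + e * s}"
  have 0: "0 \<in> A" using T by (auto simp: A_def)
  have bdd: "bdd_above A" by (rule bdd_aboveI[of _ T]) (auto simp: A_def)
  define m where "m = Sup A"
  have m: "0 \<le> m" "m \<le> T"
  proof -
    show "0 \<le> m" unfolding m_def using 0 bdd by (rule cSup_upper)
    show "m \<le> T" unfolding m_def using 0 by (intro cSup_least) (auto simp: A_def)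
  qed
  have below: "\<psi> s \<le> \<psi> 0 + e * s" if s: "0 \<le> s" "s < m" for s
  proof -
    obtain t where "t \<in> A" "s < t" using s 0 bdd less_cSup_iff[of A s] unfolding m_def by blast
    then show ?thesis using s by (auto simp: A_def)
  qed
  have at: "\<psi> m \<le> \<psi> 0 + e * m"
  proof (cases "m = 0")
    case False
    have "continuous_on {0..m} \<psi>" using c m by (auto elim: continuous_on_subset)
    then have "continuous_on {0..m} (\<lambda>s. \<psi> s - e * s)" by (intro continuous_intros)
    then have lim: "((\<lambda>s. \<psi> s - e * s) \<longlongrightarrow> \<psi> m - e * m) (at m within {0..m})"
      using m by (auto simp: continuous_on)
    have nt: "at m within {0..m} \<noteq> bot"
      using False m by (simp add: at_within_Icc_at_left)
    have "\<psi> m - e * m \<le> \<psi> 0"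
    proof (rule tendsto_upperbound[OF lim _ nt])
      show "\<forall>\<^sub>F s in at m within {0..m}. \<psi> s - e * s \<le> \<psi> 0"
        using below by (auto simp: eventually_at_filter algebra_simps intro!: always_eventually)
    qed
    then show ?thesis by simp
  qed simp
  have "m = T"
  proof (rule ccontr)
    assume "m \<noteq> T"
    then have "m < T" using m by simp
    then obtain d where d: "d > 0" "\<And>h. 0 < h \<Longrightarrow> h < d \<Longrightarrow> \<psi> (m + h) \<le> \<psi> m + h * e"
      using D[OF m(1) _ e(1)] unfolding eventually_at_right[OF zero_less_one] by blast
    define h where "h = min (d / 2) (T - m)"
    have h: "0 < h" "h < d" "m + h \<le> T" using d \<open>m < T\<close> by (auto simp: h_def min_def)
    have "m + h \<in> A" unfolding A_def
    proof safe
      fix s assume s: "s \<in> {0..m + h}"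
      show "\<psi> s \<le> \<psi> 0 + e * s"
      proof (cases "s \<le> m")
        case True
        then show ?thesis using s below[of s] at by (cases "s = m") auto
      next
        case False
        then have "\<psi> s \<le> \<psi> m + (s - m) * e" using d(2)[of "s - m"] s h by auto
        then show ?thesis using at by (simp add: algebra_simps)
      qed
    qed (use h m in auto)
    then have "m + h \<le> m" unfolding m_def using bdd by (rule cSup_upper)
    then show False using h by simp
  qed
  then show "\<psi> T \<le> \<psi> 0 + e0" using at e by simp
qed

text \<open>The integrated form of a bound on the right derivative. It replaces differentiation in
  time: along the solution only upper bounds on small increments to the right are available.\<close>

lemma dini_bound:
  fixes \<phi> \<Gamma> \<gamma> :: "real \<Rightarrow> real"
  assumes T: "0 \<le> T" and c: "continuous_on {0..T} \<phi>"
    and \<Gamma>: "\<And>t. t \<in> {0..T} \<Longrightarrow> (\<Gamma> has_real_derivative \<gamma> t) (at t within {0..T})"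
    and D: "\<And>t e. 0 \<le> t \<Longrightarrow> t < T \<Longrightarrow> e > 0 \<Longrightarrow> \<forall>\<^sub>F h in at_right 0. \<phi> (t + h) \<le> \<phi> t + h * (\<gamma> t + e)"
  shows "\<phi> T - \<phi> 0 \<le> \<Gamma> T - \<Gamma> 0"
proof -
  have "\<phi> T - \<Gamma> T \<le> \<phi> 0 - \<Gamma> 0"
  proof (rule dini_nonincreasing[OF T])
    have "continuous_on {0..T} \<Gamma>"
      using \<Gamma> by (meson DERIV_continuous continuous_on_eq_continuous_within)
    then show "continuous_on {0..T} (\<lambda>t. \<phi> t - \<Gamma> t)" using c by (intro continuous_intros)
    fix t e :: real assume t: "0 \<le> t" "t < T" "e > 0"
    have "(\<Gamma> has_real_derivative \<gamma> t) (at t within {t..T})"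
      using \<Gamma>[of t] t by (auto intro: DERIV_subset)
    then have "((\<lambda>s. (\<Gamma> s - \<Gamma> t) / (s - t)) \<longlongrightarrow> \<gamma> t) (at_right t)"
      using t by (simp add: has_field_derivative_iff at_within_Icc_at_right)
    then have "((\<lambda>h. (\<Gamma> (h + t) - \<Gamma> t) / (h + t - t)) \<longlongrightarrow> \<gamma> t) (at_right 0)"
      unfolding filterlim_at_right_to_0[of _ _ t] .
    then have "\<forall>\<^sub>F h in at_right 0. dist ((\<Gamma> (h + t) - \<Gamma> t) / (h + t - t)) (\<gamma> t) < e / 2"
      using t by (intro tendstoD) auto
    moreover have "\<forall>\<^sub>F h in at_right (0::real). h > 0" by (simp add: eventually_at_right_less)
    moreover have "\<forall>\<^sub>F h in at_right 0. \<phi> (t + h) \<le> \<phi> t + h * (\<gamma> t + e / 2)"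
      using t by (intro D) auto
    ultimately show "\<forall>\<^sub>F h in at_right 0. \<phi> (t + h) - \<Gamma> (t + h) \<le> \<phi> t - \<Gamma> t + h * e"
    proof eventually_elim
      case (elim h)
      then have "\<bar>(\<Gamma> (h + t) - \<Gamma> t) / h - \<gamma> t\<bar> < e / 2" by (simp add: dist_real_def)
      then have "(\<Gamma> (h + t) - \<Gamma> t) / h \<ge> \<gamma> t - e / 2" by linarith
      then have "\<Gamma> (t + h) - \<Gamma> t \<ge> h * (\<gamma> t - e / 2)"
        using elim by (simp add: pos_le_divide_eq mult.commute add.commute)
      then show ?case using elim by (simp add: algebra_simps)
    qed
  qed
  then show ?thesis by simp
qed

lemma dini_bound_const:
  fixes \<phi> :: "real \<Rightarrow> real"
  assumes "0 \<le> T" "continuous_on {0..T} \<phi>"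
    and D: "\<And>t e. 0 \<le> t \<Longrightarrow> t < T \<Longrightarrow> e > 0 \<Longrightarrow> \<forall>\<^sub>F h in at_right 0. \<phi> (t + h) \<le> \<phi> t + h * (c + e)"
  shows "\<phi> T \<le> \<phi> 0 + T * c"
  using dini_bound[OF assms(1,2), of "\<lambda>t. c * t" "\<lambda>_. c"] D
  by (fastforce intro!: derivative_eq_intros simp: mult.commute)

section \<open>First-order expansions of S(h) for arbitrary states\<close>

section \<open>The semigroup\<close>

context wave_space
begin

lemma Xeq_trans:
  assumes "Xeq a b \<tau> \<epsilon> x y" "Xeq a b \<tau> \<epsilon> y z" "x \<in> X a b" "y \<in> X a b" "z \<in> X a b"
  shows "Xeq a b \<tau> \<epsilon> x z"
  using xs.nm_triangle3[of x y z] xs.nm_nonneg[of "x - z"] assms by (simp add: Xeq_def xs.V_diff)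

lemma Xeq_refl: "x \<in> X a b \<Longrightarrow> Xeq a b \<tau> \<epsilon> x x"
  by (simp add: Xeq_def xs.nm_zero)

lemma Xeq_sym: "Xeq a b \<tau> \<epsilon> x y \<Longrightarrow> x \<in> X a b \<Longrightarrow> y \<in> X a b \<Longrightarrow> Xeq a b \<tau> \<epsilon> y x"
  by (simp add: Xeq_def xs.nm_minus_commute)

text \<open>The continuous extension of z -> <z, Az> from the domain of A to X; see
  \<open>op_A_dissipative\<close>.\<close>

definition "Qform z = - (NX z)\<^sup>2 + \<tau> * l2ip a b (fst z) (snd z)"

lemma N2_fst_le: "z \<in> X a b \<Longrightarrow> N2 (fst z) \<le> NX z / sqrt \<tau>"
  and N2_snd_le: "z \<in> X a b \<Longrightarrow> N2 (snd z) \<le> NX z / sqrt \<tau>"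
  using NX_ge(2,3)[of z] \<tau> by (auto simp: field_simps)

lemma N2_tendsto:
  assumes "\<And>i. f i \<in> X a b" "z \<in> X a b" "((\<lambda>i. NX (f i - z)) \<longlongrightarrow> 0) Q"
  shows "((\<lambda>i. N2 (fst (f i) - fst z)) \<longlongrightarrow> 0) Q" "((\<lambda>i. N2 (snd (f i) - snd z)) \<longlongrightarrow> 0) Q"
proof -
  have l: "((\<lambda>i. NX (f i - z) / sqrt \<tau>) \<longlongrightarrow> 0) Q"
    using tendsto_divide_zero[OF assms(3)] by simp
  have d: "f i - z \<in> X a b" for i using assms by (intro xs.V_diff)
  show "((\<lambda>i. N2 (fst (f i) - fst z)) \<longlongrightarrow> 0) Q"
    by (rule Lim_null_comparison[OF always_eventually l])
      (use N2_fst_le[OF d] l2.nm_nonneg[OF X_D(2)[OF d]] in auto)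
  show "((\<lambda>i. N2 (snd (f i) - snd z)) \<longlongrightarrow> 0) Q"
    by (rule Lim_null_comparison[OF always_eventually l])
      (use N2_snd_le[OF d] l2.nm_nonneg[OF X_D(4)[OF d]] in auto)
qed

text \<open>Upper semicontinuity, proved along sequences: it keeps the growth rate of the squared
  norm below its value at z plus e on a whole neighbourhood.\<close>

lemma Qform_upper:
  assumes z: "z \<in> X a b" and e: "e > 0"
  obtains d where "d > 0" "\<And>z'. z' \<in> X a b \<Longrightarrow> NX (z' - z) < d \<Longrightarrow> Qform z' \<le> Qform z + e"
proof (rule ccontr)
  assume neg: "\<not> thesis"
  have "\<exists>z'\<in>X a b. NX (z' - z) < inverse (real (Suc n)) \<and> Qform z' > Qform z + e" for n
    using that[of "inverse (real (Suc n))"] neg by force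
  then obtain f where f: "\<And>n. f n \<in> X a b" "\<And>n. NX (f n - z) < inverse (real (Suc n))" "\<And>n. Qform (f n) > Qform z + e"
    by metis
  have l: "(\<lambda>n. NX (f n - z)) \<longlonglongrightarrow> 0"
    by (rule Lim_null_comparison[OF always_eventually LIMSEQ_inverse_real_of_nat])
      (use f z in \<open>auto simp: xs.nm_nonneg xs.V_diff intro: less_imp_le\<close>)
  have "(\<lambda>n. Qform (f n)) \<longlonglongrightarrow> Qform z"
    unfolding Qform_def using f(1) z
    by (intro tendsto_intros xs.nm_tendsto l2.ip_tendsto N2_tendsto l) (auto simp: X_D)
  moreover have "\<forall>\<^sub>F n in sequentially. Qform z + e \<le> Qform (f n)"
    using f(3) by (auto intro!: always_eventually less_imp_le)
  ultimately have "Qform z + e \<le> Qform z"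
    by (rule tendsto_lowerbound) simp
  then show False using e by simp
qed

end

locale wave_semigroup = wave_space +
  fixes S :: "real \<Rightarrow> state \<Rightarrow> state"
  assumes semigroup: "contraction_semigroup_of_A a b \<tau> \<epsilon> S"
begin

lemmas semigroup_facts = semigroup[unfolded contraction_semigroup_of_A_def]

lemma S_X: "0 \<le> t \<Longrightarrow> z \<in> X a b \<Longrightarrow> S t z \<in> X a b"
  by (rule semigroup_facts[THEN conjunct1, rule_format])

lemma S_linear: "0 \<le> t \<Longrightarrow> z \<in> X a b \<Longrightarrow> z' \<in> X a b \<Longrightarrow> Xeq a b \<tau> \<epsilon> (S t (c *\<^sub>R z + z')) (c *\<^sub>R S t z + S t z')"
  by (rule semigroup_facts[THEN conjunct2, THEN conjunct1, rule_format])

lemma S_contr: "0 \<le> t \<Longrightarrow> z \<in> X a b \<Longrightarrow> NX (S t z) \<le> NX z"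
  by (rule semigroup_facts[THEN conjunct2, THEN conjunct2, THEN conjunct1, rule_format])

lemma S_0: "z \<in> X a b \<Longrightarrow> Xeq a b \<tau> \<epsilon> (S 0 z) z"
  by (rule semigroup_facts[THEN conjunct2, THEN conjunct2, THEN conjunct2, THEN conjunct1, rule_format])

lemma S_add: "0 \<le> s \<Longrightarrow> 0 \<le> t \<Longrightarrow> z \<in> X a b \<Longrightarrow> Xeq a b \<tau> \<epsilon> (S (s + t) z) (S s (S t z))"
  by (rule semigroup_facts[THEN conjunct2, THEN conjunct2, THEN conjunct2, THEN conjunct2, THEN conjunct1, rule_format])

lemma S_strong: "z \<in> X a b \<Longrightarrow> ((\<lambda>t. NX (S t z - z)) \<longlongrightarrow> 0) (at_right 0)"
  by (rule semigroup_facts[THEN conjunct2, THEN conjunct2, THEN conjunct2, THEN conjunct2, THEN conjunct2, THEN conjunct1, rule_format])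

lemma S_generator: "z \<in> X a b \<Longrightarrow> \<zeta> \<in> X a b \<Longrightarrow> ((\<lambda>h. NX ((1 / h) *\<^sub>R (S h z - z) - \<zeta>)) \<longlongrightarrow> 0) (at_right 0) \<longleftrightarrow>
       (\<exists>z'\<in>dom_A a b. Xeq a b \<tau> \<epsilon> z z' \<and> Xeq a b \<tau> \<epsilon> \<zeta> (op_A a b \<tau> \<epsilon> z'))"
  by (rule semigroup_facts[THEN conjunct2, THEN conjunct2, THEN conjunct2, THEN conjunct2, THEN conjunct2, THEN conjunct2, rule_format])

text \<open>Linearity for Riemann sums. It holds only up to null elements, so every application of S
  to a sum is a comparison at distance zero.\<close>

lemma S_sum:
  assumes "0 \<le> t" "finite I" "\<And>i. i \<in> I \<Longrightarrow> z i \<in> X a b"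
  shows "Xeq a b \<tau> \<epsilon> (S t (\<Sum>i\<in>I. c i *\<^sub>R z i)) (\<Sum>i\<in>I. c i *\<^sub>R S t (z i))"
  using assms(2,3)
proof (induction I rule: finite_induct)
  case empty
  have "NX (S t 0) \<le> 0" using S_contr[OF assms(1) xs.V_zero] by (simp add: xs.nm_zero)
  then show ?case using xs.nm_nonneg[OF S_X[OF assms(1) xs.V_zero]] by (simp add: Xeq_def)
next
  case (insert i I)
  let ?r = "\<Sum>i\<in>I. c i *\<^sub>R z i" and ?q = "\<Sum>i\<in>I. c i *\<^sub>R S t (z i)"
  have r: "?r \<in> X a b" using insert by (intro xs.V_sum xs.V_scale) auto
  have q: "?q \<in> X a b" using insert assms by (intro xs.V_sum xs.V_scale S_X) auto
  have zi: "z i \<in> X a b" using insert by auto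
  have sz: "S t (z i) \<in> X a b" "S t ?r \<in> X a b" using zi r assms by (auto intro: S_X)
  have "NX (S t ?r - ?q) = 0" using insert by (simp add: Xeq_def)
  then have "Xeq a b \<tau> \<epsilon> (c i *\<^sub>R S t (z i) + S t ?r) (c i *\<^sub>R S t (z i) + ?q)"
    by (simp add: Xeq_def)
  with S_linear[OF assms(1) zi r] have "Xeq a b \<tau> \<epsilon> (S t (c i *\<^sub>R z i + ?r)) (c i *\<^sub>R S t (z i) + ?q)"
    using assms zi r q sz
    by (rule_tac Xeq_trans[where y="c i *\<^sub>R S t (z i) + S t ?r"]) (auto intro!: S_X xs.V_add xs.V_scale)
  then show ?case using insert by simp
qed

lemma S_diff:
  assumes "0 \<le> t" "z \<in> X a b" "z' \<in> X a b"
  shows "NX (S t z - S t z') \<le> NX (z - z')" and "NX (S t (z - z') - (S t z - S t z')) = 0"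
proof -
  have "Xeq a b \<tau> \<epsilon> (S t ((-1) *\<^sub>R z' + z)) ((-1) *\<^sub>R S t z' + S t z)"
    using assms by (intro S_linear)
  then show e: "NX (S t (z - z') - (S t z - S t z')) = 0" by (simp add: Xeq_def)
  have "NX (S t z - S t z') = NX (S t (z - z'))"
    using e assms xs.nm_cong0[of "S t (z - z')" "S t z - S t z'"] by (auto simp: S_X xs.V_diff)
  also have "\<dots> \<le> NX (z - z')" using assms by (intro S_contr xs.V_diff)
  finally show "NX (S t z - S t z') \<le> NX (z - z')" .
qed

lemma S_increment:
  assumes "0 \<le> r" "0 \<le> h" "z \<in> X a b"
  shows "NX (S (r + h) z - S r z) \<le> NX (S h z - z)"
proof -
  have "NX (S (r + h) z - S r z) = NX (S r (S h z) - S r z)"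
    using xs.nm_replace[of "S (r + h) z" "S r (S h z)" "S r z" "S r z" 0] S_add[OF assms] assms
    by (simp add: Xeq_def S_X xs.V_zero xs.nm_zero)
  also have "\<dots> \<le> NX (S h z - z)" using assms by (intro S_diff S_X)
  finally show ?thesis .
qed

lemma S_small:
  assumes z: "z \<in> X a b" and e: "e > 0"
  obtains d where "d > 0" "\<And>r. 0 \<le> r \<Longrightarrow> r \<le> d \<Longrightarrow> NX (S r z - z) < e"
proof -
  have "\<forall>\<^sub>F t in at_right 0. NX (S t z - z) < e"
    using S_strong[OF z] e by (rule order_tendstoD)
  then obtain d where d: "d > 0" "\<And>t. 0 < t \<Longrightarrow> t < d \<Longrightarrow> NX (S t z - z) < e"
    unfolding eventually_at_right[OF zero_less_one] by blast
  have "NX (S r z - z) < e" if "0 \<le> r" "r \<le> d / 2" for r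
    using d that S_0[OF z] e by (cases "r = 0") (auto simp: Xeq_def)
  then show ?thesis using d that[of "d / 2"] by auto
qed

text \<open>Contractivity transports continuity at 0 to every time: an increment between s and t is
  at most the increment of the orbit over [0, |s - t|].\<close>

lemma S_continuous:
  assumes z: "z \<in> X a b" and t: "0 \<le> t"
  shows "((\<lambda>s. NX (S s z - S t z)) \<longlongrightarrow> 0) (at t within {0..})"
proof (rule tendstoI)
  fix e :: real assume "e > 0"
  then obtain d where d: "d > 0" "\<And>r. 0 \<le> r \<Longrightarrow> r \<le> d \<Longrightarrow> NX (S r z - z) < e"
    using S_small[OF z] by blast
  have "NX (S s z - S t z) < e" if s: "0 \<le> s" "dist s t < d" for s
  proof (cases "s \<le> t")
    case True
    have "NX (S s z - S t z) = NX (S t z - S s z)" using z s t by (intro xs.nm_minus_commute S_X)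
    then show ?thesis using S_increment[of s "t - s" z] d(2)[of "t - s"] True s z by (simp add: dist_real_def)
  next
    case False
    then show ?thesis using S_increment[of t "s - t" z] d(2)[of "s - t"] t s z by (simp add: dist_real_def)
  qed
  moreover have "NX (S s z - S t z) \<ge> 0" if "0 \<le> s" for s using that z t by (intro xs.nm_nonneg xs.V_diff S_X)
  ultimately show "\<forall>\<^sub>F s in at t within {0..}. dist (NX (S s z - S t z)) 0 < e"
    unfolding eventually_at using d(1) by (intro exI[of _ d]) auto
qed

text \<open>The difference quotient at time r is S(r) applied to the quotient at time 0, hence it
  converges. By the characterisation of the generator, S(r) z then agrees with an element z' of the
  domain and the limit with A z'; z' is a representative, since S(r) z itself is fixed only up to
  null elements.\<close>

lemma S_derivative:
  assumes z: "z \<in> dom_A a b" and r: "0 \<le> r" and e: "e > 0"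
  obtains z' where "z' \<in> dom_A a b" "Xeq a b \<tau> \<epsilon> (S r z) z'"
    "\<forall>\<^sub>F h in at_right 0. NX (S (r + h) z - S r z - h *\<^sub>R op_A a b \<tau> \<epsilon> z') \<le> h * e"
proof -
  have zX: "z \<in> X a b" using z by (rule dom_A_X)
  let ?\<zeta> = "op_A a b \<tau> \<epsilon> z"
  have \<zeta>X: "?\<zeta> \<in> X a b" using z by (rule op_A_dissipative)
  have l0: "((\<lambda>h. NX ((1 / h) *\<^sub>R (S h z - z) - ?\<zeta>)) \<longlongrightarrow> 0) (at_right 0)"
    using S_generator[OF zX \<zeta>X] z Xeq_refl[OF zX] Xeq_refl[OF \<zeta>X] by blast
  have SzX: "S r z \<in> X a b" and S\<zeta>X: "S r ?\<zeta> \<in> X a b" using r zX \<zeta>X by (auto intro: S_X)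
  have le: "NX ((1 / h) *\<^sub>R (S h (S r z) - S r z) - S r ?\<zeta>) \<le> NX ((1 / h) *\<^sub>R (S h z - z) - ?\<zeta>)" if h: "0 < h" for h
  proof -
    have hX: "S h z \<in> X a b" "S h (S r z) \<in> X a b" "S (h + r) z \<in> X a b" "S r (S h z) \<in> X a b"
      using h r zX SzX by (auto intro!: S_X)
    have d: "S h z - z \<in> X a b" using hX zX by (intro xs.V_diff)
    have c: "Xeq a b \<tau> \<epsilon> (S h (S r z)) (S r (S h z))"
    proof (rule Xeq_trans)
      show "Xeq a b \<tau> \<epsilon> (S h (S r z)) (S (h + r) z)"
        using S_add[of h r z] h r zX hX by (metis Xeq_sym less_imp_le)
      show "Xeq a b \<tau> \<epsilon> (S (h + r) z) (S r (S h z))"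
        using S_add[of r h z] h r zX by (simp add: add.commute)
    qed (use hX in auto)
    have rd: "S r (S h z - z) \<in> X a b" using r d by (rule S_X)
    have "NX (S h (S r z) - S r z - S r (S h z - z)) = 0"
    proof -
      have "NX (S h (S r z) - S r z - S r (S h z - z)) = NX (S r (S h z) - S r z - S r (S h z - z))"
        using c hX SzX rd by (intro xs.nm_replace) (auto simp: Xeq_def xs.nm_zero)
      also have "\<dots> = NX (S r (S h z - z) - (S r (S h z) - S r z))"
        using hX SzX rd by (intro xs.nm_minus_commute xs.V_diff)
      also have "\<dots> = 0" using r hX zX by (intro S_diff)
      finally show ?thesis .
    qed
    then have 1: "NX ((1 / h) *\<^sub>R (S h (S r z) - S r z) - (1 / h) *\<^sub>R S r (S h z - z)) = 0"
      unfolding scaleR_diff_right[symmetric] using hX SzX rd by (simp add: xs.nm_scale xs.V_diff)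
    have "NX (S r ((1 / h) *\<^sub>R (S h z - z) + (-1) *\<^sub>R ?\<zeta>) - ((1 / h) *\<^sub>R S r (S h z - z) + S r ((-1) *\<^sub>R ?\<zeta>))) = 0"
      using S_linear[OF r d, of "(-1) *\<^sub>R ?\<zeta>" "1 / h"] \<zeta>X by (simp add: Xeq_def xs.V_scale xs.V_minus)
    \<comment> \<open>Linearity is given for combinations c z + z'; a one-term sum supplies the pure
      multiple by -1.\<close>
    moreover have "NX (S r (0 + (-1) *\<^sub>R ?\<zeta>) - (-1) *\<^sub>R S r ?\<zeta>) = 0"
      using S_sum[OF r, of "{0::nat}" "\<lambda>_. ?\<zeta>" "\<lambda>_. -1"] \<zeta>X by (simp add: Xeq_def)
    ultimately have "NX (S r ((1 / h) *\<^sub>R (S h z - z) - ?\<zeta>) - ((1 / h) *\<^sub>R S r (S h z - z) - S r ?\<zeta>)) = 0"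
    proof -
      let ?x = "S r ((1 / h) *\<^sub>R (S h z - z) + (-1) *\<^sub>R ?\<zeta>)" and ?y = "(1 / h) *\<^sub>R S r (S h z - z)"
      assume a1: "NX (?x - (?y + S r ((-1) *\<^sub>R ?\<zeta>))) = 0" and a2: "NX (S r (0 + (-1) *\<^sub>R ?\<zeta>) - (-1) *\<^sub>R S r ?\<zeta>) = 0"
      have m: "?x \<in> X a b" "?y \<in> X a b" "S r ((-1) *\<^sub>R ?\<zeta>) \<in> X a b" "(-1) *\<^sub>R S r ?\<zeta> \<in> X a b"
        using r d \<zeta>X rd S\<zeta>X by (auto intro!: S_X xs.V_add xs.V_scale xs.V_diff xs.V_scale[of _ "-1", simplified])
      have "Xeq a b \<tau> \<epsilon> ?x (?y + (-1) *\<^sub>R S r ?\<zeta>)"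
      proof (rule Xeq_trans)
        show "Xeq a b \<tau> \<epsilon> ?x (?y + S r ((-1) *\<^sub>R ?\<zeta>))" using a1 by (simp add: Xeq_def)
        show "Xeq a b \<tau> \<epsilon> (?y + S r ((-1) *\<^sub>R ?\<zeta>)) (?y + (-1) *\<^sub>R S r ?\<zeta>)" using a2 by (simp add: Xeq_def)
      qed (use m xs.V_add[OF m(2,3)] xs.V_add[OF m(2,4)] in auto)
      then show ?thesis by (simp add: Xeq_def)
    qed
    then have 2: "NX ((1 / h) *\<^sub>R S r (S h z - z) - S r ?\<zeta>) = NX (S r ((1 / h) *\<^sub>R (S h z - z) - ?\<zeta>))"
      using r d \<zeta>X rd S\<zeta>X
      by (intro xs.nm_cong0[symmetric]) (auto intro!: S_X xs.V_add xs.V_scale xs.V_diff)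
    have "NX ((1 / h) *\<^sub>R (S h (S r z) - S r z) - S r ?\<zeta>) = NX ((1 / h) *\<^sub>R S r (S h z - z) - S r ?\<zeta>)"
      using 1 rd hX SzX S\<zeta>X
        xs.nm_replace[of "(1 / h) *\<^sub>R (S h (S r z) - S r z)" "(1 / h) *\<^sub>R S r (S h z - z)" "S r ?\<zeta>" "S r ?\<zeta>" 0]
      by (simp add: xs.V_scale xs.V_diff xs.V_zero xs.nm_zero)
    also note 2
    also have "NX (S r ((1 / h) *\<^sub>R (S h z - z) - ?\<zeta>)) \<le> NX ((1 / h) *\<^sub>R (S h z - z) - ?\<zeta>)"
      using r d \<zeta>X hX zX by (intro S_contr xs.V_diff xs.V_scale)
    finally show ?thesis .
  qed
  have pos: "\<forall>\<^sub>F h in at_right (0::real). 0 < h" by (rule eventually_at_right_less)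
  have "((\<lambda>h. NX ((1 / h) *\<^sub>R (S h (S r z) - S r z) - S r ?\<zeta>)) \<longlongrightarrow> 0) (at_right 0)"
  proof (rule Lim_null_comparison[OF _ l0])
    show "\<forall>\<^sub>F h in at_right 0. norm (NX ((1 / h) *\<^sub>R (S h (S r z) - S r z) - S r ?\<zeta>)) \<le> NX ((1 / h) *\<^sub>R (S h z - z) - ?\<zeta>)"
      using pos
    proof eventually_elim
      case (elim h)
      have "0 \<le> NX ((1 / h) *\<^sub>R (S h (S r z) - S r z) - S r ?\<zeta>)"
        using elim SzX S\<zeta>X S_X[OF _ SzX] by (intro xs.nm_nonneg xs.V_diff xs.V_scale) auto
      then show ?case using le[OF elim] by simp
    qed
  qed
  \<comment> \<open>The generator equivalence is now read from the limit back to the domain.\<close>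
  moreover from calculation obtain z' where z': "z' \<in> dom_A a b" "Xeq a b \<tau> \<epsilon> (S r z) z'" "Xeq a b \<tau> \<epsilon> (S r ?\<zeta>) (op_A a b \<tau> \<epsilon> z')"
    using S_generator[OF SzX S\<zeta>X] by blast
  ultimately have "\<forall>\<^sub>F h in at_right 0. NX ((1 / h) *\<^sub>R (S h (S r z) - S r z) - S r ?\<zeta>) < e"
    using e by (intro order_tendstoD)
  with pos have "\<forall>\<^sub>F h in at_right 0. NX (S (r + h) z - S r z - h *\<^sub>R op_A a b \<tau> \<epsilon> z') \<le> h * e"
  proof eventually_elim
    case (elim h)
    let ?A = "op_A a b \<tau> \<epsilon> z'"
    have m: "S (r + h) z \<in> X a b" "S (h + r) z \<in> X a b" "S h (S r z) \<in> X a b" "?A \<in> X a b"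
      using elim r zX SzX z' by (auto intro!: S_X op_A_dissipative)
    have "Xeq a b \<tau> \<epsilon> (S (h + r) z) (S h (S r z))" using elim r zX by (intro S_add) auto
    then have e1: "NX (S (r + h) z - S h (S r z)) = 0" by (simp add: Xeq_def add.commute)
    have e2: "NX (h *\<^sub>R ?A - h *\<^sub>R S r ?\<zeta>) = 0"
      using z'(3) m S\<zeta>X xs.nm_minus_commute[of ?A "S r ?\<zeta>"]
      unfolding scaleR_diff_right[symmetric] by (simp add: xs.nm_scale xs.V_diff Xeq_def)
    have "NX (S (r + h) z - h *\<^sub>R ?A - S r z) = NX (S h (S r z) - h *\<^sub>R S r ?\<zeta> - S r z)"
      by (rule xs.nm_replace[OF _ _ _ _ _ e1 e2]) (use m SzX S\<zeta>X in \<open>auto intro!: xs.V_scale\<close>)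
    also have "S h (S r z) - h *\<^sub>R S r ?\<zeta> - S r z = h *\<^sub>R ((1 / h) *\<^sub>R (S h (S r z) - S r z) - S r ?\<zeta>)"
      using elim by (simp add: scaleR_diff_right)
    also have "NX \<dots> = h * NX ((1 / h) *\<^sub>R (S h (S r z) - S r z) - S r ?\<zeta>)"
      using elim m SzX S\<zeta>X by (subst xs.nm_scale) (auto intro!: xs.V_scale xs.V_diff)
    also have "\<dots> \<le> h * e" using elim by simp
    finally show ?case by (simp add: algebra_simps)
  qed
  with z' show ?thesis by (intro that)
qed

end

lemma eventually_mult_le:
  fixes c e :: real
  assumes "e > 0"
  shows "\<forall>\<^sub>F k in at_right 0. k * c \<le> e"
proof -
  have "((\<lambda>k. k * c) \<longlongrightarrow> 0 * c) (at_right 0)" by (intro tendsto_intros)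
  then have "\<forall>\<^sub>F k in at_right 0. k * c < e" using assms by (intro order_tendstoD) auto
  then show ?thesis by eventually_elim simp
qed

context wave_space
begin

lemma Qform_Xeq:
  assumes "x \<in> X a b" "y \<in> X a b" "Xeq a b \<tau> \<epsilon> x y"
  shows "Qform x = Qform y"
proof -
  note D = X_D[OF assms(1)] X_D[OF assms(2)] and E = Xeq_N2[OF assms]
  have "l2ip a b (fst x) (snd x) = l2ip a b (fst y) (snd x)" using D E by (intro l2.ip_cong0)
  also have "\<dots> = l2ip a b (snd x) (fst y)" using D by (intro l2.ip_commute)
  also have "\<dots> = l2ip a b (snd y) (fst y)" using D E by (intro l2.ip_cong0)
  also have "\<dots> = l2ip a b (fst y) (snd y)" using D by (intro l2.ip_commute)
  finally show ?thesis using Xeq_NX[OF assms] by (simp add: Qform_def)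
qed

lemma dom_A_seq:
  assumes z: "z \<in> X a b"
  obtains zn :: "nat \<Rightarrow> state" where "\<And>n. zn n \<in> dom_A a b" "(\<lambda>n. NX (zn n - z)) \<longlonglongrightarrow> 0"
proof -
  have "\<exists>z'. z' \<in> dom_A a b \<and> NX (z' - z) < inverse (real (Suc n))" for n
  proof -
    have "inverse (real (Suc n)) > 0" by simp
    then show ?thesis using dom_A_dense[OF z] by metis
  qed
  then obtain zn where zn: "\<And>n. zn n \<in> dom_A a b" "\<And>n. NX (zn n - z) < inverse (real (Suc n))"
    by metis
  have "(\<lambda>n. NX (zn n - z)) \<longlonglongrightarrow> 0"
  proof (rule Lim_null_comparison[OF always_eventually LIMSEQ_inverse_real_of_nat], rule allI)
    show "norm (NX (zn n - z)) \<le> inverse (real (Suc n))" for n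
      using zn(2)[of n] xs.nm_nonneg[OF xs.V_diff[OF dom_A_X[OF zn(1)] z], of n] by simp
  qed
  with zn(1) show ?thesis by (rule that)
qed

end

context wave_semigroup
begin

lemma S_curve_tendsto:
  assumes z: "z \<in> X a b" and t: "0 \<le> t" "t \<le> T"
  shows "((\<lambda>s. NX (S s z - S t z)) \<longlongrightarrow> 0) (at t within {0..T})"
    and "\<forall>\<^sub>F s in at t within {0..T}. S s z \<in> X a b"
  using tendsto_within_subset[OF S_continuous[OF z t(1)], of "{0..T}"] S_X[OF _ z]
  by (auto simp: eventually_at_filter)

text \<open>For z' in the domain, half the squared norm along its orbit has right derivative
  \<open>Qform\<close>, which stays below Qform z + e while the orbit is near z. Integrating over
  [0, h] for h up to a bound independent of z', and then letting z' tend to z, gives the estimate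
  outside the domain.\<close>

lemma S_half_square:
  assumes z: "z \<in> X a b" and e: "e > 0"
  shows "\<forall>\<^sub>F h in at_right 0. (NX (S h z))\<^sup>2 / 2 \<le> (NX z)\<^sup>2 / 2 + h * (Qform z + e)"
proof -
  obtain d1 where d1: "d1 > 0" "\<And>z'. z' \<in> X a b \<Longrightarrow> NX (z' - z) < d1 \<Longrightarrow> Qform z' \<le> Qform z + e"
    using Qform_upper[OF z e] by blast
  \<comment> \<open>Half of d1 is for the motion of the orbit of z, the other half for the distance
    between z' and z, which S does not increase.\<close>
  obtain d2 where d2: "d2 > 0" "\<And>r. 0 \<le> r \<Longrightarrow> r \<le> d2 \<Longrightarrow> NX (S r z - z) < d1 / 2"
    using S_small[OF z, of "d1/2"] d1(1) by auto
  obtain zn where zn: "\<And>n. zn n \<in> dom_A a b" "(\<lambda>n. NX (zn n - z)) \<longlonglongrightarrow> 0"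
    using dom_A_seq[OF z] by metis
  have znX: "zn n \<in> X a b" for n using zn(1) by (rule dom_A_X)
  have main: "(NX (S h z))\<^sup>2 / 2 \<le> (NX z)\<^sup>2 / 2 + h * (Qform z + e)" if h: "0 < h" "h \<le> d2" for h
  proof -
    have step: "(NX (S h z'))\<^sup>2 / 2 \<le> (NX z')\<^sup>2 / 2 + h * (Qform z + e)"
      if z': "z' \<in> dom_A a b" "NX (z' - z) < d1 / 2" for z'
    proof -
      have z'X: "z' \<in> X a b" using z'(1) by (rule dom_A_X)
      have "(NX (S h z'))\<^sup>2 / 2 \<le> (NX (S 0 z'))\<^sup>2 / 2 + h * (Qform z + e)"
      proof (rule dini_bound_const)
        show "0 \<le> h" using h by simp
        have "continuous_on {0..h} (\<lambda>s. NX (S s z'))"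
          unfolding continuous_on
          using S_curve_tendsto[OF z'X] S_X[OF _ z'X] by (auto intro!: xs.nm_tendsto_eventually)
        then show "continuous_on {0..h} (\<lambda>s. (NX (S s z'))\<^sup>2 / 2)" by (intro continuous_intros) auto
        fix r e' :: real assume r: "0 \<le> r" "r < h" "e' > 0"
        define x where "x = S r z'"
        have xX: "x \<in> X a b" unfolding x_def using r z'X by (intro S_X)
        \<comment> \<open>The error e1 in the expansion of the orbit is multiplied by |x| in the
          expansion of the square; adding 1 covers |x| = 0.\<close>
        define e1 where "e1 = e' / (2 * (NX x + 1))"
        have n0: "NX x \<ge> 0" using xX by (rule xs.nm_nonneg)
        then have e1: "e1 > 0" "NX x * e1 \<le> e' / 2" using r by (auto simp: e1_def field_simps)
        obtain z'' where z'': "z'' \<in> dom_A a b" "Xeq a b \<tau> \<epsilon> x z''"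
          "\<forall>\<^sub>F k in at_right 0. NX (S (r + k) z' - x - k *\<^sub>R op_A a b \<tau> \<epsilon> z'') \<le> k * e1"
          using S_derivative[OF z'(1) r(1) e1(1)] unfolding x_def by blast
        let ?A = "op_A a b \<tau> \<epsilon> z''"
        have AX: "?A \<in> X a b" and z''X: "z'' \<in> X a b" using z''(1) op_A_dissipative dom_A_X by auto
        have "Xinner a b \<tau> \<epsilon> x ?A = Xinner a b \<tau> \<epsilon> z'' ?A"
          using z''(2) xX z''X AX by (intro xs.ip_cong0) (auto simp: Xeq_def)
        also have "\<dots> = Qform z''" using op_A_dissipative(3)[OF z''(1)] by (simp add: Qform_def)
        also have "\<dots> = Qform x" using Qform_Xeq[OF xX z''X z''(2)] by simp
        also have "\<dots> \<le> Qform z + e"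
        proof (rule d1(2)[OF xX])
          have "NX (x - z) \<le> NX (x - S r z) + NX (S r z - z)"
            using xX z r by (intro xs.nm_triangle3 S_X)
          also have "NX (x - S r z) \<le> NX (z' - z)" unfolding x_def using r z'X z by (intro S_diff)
          finally show "NX (x - z) < d1" using z'(2) d2(2)[of r] r h by simp
        qed
        finally have Q: "Xinner a b \<tau> \<epsilon> x ?A \<le> Qform z + e" .
        have "\<forall>\<^sub>F k in at_right 0. k * ((NX ?A + e1)\<^sup>2 / 2) \<le> e' / 2"
          using r by (intro eventually_mult_le) simp
        with z''(3) eventually_at_right_less[of 0]
        show "\<forall>\<^sub>F k in at_right 0. (NX (S (r + k) z'))\<^sup>2 / 2 \<le> (NX (S r z'))\<^sup>2 / 2 + k * (Qform z + e + e')"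
        proof eventually_elim
          case (elim k)
          have "(NX (S (r + k) z'))\<^sup>2 / 2 \<le> (NX x)\<^sup>2 / 2 + k * (Xinner a b \<tau> \<epsilon> x ?A + NX x * e1 + k * (NX ?A + e1)\<^sup>2 / 2)"
            using elim r z'X xX AX by (intro xs.half_square_step S_X) auto
          also have "\<dots> \<le> (NX x)\<^sup>2 / 2 + k * (Qform z + e + e')"
            using elim Q e1 by (intro add_left_mono mult_left_mono) auto
          finally show ?case by (simp add: x_def)
        qed
      qed
      also have "NX (S 0 z') = NX z'" using z'X by (intro Xeq_NX S_X S_0) auto
      finally show ?thesis .
    qed
    have hX: "S h z \<in> X a b" "S h (zn n) \<in> X a b" for n using h z znX by (auto intro: S_X)
    have "(\<lambda>n. NX (S h (zn n) - S h z)) \<longlonglongrightarrow> 0"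
      by (rule Lim_null_comparison[OF always_eventually zn(2)])
        (use S_diff(1)[OF _ znX z] h xs.nm_nonneg[OF xs.V_diff[OF hX(2,1)]] in auto)
    then have "(\<lambda>n. NX (S h (zn n))) \<longlonglongrightarrow> NX (S h z)" using hX by (intro xs.nm_tendsto)
    then have l1: "(\<lambda>n. (NX (S h (zn n)))\<^sup>2 / 2) \<longlonglongrightarrow> (NX (S h z))\<^sup>2 / 2" by (intro tendsto_intros) auto
    have "(\<lambda>n. NX (zn n)) \<longlonglongrightarrow> NX z" using znX z zn(2) by (intro xs.nm_tendsto)
    then have l2: "(\<lambda>n. (NX (zn n))\<^sup>2 / 2 + h * (Qform z + e)) \<longlonglongrightarrow> (NX z)\<^sup>2 / 2 + h * (Qform z + e)"
      by (intro tendsto_intros) auto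
    have "\<forall>\<^sub>F n in sequentially. NX (zn n - z) < d1 / 2" using zn(2) d1(1) by (intro order_tendstoD) auto
    then have "\<forall>\<^sub>F n in sequentially. (NX (S h (zn n)))\<^sup>2 / 2 \<le> (NX (zn n))\<^sup>2 / 2 + h * (Qform z + e)"
      by eventually_elim (use step zn(1) in auto)
    then show ?thesis by (rule tendsto_le[OF sequentially_bot l2 l1])
  qed
  show ?thesis unfolding eventually_at_right[OF d2(1)] using main by (intro exI[of _ d2]) (use d2 in auto)
qed

text \<open>The scheme of \<open>S_half_square\<close> for another quantity: on the domain the first
  component moves with velocity w - u, which is continuous on X and so stays within e of its value
  at z. The estimate is integrated on the domain and extended by density.\<close>

lemma S_fst_expansion:
  assumes z: "z \<in> X a b" and e: "e > 0"
  shows "\<forall>\<^sub>F h in at_right 0. N2 (fst (S h z) - fst z - h *\<^sub>R (snd z - fst z)) \<le> h * e"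
proof -
  define v where "v = snd z - fst z"
  have vL: "v \<in> L2 a b" unfolding v_def using z by (intro l2.V_diff X_D)
  \<comment> \<open>A state within 2 \<delta> of z has a velocity w - u differing by at most 4
    \<delta> / sqrt \<tau> = e.\<close>
  define \<delta> where "\<delta> = e * sqrt \<tau> / 4"
  have \<delta>: "\<delta> > 0" using e \<tau> by (simp add: \<delta>_def)
  have near: "N2 (snd y - fst y - v) \<le> e" if y: "y \<in> X a b" "NX (y - z) < 2 * \<delta>" for y
  proof -
    have d: "y - z \<in> X a b" using y z by (intro xs.V_diff)
    have "N2 (snd (y - z) - fst (y - z)) \<le> N2 (snd (y - z)) + N2 (fst (y - z))"
      using d by (intro l2.nm_diff_le X_D)
    also have "\<dots> \<le> NX (y - z) / sqrt \<tau> + NX (y - z) / sqrt \<tau>"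
      using d by (intro add_mono N2_fst_le N2_snd_le)
    also have "\<dots> \<le> e" using y(2) \<tau> by (simp add: \<delta>_def field_simps)
    finally show ?thesis by (simp add: v_def algebra_simps)
  qed
  obtain d2 where d2: "d2 > 0" "\<And>r. 0 \<le> r \<Longrightarrow> r \<le> d2 \<Longrightarrow> NX (S r z - z) < \<delta>"
    using S_small[OF z \<delta>] by blast
  obtain zn where zn: "\<And>n. zn n \<in> dom_A a b" "(\<lambda>n. NX (zn n - z)) \<longlonglongrightarrow> 0"
    using dom_A_seq[OF z] by metis
  have znX: "zn n \<in> X a b" for n using zn(1) by (rule dom_A_X)
  have main: "N2 (fst (S h z) - fst z - h *\<^sub>R v) \<le> h * e" if h: "0 < h" "h \<le> d2" for h
  proof -
    have step: "N2 (fst (S h z') - fst (S 0 z') - h *\<^sub>R v) \<le> h * e"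
      if z': "z' \<in> dom_A a b" "NX (z' - z) < \<delta>" for z'
    proof -
      have z'X: "z' \<in> X a b" using z'(1) by (rule dom_A_X)
      have SX: "S s z' \<in> X a b" if "0 \<le> s" for s using that z'X by (rule S_X)
      have \<phi>L: "fst (S s z') - fst (S 0 z') - s *\<^sub>R v \<in> L2 a b" if "0 \<le> s" for s
        using that SX vL by (intro l2.V_diff l2.V_scale X_D) auto
      have "N2 (fst (S h z') - fst (S 0 z') - h *\<^sub>R v) \<le> N2 (fst (S 0 z') - fst (S 0 z') - 0 *\<^sub>R v) + h * e"
      proof (rule dini_bound_const)
        show "0 \<le> h" using h by simp
        show "continuous_on {0..h} (\<lambda>s. N2 (fst (S s z') - fst (S 0 z') - s *\<^sub>R v))"
          unfolding continuous_on
        proof (intro ballI l2.nm_tendsto_eventually)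
          fix t assume t: "t \<in> {0..h}"
          show "\<forall>\<^sub>F s in at t within {0..h}. fst (S s z') - fst (S 0 z') - s *\<^sub>R v \<in> L2 a b"
            using \<phi>L by (auto simp: eventually_at_filter)
          show "fst (S t z') - fst (S 0 z') - t *\<^sub>R v \<in> L2 a b" using \<phi>L t by auto
          have "((\<lambda>s. NX (S s z' - S t z') / sqrt \<tau> + \<bar>s - t\<bar> * N2 v) \<longlongrightarrow> 0 / sqrt \<tau> + \<bar>t - t\<bar> * N2 v) (at t within {0..h})"
            using t \<tau> by (intro tendsto_intros S_curve_tendsto z'X) auto
          then have l: "((\<lambda>s. NX (S s z' - S t z') / sqrt \<tau> + \<bar>s - t\<bar> * N2 v) \<longlongrightarrow> 0) (at t within {0..h})" by simp
          show "((\<lambda>s. N2 (fst (S s z') - fst (S 0 z') - s *\<^sub>R v - (fst (S t z') - fst (S 0 z') - t *\<^sub>R v))) \<longlongrightarrow> 0) (at t within {0..h})"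
          proof (rule Lim_null_comparison[OF _ l])
            have "norm (N2 (fst (S s z') - fst (S 0 z') - s *\<^sub>R v - (fst (S t z') - fst (S 0 z') - t *\<^sub>R v)))
                \<le> NX (S s z' - S t z') / sqrt \<tau> + \<bar>s - t\<bar> * N2 v" if s: "0 \<le> s" for s
            proof -
              have d: "S s z' - S t z' \<in> X a b" using s t SX by (intro xs.V_diff) auto
              have eq: "fst (S s z') - fst (S 0 z') - s *\<^sub>R v - (fst (S t z') - fst (S 0 z') - t *\<^sub>R v) = fst (S s z' - S t z') - (s - t) *\<^sub>R v"
                by (simp add: algebra_simps)
              have "N2 (fst (S s z' - S t z') - (s - t) *\<^sub>R v) \<le> N2 (fst (S s z' - S t z')) + N2 ((s - t) *\<^sub>R v)"
                using X_D[OF d] vL by (intro l2.nm_diff_le l2.V_scale)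
              moreover have "N2 ((s - t) *\<^sub>R v) = \<bar>s - t\<bar> * N2 v" using vL by (rule l2.nm_scale)
              moreover have "0 \<le> N2 (fst (S s z' - S t z') - (s - t) *\<^sub>R v)"
                using X_D[OF d] vL by (intro l2.nm_nonneg l2.V_diff l2.V_scale)
              ultimately show ?thesis unfolding eq using N2_fst_le[OF d] by simp
            qed
            then show "\<forall>\<^sub>F s in at t within {0..h}. norm (N2 (fst (S s z') - fst (S 0 z') - s *\<^sub>R v - (fst (S t z') - fst (S 0 z') - t *\<^sub>R v)))
                \<le> NX (S s z' - S t z') / sqrt \<tau> + \<bar>s - t\<bar> * N2 v" by (auto simp: eventually_at_filter)
          qed
        qed
        fix r e' :: real assume r: "0 \<le> r" "r < h" "e' > 0"
        obtain z'' where z'': "z'' \<in> dom_A a b" "Xeq a b \<tau> \<epsilon> (S r z') z''"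
          "\<forall>\<^sub>F k in at_right 0. NX (S (r + k) z' - S r z' - k *\<^sub>R op_A a b \<tau> \<epsilon> z'') \<le> k * (e' * sqrt \<tau>)"
          using S_derivative[OF z'(1) r(1), of "e' * sqrt \<tau>"] r \<tau> by auto
        let ?A = "op_A a b \<tau> \<epsilon> z''"
        have AX: "?A \<in> X a b" and z''X: "z'' \<in> X a b" using z''(1) op_A_dissipative dom_A_X by auto
        have A: "fst ?A = snd z'' - fst z''" using z''(1) by (rule op_A_dissipative)
        have "NX (z'' - z) = NX (S r z' - z)"
          using z''(2) z''X z SX[OF r(1)] xs.nm_replace[of "S r z'" z'' z z 0]
          by (simp add: Xeq_def xs.V_zero xs.nm_zero)
        also have "NX (S r z' - z) \<le> NX (S r z' - S r z) + NX (S r z - z)"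
          using z z'X r by (intro xs.nm_triangle3 S_X) auto
        also have "NX (S r z' - S r z) \<le> NX (z' - z)" using r z'X z by (intro S_diff)
        finally have "NX (z'' - z) < 2 * \<delta>" using z'(2) d2(2)[of r] r h by simp
        then have nr: "N2 (fst ?A - v) \<le> e" unfolding A using z''X by (intro near)
        from z''(3) eventually_at_right_less[of 0]
        show "\<forall>\<^sub>F k in at_right 0. N2 (fst (S (r + k) z') - fst (S 0 z') - (r + k) *\<^sub>R v)
           \<le> N2 (fst (S r z') - fst (S 0 z') - r *\<^sub>R v) + k * (e + e')"
        proof eventually_elim
          case (elim k)
          define \<rho> where "\<rho> = S (r + k) z' - S r z' - k *\<^sub>R ?A"
          have \<rho>: "\<rho> \<in> X a b" unfolding \<rho>_def using AX SX r elim by (intro xs.V_diff xs.V_scale) auto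
          have eq: "fst (S (r + k) z') - fst (S 0 z') - (r + k) *\<^sub>R v
            = (fst (S r z') - fst (S 0 z') - r *\<^sub>R v) + (fst \<rho> + k *\<^sub>R (fst ?A - v))"
            by (simp add: \<rho>_def algebra_simps)
          have "N2 ((fst (S r z') - fst (S 0 z') - r *\<^sub>R v) + (fst \<rho> + k *\<^sub>R (fst ?A - v)))
            \<le> N2 (fst (S r z') - fst (S 0 z') - r *\<^sub>R v) + N2 (fst \<rho> + k *\<^sub>R (fst ?A - v))"
            using X_D[OF \<rho>] X_D[OF AX] vL by (intro l2.nm_triangle[OF \<phi>L[OF r(1)]] l2.V_add l2.V_scale l2.V_diff)
          moreover have "N2 (fst \<rho> + k *\<^sub>R (fst ?A - v)) \<le> N2 (fst \<rho>) + N2 (k *\<^sub>R (fst ?A - v))"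
            using X_D[OF \<rho>] X_D[OF AX] vL by (intro l2.nm_triangle l2.V_scale l2.V_diff)
          moreover have "N2 (fst \<rho>) \<le> k * e'"
          proof -
            have "N2 (fst \<rho>) \<le> NX \<rho> / sqrt \<tau>" using \<rho> by (rule N2_fst_le)
            also have "\<dots> \<le> k * (e' * sqrt \<tau>) / sqrt \<tau>" using elim \<tau> by (intro divide_right_mono) (auto simp: \<rho>_def)
            finally show ?thesis using \<tau> by simp
          qed
          moreover have "N2 (k *\<^sub>R (fst ?A - v)) \<le> k * e"
            using nr elim l2.nm_scale[OF l2.V_diff[OF X_D(2)[OF AX] vL], of k] by simp
          ultimately show ?case unfolding eq by (simp add: distrib_left)
        qed
      qed
      then show ?thesis by (simp add: l2.nm_zero)
    qed
    have hX: "S h z \<in> X a b" "S h (zn n) \<in> X a b" for n using h z znX by (auto intro: S_X)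
    have l1: "(\<lambda>n. NX (S h (zn n) - S h z)) \<longlonglongrightarrow> 0"
      by (rule Lim_null_comparison[OF always_eventually zn(2)])
        (use S_diff(1)[OF _ znX z] h xs.nm_nonneg[OF xs.V_diff[OF hX(2,1)]] in auto)
    have 0: "S 0 (zn n) \<in> X a b" for n using znX by (intro S_X) auto
    have "NX (S 0 (zn n) - z) = NX (zn n - z)" for n
      using S_0[OF znX] znX z 0 xs.nm_replace[of "S 0 (zn n)" "zn n" z z 0]
      by (simp add: Xeq_def xs.V_zero xs.nm_zero)
    then have l2: "(\<lambda>n. NX (S 0 (zn n) - z)) \<longlonglongrightarrow> 0" using zn(2) by simp
    have "(\<lambda>n. N2 (fst (S h (zn n)) - fst (S 0 (zn n)) - h *\<^sub>R v)) \<longlonglongrightarrow> N2 (fst (S h z) - fst z - h *\<^sub>R v)"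
    proof (rule l2.nm_tendsto)
      let ?r = "\<lambda>n. N2 (fst (S h (zn n)) - fst (S h z)) + N2 (fst (S 0 (zn n)) - fst z)"
      have "?r \<longlonglongrightarrow> 0 + 0" by (intro tendsto_add N2_tendsto l1 l2 hX z 0)
      then have l: "?r \<longlonglongrightarrow> 0" by simp
      show m: "fst (S h (zn n)) - fst (S 0 (zn n)) - h *\<^sub>R v \<in> L2 a b" for n
        using X_D(2)[OF hX(2)] X_D(2)[OF 0] vL by (intro l2.V_diff l2.V_scale)
      show m': "fst (S h z) - fst z - h *\<^sub>R v \<in> L2 a b"
        using X_D(2)[OF hX(1)] X_D(2)[OF z] vL by (intro l2.V_diff l2.V_scale)
      show "(\<lambda>n. N2 (fst (S h (zn n)) - fst (S 0 (zn n)) - h *\<^sub>R v - (fst (S h z) - fst z - h *\<^sub>R v))) \<longlonglongrightarrow> 0"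
      proof (rule Lim_null_comparison[OF always_eventually l], rule allI)
        fix n
        have eq: "fst (S h (zn n)) - fst (S 0 (zn n)) - h *\<^sub>R v - (fst (S h z) - fst z - h *\<^sub>R v)
          = (fst (S h (zn n)) - fst (S h z)) - (fst (S 0 (zn n)) - fst z)" by (simp add: algebra_simps)
        have "N2 ((fst (S h (zn n)) - fst (S h z)) - (fst (S 0 (zn n)) - fst z)) \<le> ?r n"
          using X_D(2)[OF hX(2)] X_D(2)[OF hX(1)] X_D(2)[OF 0] X_D(2)[OF z]
          by (intro l2.nm_diff_le l2.V_diff)
        then show "norm (N2 (fst (S h (zn n)) - fst (S 0 (zn n)) - h *\<^sub>R v - (fst (S h z) - fst z - h *\<^sub>R v))) \<le> ?r n"
          using l2.nm_nonneg[OF l2.V_diff[OF m m'], of n] unfolding eq by simp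
      qed
    qed
    moreover have "\<forall>\<^sub>F n in sequentially. NX (zn n - z) < \<delta>" using zn(2) \<delta> by (intro order_tendstoD) auto
    then have "\<forall>\<^sub>F n in sequentially. N2 (fst (S h (zn n)) - fst (S 0 (zn n)) - h *\<^sub>R v) \<le> h * e"
      by eventually_elim (use step zn(1) in auto)
    ultimately show ?thesis by (rule tendsto_upperbound) simp
  qed
  show ?thesis unfolding eventually_at_right[OF d2(1)] v_def[symmetric]
    using main by (intro exI[of _ d2]) (use d2 in auto)
qed

end

section \<open>The Duhamel formula over a short time step\<close>

section \<open>Mild solutions\<close>

context wave_semigroup
begin

text \<open>The Duhamel integral over [0, t+h] is S(h) applied to the one over [0, t], plus a part
  over [t, t+h] that is close to h H(t). The integrals are compared through Riemann sums: a division
  of [0, t+h] is glued from divisions of [0, t] and [t, t+h].\<close>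

lemma mild_increment:
  assumes H: "\<And>t. 0 \<le> t \<Longrightarrow> H t \<in> X a b" "\<And>t. 0 \<le> t \<Longrightarrow> ((\<lambda>s. NX (H s - H t)) \<longlongrightarrow> 0) (at t within {0..})"
    and y: "\<And>t. 0 \<le> t \<Longrightarrow> y t \<in> X a b" and z0: "z0 \<in> X a b"
    and mild: "\<And>t. 0 \<le> t \<Longrightarrow> \<exists>J. has_X_integral a b \<tau> \<epsilon> (\<lambda>s. S (t - s) (H s)) t J \<and> Xeq a b \<tau> \<epsilon> (y t) (S t z0 + J)"
    and t: "0 \<le> t" and e: "0 < e"
  shows "\<forall>\<^sub>F h in at_right 0. NX (y (t + h) - S h (y t) - h *\<^sub>R H t) \<le> h * e"
proof -
  have "\<forall>\<^sub>F s in at t within {0..}. NX (H s - H t) < e / 2"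
    using H(2)[OF t] e by (intro order_tendstoD) auto
  then obtain d1 where d1: "d1 > 0" "\<And>s. 0 \<le> s \<Longrightarrow> s \<noteq> t \<Longrightarrow> dist s t < d1 \<Longrightarrow> NX (H s - H t) < e / 2"
    unfolding eventually_at by auto
  obtain d2 where d2: "d2 > 0" "\<And>r. 0 \<le> r \<Longrightarrow> r \<le> d2 \<Longrightarrow> NX (S r (H t) - H t) < e / 2"
    using S_small[OF H(1)[OF t], of "e/2"] e by auto
  define d0 where "d0 = min d1 d2"
  have d0: "d0 > 0" using d1 d2 by (simp add: d0_def)
  obtain J1 where J1: "has_X_integral a b \<tau> \<epsilon> (\<lambda>s. S (t - s) (H s)) t J1" "Xeq a b \<tau> \<epsilon> (y t) (S t z0 + J1)"
    using mild[OF t] by blast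
  have J1X: "J1 \<in> X a b" using J1(1) by (simp add: has_X_integral_def)
  have main: "NX (y (t + h) - S h (y t) - h *\<^sub>R H t) \<le> h * e" if h: "0 < h" "h < d0" for h
  proof -
    have th: "0 \<le> t + h" using t h by simp
    obtain J2 where J2: "has_X_integral a b \<tau> \<epsilon> (\<lambda>s. S (t + h - s) (H s)) (t + h) J2" "Xeq a b \<tau> \<epsilon> (y (t + h)) (S (t + h) z0 + J2)"
      using mild[OF th] by blast
    have J2X: "J2 \<in> X a b" using J2(1) by (simp add: has_X_integral_def)
    have HtX: "h *\<^sub>R H t \<in> X a b" using H(1)[OF t] by (rule xs.V_scale)
    have SJ1: "S h J1 \<in> X a b" using h J1X by (intro S_X) auto
    have diff: "NX (J2 - S h J1 - h *\<^sub>R H t) \<le> h * e"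
    proof (rule field_le_epsilon)
      \<comment> \<open>The slack \<eta> absorbs the errors of both Riemann sums, half each; the
        bound h e must come from the piece over [t, t+h] alone.\<close>
      fix \<eta> :: real assume \<eta>: "\<eta> > 0"
      obtain g1 where g1: "g1 > 0" "\<And>\<D>. \<D> tagged_division_of {0..t} \<Longrightarrow> (\<lambda>s. ball s g1) fine \<D> \<Longrightarrow>
          NX ((\<Sum>(s, k)\<in>\<D>. measure lborel k *\<^sub>R S (t - s) (H s)) - J1) < \<eta> / 2"
        using J1(1) \<eta> half_gt_zero unfolding has_X_integral_def by meson
      obtain g2 where g2: "g2 > 0" "\<And>\<D>. \<D> tagged_division_of {0..t + h} \<Longrightarrow> (\<lambda>s. ball s g2) fine \<D> \<Longrightarrow>
          NX ((\<Sum>(s, k)\<in>\<D>. measure lborel k *\<^sub>R S (t + h - s) (H s)) - J2) < \<eta> / 2"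
        using J2(1) \<eta> half_gt_zero unfolding has_X_integral_def by meson
      define g where "g = min g1 g2"
      have g: "gauge (\<lambda>s::real. ball s g)" using g1 g2 by (intro gauge_ball) (simp add: g_def)
      obtain D1 where D1: "D1 tagged_division_of {0..t}" "(\<lambda>s. ball s g) fine D1"
        using fine_division_exists_real[OF g] by blast
      obtain D2 where D2: "D2 tagged_division_of {t..t + h}" "(\<lambda>s. ball s g) fine D2"
        using fine_division_exists_real[OF g] by blast
      have D12: "(D1 \<union> D2) tagged_division_of {0..t + h}"
      proof -
        have "interior {0..t} \<inter> interior {t..t + h} = {}" by auto
        then have "(D1 \<union> D2) tagged_division_of ({0..t} \<union> {t..t + h})"
          by (rule tagged_division_Un[OF D1(1) D2(1)])
        moreover have "{0..t} \<union> {t..t + h} = {0..t + h}" using t h by auto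
        ultimately show ?thesis by simp
      qed
      have fine: "(\<lambda>s. ball s g1) fine D1" "(\<lambda>s. ball s g2) fine (D1 \<union> D2)"
        using D1(2) D2(2) unfolding fine_def g_def by (fastforce simp: ball_def)+
      let ?G = "\<lambda>(s, k). measure lborel k *\<^sub>R S (t + h - s) (H s)"
      define \<Sigma>1 where "\<Sigma>1 = (\<Sum>(s, k)\<in>D1. measure lborel k *\<^sub>R S (t - s) (H s))"
      define \<Sigma>2 where "\<Sigma>2 = sum ?G D2"
      have fin: "finite D1" "finite D2" using D1 D2 by (auto intro: tagged_division_of_finite)
      have in1: "0 \<le> s" "s \<le> t" if "(s, k) \<in> D1" for s k
        using tagged_division_ofD(2,3)[OF D1(1) that] by auto
      have in2: "t \<le> s" "s \<le> t + h" if "(s, k) \<in> D2" for s k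
        using tagged_division_ofD(2,3)[OF D2(1) that] by auto
      \<comment> \<open>A tagged interval belonging to both divisions lies in {t} and has length 0,
        so counting it twice is harmless.\<close>
      have over: "?G p = 0" if p: "p \<in> D1 \<inter> D2" for p
      proof -
        obtain s k where sk: "p = (s, k)" "(s, k) \<in> D1" "(s, k) \<in> D2" using p by (cases p) auto
        obtain u v where k: "k = cbox u v" using tagged_division_ofD(4)[OF D1(1) sk(2)] by blast
        have "k \<subseteq> {t}" using tagged_division_ofD(3)[OF D1(1) sk(2)] tagged_division_ofD(3)[OF D2(1) sk(3)] by fastforce
        then have "emeasure lborel k \<le> emeasure lborel {t}" by (intro emeasure_mono) auto
        then have "measure lborel k = 0" by (simp add: measure_def)
        then show ?thesis by (simp add: sk)
      qed
      have sum12: "sum ?G (D1 \<union> D2) = sum ?G D1 + \<Sigma>2"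
        unfolding \<Sigma>2_def using fin over by (intro sum.union_inter_neutral) auto
      have S1X: "\<Sigma>1 \<in> X a b" unfolding \<Sigma>1_def using in1 t H by (intro xs.V_sum) (auto intro!: xs.V_scale S_X)
      have G1X: "sum ?G D1 \<in> X a b" using in1 t h H by (intro xs.V_sum) (force intro!: xs.V_scale S_X)
      have S2X: "\<Sigma>2 \<in> X a b" unfolding \<Sigma>2_def using in2 t h H by (intro xs.V_sum) (force intro!: xs.V_scale S_X)
      have SS1X: "S h \<Sigma>1 \<in> X a b" using h S1X by (intro S_X) auto
      have eq1: "NX (sum ?G D1 - S h \<Sigma>1) = 0"
      proof -
        let ?I = "\<Sum>p\<in>D1. measure lborel (snd p) *\<^sub>R S h (S (t - fst p) (H (fst p)))"
        have IX: "?I \<in> X a b" using in1 t h H by (intro xs.V_sum) (force intro!: xs.V_scale S_X)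
        have "Xeq a b \<tau> \<epsilon> (S h (\<Sum>p\<in>D1. measure lborel (snd p) *\<^sub>R S (t - fst p) (H (fst p)))) ?I"
          using h fin in1 t H by (intro S_sum) (force intro!: S_X)+
        then have 1: "NX (S h \<Sigma>1 - ?I) = 0" by (simp add: \<Sigma>1_def Xeq_def case_prod_beta)
        have "NX (sum ?G D1 - ?I) = NX (\<Sum>p\<in>D1. measure lborel (snd p) *\<^sub>R (S (t + h - fst p) (H (fst p)) - S h (S (t - fst p) (H (fst p)))))"
          by (simp add: case_prod_beta sum_subtractf[symmetric] scaleR_diff_right)
        also have "\<dots> \<le> (\<Sum>p\<in>D1. NX (measure lborel (snd p) *\<^sub>R (S (t + h - fst p) (H (fst p)) - S h (S (t - fst p) (H (fst p))))))"
          using in1 t h H by (intro xs.nm_sum) (force intro!: xs.V_scale xs.V_diff S_X)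
        also have "\<dots> = 0"
        proof (intro sum.neutral ballI)
          fix p assume p: "p \<in> D1"
          have st: "0 \<le> fst p" "fst p \<le> t" using in1[of "fst p" "snd p"] p by auto
          have HX: "H (fst p) \<in> X a b" using st H by auto
          have "Xeq a b \<tau> \<epsilon> (S (h + (t - fst p)) (H (fst p))) (S h (S (t - fst p) (H (fst p))))"
            using h st HX by (intro S_add) auto
          then have "NX (S (t + h - fst p) (H (fst p)) - S h (S (t - fst p) (H (fst p)))) = 0"
            by (simp add: Xeq_def algebra_simps)
          moreover have "S (t + h - fst p) (H (fst p)) - S h (S (t - fst p) (H (fst p))) \<in> X a b"
            using h st HX by (intro xs.V_diff S_X) auto
          ultimately show "NX (measure lborel (snd p) *\<^sub>R (S (t + h - fst p) (H (fst p)) - S h (S (t - fst p) (H (fst p))))) = 0"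
            by (simp add: xs.nm_scale)
        qed
        finally have 2: "NX (sum ?G D1 - ?I) \<le> 0" .
        have "NX (sum ?G D1 - S h \<Sigma>1) \<le> NX (sum ?G D1 - ?I) + NX (?I - S h \<Sigma>1)"
          using G1X IX SS1X by (rule xs.nm_triangle3)
        also have "NX (?I - S h \<Sigma>1) = 0" using 1 xs.nm_minus_commute[OF IX SS1X] by simp
        finally show ?thesis using 2 xs.nm_nonneg[OF xs.V_diff[OF G1X SS1X]] by simp
      qed
      have le2: "NX (\<Sigma>2 - h *\<^sub>R H t) \<le> h * e"
      proof -
        have cont: "(\<Sum>p\<in>D2. measure lborel (snd p)) = h"
          using additive_content_tagged_division[of D2 t "t + h"] D2(1) h by (simp add: case_prod_beta)
        have eq: "\<Sigma>2 - h *\<^sub>R H t = (\<Sum>p\<in>D2. measure lborel (snd p) *\<^sub>R (S (t + h - fst p) (H (fst p)) - H t))"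
          unfolding \<Sigma>2_def scaleR_diff_right sum_subtractf scaleR_left.sum[symmetric] cont by (simp add: case_prod_beta)
        have "NX (\<Sigma>2 - h *\<^sub>R H t) \<le> (\<Sum>p\<in>D2. NX (measure lborel (snd p) *\<^sub>R (S (t + h - fst p) (H (fst p)) - H t)))"
          unfolding eq using in2 t h H by (intro xs.nm_sum) (force intro!: xs.V_scale xs.V_diff S_X)
        also have "\<dots> \<le> (\<Sum>p\<in>D2. measure lborel (snd p) * e)"
        proof (rule sum_mono)
          fix p assume p: "p \<in> D2"
          have st: "t \<le> fst p" "fst p \<le> t + h" using in2[of "fst p" "snd p"] p by auto
          have HX: "H (fst p) \<in> X a b" "H t \<in> X a b" using st t H by auto
          let ?r = "t + h - fst p"
          have m: "S ?r (H (fst p)) \<in> X a b" "S ?r (H t) \<in> X a b" using st HX by (auto intro: S_X)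
          have "NX (S ?r (H (fst p)) - H t) \<le> NX (S ?r (H (fst p)) - S ?r (H t)) + NX (S ?r (H t) - H t)"
            using m HX by (intro xs.nm_triangle3)
          also have "NX (S ?r (H (fst p)) - S ?r (H t)) \<le> NX (H (fst p) - H t)" using st HX by (intro S_diff) auto
          also have "\<dots> \<le> e / 2"
            using d1(2)[of "fst p"] st t h e by (cases "fst p = t") (auto simp: xs.nm_zero d0_def dist_real_def)
          also have "NX (S ?r (H t) - H t) \<le> e / 2" using d2(2)[of ?r] st h by (auto simp: d0_def)
          finally have "NX (S ?r (H (fst p)) - H t) \<le> e" by simp
          then show "NX (measure lborel (snd p) *\<^sub>R (S ?r (H (fst p)) - H t)) \<le> measure lborel (snd p) * e"
            using m HX by (simp add: xs.nm_scale xs.V_diff mult_left_mono)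
        qed
        also have "\<dots> = h * e" unfolding sum_distrib_right[symmetric] cont ..
        finally show ?thesis .
      qed
      have b1: "NX (\<Sigma>1 - J1) < \<eta> / 2" unfolding \<Sigma>1_def using D1(1) fine(1) by (rule g1)
      have b2: "NX (sum ?G D1 + \<Sigma>2 - J2) < \<eta> / 2" unfolding sum12[symmetric] using D12 fine(2) by (rule g2)
      have b3: "NX (S h \<Sigma>1 - S h J1) < \<eta> / 2" using S_diff(1)[OF _ S1X J1X, of h] b1 h by simp
      have b2': "NX (J2 - (sum ?G D1 + \<Sigma>2)) < \<eta> / 2"
        using b2 xs.nm_minus_commute[OF J2X xs.V_add[OF G1X S2X]] by simp
      have m: "J2 - (sum ?G D1 + \<Sigma>2) \<in> X a b" "sum ?G D1 - S h \<Sigma>1 \<in> X a b"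
        "S h \<Sigma>1 - S h J1 \<in> X a b" "\<Sigma>2 - h *\<^sub>R H t \<in> X a b"
        by (intro xs.V_diff xs.V_add J2X G1X S2X SS1X SJ1 HtX)+
      have eq: "J2 - S h J1 - h *\<^sub>R H t = ((J2 - (sum ?G D1 + \<Sigma>2)) + (sum ?G D1 - S h \<Sigma>1)) + ((S h \<Sigma>1 - S h J1) + (\<Sigma>2 - h *\<^sub>R H t))"
        by (simp add: algebra_simps)
      have "NX (J2 - S h J1 - h *\<^sub>R H t) \<le> NX ((J2 - (sum ?G D1 + \<Sigma>2)) + (sum ?G D1 - S h \<Sigma>1)) + NX ((S h \<Sigma>1 - S h J1) + (\<Sigma>2 - h *\<^sub>R H t))"
        unfolding eq by (intro xs.nm_triangle xs.V_add[OF m(1,2)] xs.V_add[OF m(3,4)])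
      also have "\<dots> \<le> (NX (J2 - (sum ?G D1 + \<Sigma>2)) + NX (sum ?G D1 - S h \<Sigma>1)) + (NX (S h \<Sigma>1 - S h J1) + NX (\<Sigma>2 - h *\<^sub>R H t))"
        by (rule add_mono[OF xs.nm_triangle[OF m(1,2)] xs.nm_triangle[OF m(3,4)]])
      also have "\<dots> \<le> h * e + \<eta>" using b2' b3 eq1 le2 by simp
      finally show "NX (J2 - S h J1 - h *\<^sub>R H t) \<le> h * e + \<eta>" .
    qed
    have ytX: "y t \<in> X a b" "y (t + h) \<in> X a b" using y t th by auto
    have SX: "S h (y t) \<in> X a b" "S t z0 \<in> X a b" "S (t + h) z0 \<in> X a b" "S h (S t z0) \<in> X a b" "S h (S t z0 + J1) \<in> X a b"
      using h t th ytX z0 J1X by (auto intro!: S_X xs.V_add)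
    have 1: "NX (y (t + h) - (S (t + h) z0 + J2)) = 0" using J2(2) by (simp add: Xeq_def)
    \<comment> \<open>Applying S(h) to the formula for y t: contractivity removes the null error in
      that formula, linearity splits the sum, and the semigroup law rewrites the free part.\<close>
    have 2: "NX (S h (y t) - (S (t + h) z0 + S h J1)) = 0"
    proof -
      have "NX (S h (y t) - S h (S t z0 + J1)) \<le> NX (y t - (S t z0 + J1))"
        using h ytX SX J1X by (intro S_diff xs.V_add) auto
      then have a1: "NX (S h (y t) - S h (S t z0 + J1)) \<le> 0" using J1(2) by (simp add: Xeq_def)
      have a2: "NX (S h (S t z0 + J1) - (S h (S t z0) + S h J1)) = 0"
        using S_linear[OF _ SX(2) J1X, of h 1] h by (simp add: Xeq_def)
      have "Xeq a b \<tau> \<epsilon> (S (h + t) z0) (S h (S t z0))" using h t z0 by (intro S_add) auto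
      then have a3: "NX (S h (S t z0) - S (t + h) z0) = 0"
        using xs.nm_minus_commute[OF SX(3,4)] by (simp add: Xeq_def add.commute)
      have eq: "S h (y t) - (S (t + h) z0 + S h J1) = (S h (y t) - S h (S t z0 + J1)) +
        ((S h (S t z0 + J1) - (S h (S t z0) + S h J1)) + (S h (S t z0) - S (t + h) z0))" by (simp add: algebra_simps)
      have "NX (S h (y t) - (S (t + h) z0 + S h J1)) \<le> NX (S h (y t) - S h (S t z0 + J1)) + NX ((S h (S t z0 + J1) - (S h (S t z0) + S h J1)) + (S h (S t z0) - S (t + h) z0))"
        unfolding eq by (intro xs.nm_triangle[OF xs.V_diff[OF SX(1,5)]] xs.V_add[OF xs.V_diff[OF SX(5) xs.V_add[OF SX(4) SJ1]] xs.V_diff[OF SX(4,3)]])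
      also have "\<dots> \<le> NX (S h (y t) - S h (S t z0 + J1)) + (NX (S h (S t z0 + J1) - (S h (S t z0) + S h J1)) + NX (S h (S t z0) - S (t + h) z0))"
        by (intro add_left_mono xs.nm_triangle[OF xs.V_diff[OF SX(5) xs.V_add[OF SX(4) SJ1]] xs.V_diff[OF SX(4,3)]])
      finally have "NX (S h (y t) - (S (t + h) z0 + S h J1)) \<le> 0" using a1 a2 a3 by simp
      then show ?thesis using xs.nm_nonneg[OF xs.V_diff[OF SX(1) xs.V_add[OF SX(3) SJ1]]] by simp
    qed
    have "NX (y (t + h) - S h (y t) - h *\<^sub>R H t) = NX ((S (t + h) z0 + J2) - (S (t + h) z0 + S h J1) - h *\<^sub>R H t)"
      using ytX SX SJ1 J2X HtX by (intro xs.nm_replace 1 2) (auto intro!: xs.V_add[OF SX(3) J2X] xs.V_add[OF SX(3) SJ1])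
    moreover have "(S (t + h) z0 + J2) - (S (t + h) z0 + S h J1) - h *\<^sub>R H t = J2 - S h J1 - h *\<^sub>R H t" by simp
    ultimately show ?thesis using diff by simp
  qed
  show ?thesis unfolding eventually_at_right[OF d0] using main by (intro exI[of _ d0]) (use d0 in auto)
qed

text \<open>The only cell of [0, 0] has length 0, so every Riemann sum vanishes and J is a null
  element; S(0) is the identity up to null elements.\<close>

lemma mild_initial:
  assumes "has_X_integral a b \<tau> \<epsilon> G 0 J" "z0 \<in> X a b" "y0 \<in> X a b" "Xeq a b \<tau> \<epsilon> y0 (S 0 z0 + J)"
  shows "Xeq a b \<tau> \<epsilon> y0 z0"
proof -
  have JX: "J \<in> X a b" using assms(1) by (simp add: has_X_integral_def)
  have SX: "S 0 z0 \<in> X a b" using assms(2) by (intro S_X) auto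
  have "NX J \<le> 0"
  proof (rule field_le_epsilon)
    fix e :: real assume "e > 0"
    then obtain d where d: "d > 0" "\<And>\<D>. \<D> tagged_division_of {0..0} \<Longrightarrow> (\<lambda>s. ball s d) fine \<D> \<Longrightarrow>
          NX ((\<Sum>(s, k)\<in>\<D>. measure lborel k *\<^sub>R G s) - J) < e"
      using assms(1) unfolding has_X_integral_def by meson
    have "{(0, cbox 0 (0::real))} tagged_division_of cbox 0 0" by (rule tagged_division_of_self) simp
    moreover have "(\<lambda>s. ball s d) fine {(0, cbox 0 (0::real))}" using d(1) by (auto simp: fine_def)
    ultimately have "NX (0 - J) < e" using d(2)[of "{(0, cbox 0 (0::real))}"] by simp
    then show "NX J \<le> 0 + e" using xs.nm_minus[OF JX] by simp
  qed
  then have J0: "NX J = 0" using xs.nm_nonneg[OF JX] by simp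
  have "Xeq a b \<tau> \<epsilon> (S 0 z0 + J) (S 0 z0)" using J0 by (simp add: Xeq_def)
  then have "Xeq a b \<tau> \<epsilon> y0 (S 0 z0)"
    by (rule Xeq_trans[OF assms(4)]) (use assms JX SX xs.V_add[OF SX JX] in auto)
  then show ?thesis
    by (rule Xeq_trans[OF _ S_0[OF assms(2)]]) (use assms SX in auto)
qed

end

section \<open>Energy balance and displacement along the solution\<close>

section \<open>Energy dissipation\<close>

lemma mean_value_segment:
  fixes F :: "real \<Rightarrow> real"
  assumes "\<And>x. (F has_real_derivative F' x) (at x)"
  obtains \<xi> where "\<xi> \<in> closed_segment s t" "F t - F s = F' \<xi> * (t - s)"
proof -
  consider "s < t" | "s = t" | "t < s" by linarith
  then show ?thesis
  proof cases
    case 1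
    then obtain z where z: "s < z" "z < t" "F t - F s = (t - s) * F' z" using MVT2[of s t F F'] assms by blast
    then show ?thesis using that[of z] by (auto simp: closed_segment_eq_real_ivl mult.commute)
  next
    case 2
    then show ?thesis using that[of s] by simp
  next
    case 3
    then obtain z where z: "t < z" "z < s" "F s - F t = (s - t) * F' z" using MVT2[of t s F F'] assms by blast
    then show ?thesis using that[of z] by (auto simp: closed_segment_eq_real_ivl algebra_simps)
  qed
qed

text \<open>Two successive mean values, first for F and then for f, with C a bound of |f'| on the
  interval. It serves both the evolution of the potential energy and the behaviour at the
  wells.\<close>

lemma quadratic_upper_bound:
  fixes F f f' :: "real \<Rightarrow> real"
  assumes F: "\<And>s. (F has_real_derivative - f s) (at s)" and f: "\<And>s. (f has_real_derivative f' s) (at s)"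
    and f': "continuous_on UNIV f'"
  obtains C where "C \<ge> 0" "\<And>s t. s \<in> {-R..R} \<Longrightarrow> t \<in> {-R..R} \<Longrightarrow> F t \<le> F s - f s * (t - s) + C * (t - s)\<^sup>2"
proof -
  obtain C where C: "C \<ge> 0" "\<And>x. x \<in> {-R..R} \<Longrightarrow> \<bar>f' x\<bar> \<le> C"
    using continuous_bounded_ivl[OF continuous_on_subset[OF f']] by blast
  have seg: "closed_segment s t \<subseteq> {-R..R}" if "s \<in> {-R..R}" "t \<in> {-R..R}" for s t
    using that by (intro closed_segment_subset) auto
  have "F t \<le> F s - f s * (t - s) + C * (t - s)\<^sup>2" if st: "s \<in> {-R..R}" "t \<in> {-R..R}" for s t
  proof -
    obtain \<xi> where \<xi>: "\<xi> \<in> closed_segment s t" "F t - F s = - f \<xi> * (t - s)"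
      using mean_value_segment[OF F] by blast
    have \<xi>R: "\<xi> \<in> {-R..R}" using \<xi>(1) seg[OF st] by blast
    obtain \<eta> where \<eta>: "\<eta> \<in> closed_segment s \<xi>" "f \<xi> - f s = f' \<eta> * (\<xi> - s)"
      using mean_value_segment[OF f] by blast
    have \<eta>R: "\<eta> \<in> {-R..R}" using \<eta>(1) seg[OF st(1) \<xi>R] by blast
    have d: "\<bar>\<xi> - s\<bar> \<le> \<bar>t - s\<bar>" using \<xi>(1) by (auto simp: closed_segment_eq_real_ivl split: if_splits)
    have "F t - F s + f s * (t - s) = - (f \<xi> - f s) * (t - s)"
      using \<xi>(2) by (simp add: algebra_simps)
    also have "\<dots> = - (f' \<eta> * (\<xi> - s)) * (t - s)" unfolding \<eta>(2) ..
    also have "\<dots> \<le> \<bar>f' \<eta>\<bar> * \<bar>\<xi> - s\<bar> * \<bar>t - s\<bar>" by (metis abs_ge_self abs_minus_cancel abs_mult)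
    also have "\<dots> \<le> C * \<bar>t - s\<bar> * \<bar>t - s\<bar>" using C d \<eta>R by (intro mult_right_mono mult_mono) auto
    also have "\<dots> = C * (t - s)\<^sup>2" by (simp add: power2_eq_square)
    finally show ?thesis by simp
  qed
  then show ?thesis using that C by blast
qed

lemma continuous_on_compose_UNIV:
  assumes u: "continuous_on {a..b} u" and h: "continuous_on UNIV (h::real\<Rightarrow>real)"
  shows "continuous_on {a..b} (\<lambda>x. h (u x))"
  using u h by (intro continuous_on_compose2[OF h u]) auto

locale damped_wave = wave_space +
  fixes f f' g F :: "real \<Rightarrow> real" and \<sigma> :: real
  assumes DF: "\<And>s. (F has_real_derivative - f s) (at s)" and Df: "\<And>s. (f has_real_derivative f' s) (at s)"
    and cf': "continuous_on UNIV f'" and cg: "continuous_on UNIV g" and \<sigma>: "\<And>s. \<sigma> \<le> g s"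
begin

lemma cf: "continuous_on UNIV f"
  using has_field_derivative_at_within[OF Df] by (rule DERIV_continuous_on)

lemma cF: "continuous_on UNIV F"
  using has_field_derivative_at_within[OF DF] by (rule DERIV_continuous_on)

abbreviation "P \<equiv> Phi \<tau> f g"

lemma Phi_fst: "fst (P z) = fst z"
  and Phi_snd: "snd (P z) = snd z + (1 / \<tau>) *\<^sub>R ((\<lambda>x. f (fst z x)) - (\<lambda>x. g (fst z x) * snd z x))"
  by (auto simp: Phi_def fun_eq_iff scaleR_fun_def split: prod.split)

lemma comp_L2:
  assumes z: "z \<in> X a b"
  shows "(\<lambda>x. f (fst z x)) \<in> L2 a b" "(\<lambda>x. g (fst z x) * snd z x) \<in> L2 a b"
    "integrable (Mab a b) (\<lambda>x. F (fst z x))"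
proof -
  note cu = X_D(5)[OF z]
  show "(\<lambda>x. f (fst z x)) \<in> L2 a b" by (rule continuous_L2[OF continuous_on_compose_UNIV[OF cu cf]])
  show "integrable (Mab a b) (\<lambda>x. F (fst z x))" by (rule L2_integrable[OF continuous_L2[OF continuous_on_compose_UNIV[OF cu cF]]])
  have c: "continuous_on {a..b} (\<lambda>x. g (fst z x))" by (rule continuous_on_compose_UNIV[OF cu cg])
  obtain B where "B \<ge> 0" "\<And>x. x \<in> {a..b} \<Longrightarrow> \<bar>g (fst z x)\<bar> \<le> B" using continuous_bounded_ivl[OF c] by blast
  then show "(\<lambda>x. g (fst z x) * snd z x) \<in> L2 a b"
    by (intro L2_mult_bounded(1)[OF X_D(4)[OF z] continuous_measurable_Mab[OF c], of B]) auto
qed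

lemma Phi_X: "z \<in> X a b \<Longrightarrow> P z \<in> X a b"
proof -
  assume z: "z \<in> X a b"
  have "snd (P z) \<in> L2 a b" unfolding Phi_snd using z by (intro l2.V_add l2.V_scale l2.V_diff comp_L2 X_D)
  then show ?thesis using X_D(1)[OF z] by (auto simp: X_def mem_Times_iff Phi_fst)
qed

lemma pair_zero_NX:
  assumes r: "r \<in> L2 a b"
  shows "(0, r) \<in> X a b" "NX (0, r) = sqrt \<tau> * N2 r"
proof -
  have 0: "0 \<in> H1 a b" using subspace_0[OF H1_subspace] .
  show X: "(0, r) \<in> X a b" using 0 r by (simp add: X_def)
  have wd0: "has_weak_deriv a b 0 0"
    using has_weak_deriv_scale[of a b 0 _ 0] 0 by (fastforce simp: H1_iff)
  have "N2 (weak_deriv a b 0) = 0" using weak_deriv_eq[OF wd0 ab] by simp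
  then have "(NX (0, r))\<^sup>2 = (sqrt \<tau> * N2 r)\<^sup>2"
    using NX_square[OF X] \<tau> by (simp add: l2.nm_zero power_mult_distrib)
  then show "NX (0, r) = sqrt \<tau> * N2 r"
    using xs.nm_nonneg[OF X] l2.nm_nonneg[OF r] \<tau> by simp
qed

text \<open>The embedding of X into continuous functions confines u to a compact range, on which f
  and g are bounded and uniformly continuous.\<close>

lemma Phi_continuous:
  assumes z: "z \<in> X a b" and e: "e > 0"
  obtains d where "d > 0" "\<And>z'. z' \<in> X a b \<Longrightarrow> NX (z' - z) < d \<Longrightarrow> NX (P z' - P z) < e"
proof -
  define R where "R = Csup * (NX z + 1)"
  have nz: "NX z \<ge> 0" using z by (rule xs.nm_nonneg)
  obtain G where G: "G \<ge> 0" "\<And>x. x \<in> {-R..R} \<Longrightarrow> \<bar>g x\<bar> \<le> G"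
    using continuous_bounded_ivl[OF continuous_on_subset[OF cg]] by blast
  \<comment> \<open>K1 collects what is linear in the distance of the states: the identity part of
    Phi and the damping applied to the velocity difference. K2, times the modulus e1, collects the
    changes of f(u) and of g(u).\<close>
  define K1 where "K1 = 1 + G / \<tau>"
  define K2 where "K2 = (sqrt (b - a) + N2 (snd z)) / sqrt \<tau>"
  have K: "K1 > 0" "K2 \<ge> 0"
    using G \<tau> ab l2.nm_nonneg[OF X_D(4)[OF z]] by (auto simp: K1_def K2_def add_pos_nonneg)
  define e1 where "e1 = e / (2 * (K2 + 1))"
  have e1: "e1 > 0" "e1 * K2 < e / 2" using e K by (auto simp: e1_def field_simps)
  have uc: "uniformly_continuous_on {-R..R} f" "uniformly_continuous_on {-R..R} g"
    by (auto intro!: compact_uniformly_continuous continuous_on_subset[OF cf] continuous_on_subset[OF cg])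
  obtain \<eta>1 where \<eta>1: "\<eta>1 > 0" "\<And>s t. s \<in> {-R..R} \<Longrightarrow> t \<in> {-R..R} \<Longrightarrow> dist t s < \<eta>1 \<Longrightarrow> dist (f t) (f s) < e1"
    using uc(1) e1(1) unfolding uniformly_continuous_on_def by metis
  obtain \<eta>2 where \<eta>2: "\<eta>2 > 0" "\<And>s t. s \<in> {-R..R} \<Longrightarrow> t \<in> {-R..R} \<Longrightarrow> dist t s < \<eta>2 \<Longrightarrow> dist (g t) (g s) < e1"
    using uc(2) e1(1) unfolding uniformly_continuous_on_def by metis
  define d where "d = Min {1, \<eta>1 / Csup, \<eta>2 / Csup, e / (2 * K1)}"
  have d: "d > 0" "d \<le> 1" "d \<le> \<eta>1 / Csup" "d \<le> \<eta>2 / Csup" "d \<le> e / (2 * K1)"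
    using \<eta>1 \<eta>2 Csup_pos e K by (auto simp: d_def)
  have "NX (P z' - P z) < e" if z': "z' \<in> X a b" "NX (z' - z) < d" for z'
  proof -
    have dX: "z' - z \<in> X a b" using z' z by (intro xs.V_diff)
    have dn: "0 \<le> NX (z' - z)" using dX by (rule xs.nm_nonneg)
    have "NX z' \<le> NX z + 1" using xs.nm_diff_abs[OF z'(1) z] z'(2) d(2) by linarith
    then have "Csup * NX z' \<le> R" "Csup * NX z \<le> R" unfolding R_def using Csup_pos by (auto intro!: mult_left_mono)
    then have uR: "fst z' x \<in> {-R..R}" "fst z x \<in> {-R..R}" if "x \<in> {a..b}" for x
      using sup_le_NX[OF z'(1) that] sup_le_NX[OF z that] by auto
    have du: "\<bar>fst z' x - fst z x\<bar> < \<eta>1" "\<bar>fst z' x - fst z x\<bar> < \<eta>2" if "x \<in> {a..b}" for x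
    proof -
      have "\<bar>fst z' x - fst z x\<bar> \<le> Csup * NX (z' - z)" using sup_le_NX[OF dX that] by simp
      also have "\<dots> < Csup * d" using z'(2) Csup_pos by simp
      finally have l: "\<bar>fst z' x - fst z x\<bar> < Csup * d" .
      have "Csup * d \<le> \<eta>1" "Csup * d \<le> \<eta>2" using d(3,4) Csup_pos by (auto simp: field_simps)
      with l show "\<bar>fst z' x - fst z x\<bar> < \<eta>1" "\<bar>fst z' x - fst z x\<bar> < \<eta>2" by auto
    qed
    \<comment> \<open>The change of g(u) w is split as g(u')(w' - w) + (g(u') - g(u)) w, so that
      differences of g multiply only the fixed velocity w.\<close>
    define r1 where "r1 = (\<lambda>x. f (fst z' x)) - (\<lambda>x. f (fst z x))"
    define r2 where "r2 = (\<lambda>x. g (fst z' x) * (snd z' - snd z) x)"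
    define r3 where "r3 = (\<lambda>x. (g (fst z' x) - g (fst z x)) * snd z x)"
    have cgu: "continuous_on {a..b} (\<lambda>x. g (fst z' x))" "continuous_on {a..b} (\<lambda>x. g (fst z x))"
      by (rule continuous_on_compose_UNIV[OF X_D(5)[OF z'(1)] cg], rule continuous_on_compose_UNIV[OF X_D(5)[OF z] cg])
    have cgd: "continuous_on {a..b} (\<lambda>x. g (fst z' x) - g (fst z x))" by (intro continuous_intros cgu)
    have wL: "snd z' - snd z \<in> L2 a b" using z' z by (intro l2.V_diff X_D)
    have b2: "\<bar>g (fst z' x)\<bar> \<le> G" if "x \<in> {a<..<b}" for x using G(2)[OF uR(1)[of x]] that by simp
    have b3: "\<bar>g (fst z' x) - g (fst z x)\<bar> \<le> e1" if "x \<in> {a<..<b}" for x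
      using \<eta>2(2)[of "fst z x" "fst z' x"] uR[of x] du(2)[of x] that by (simp add: dist_real_def)
    have r1: "r1 \<in> L2 a b" unfolding r1_def using z' z by (intro l2.V_diff comp_L2)
    have n1: "N2 r1 \<le> sqrt (b - a) * e1"
    proof (rule l2nm_le_bound[OF r1 ab])
      show "\<bar>r1 x\<bar> \<le> e1" if "x \<in> {a<..<b}" for x
        using \<eta>1(2)[of "fst z x" "fst z' x"] uR[of x] du(1)[of x] that by (simp add: dist_real_def r1_def)
    qed
    have r2: "r2 \<in> L2 a b" "N2 r2 \<le> G * N2 (snd z' - snd z)"
      unfolding r2_def by (intro L2_mult_bounded[OF wL continuous_measurable_Mab[OF cgu(1)] b2]; simp)+
    have r3: "r3 \<in> L2 a b" "N2 r3 \<le> e1 * N2 (snd z)"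
      unfolding r3_def by (intro L2_mult_bounded[OF X_D(4)[OF z] continuous_measurable_Mab[OF cgd] b3]; simp)+
    define r where "r = (1 / \<tau>) *\<^sub>R (r1 - r2 - r3)"
    have rL: "r \<in> L2 a b" unfolding r_def using r1 r2 r3 by (intro l2.V_scale l2.V_diff)
    have eq: "P z' - P z = (z' - z) + (0, r)"
    proof (rule prod_eqI)
      show "fst (P z' - P z) = fst ((z' - z) + (0, r))" by (simp add: Phi_fst)
      show "snd (P z' - P z) = snd ((z' - z) + (0, r))"
        by (simp add: Phi_snd r_def r1_def r2_def r3_def fun_eq_iff scaleR_fun_def algebra_simps)
    qed
    have "N2 (snd (z' - z)) \<le> NX (z' - z) / sqrt \<tau>" using dX by (rule N2_snd_le)
    then have n2: "N2 r2 \<le> G * (NX (z' - z) / sqrt \<tau>)"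
      using r2(2) mult_left_mono[OF _ G(1), of "N2 (snd (z' - z))" "NX (z' - z) / sqrt \<tau>"] by simp
    have "N2 (r1 - r2 - r3) \<le> N2 (r1 - r2) + N2 r3" using r1 r2 r3 by (intro l2.nm_diff_le l2.V_diff)
    also have "N2 (r1 - r2) \<le> N2 r1 + N2 r2" using r1 r2 by (intro l2.nm_diff_le)
    finally have n: "N2 (r1 - r2 - r3) \<le> sqrt (b - a) * e1 + G * (NX (z' - z) / sqrt \<tau>) + e1 * N2 (snd z)"
      using n1 n2 r3(2) by simp
    have "NX (0, r) = sqrt \<tau> * ((1 / \<tau>) * N2 (r1 - r2 - r3))"
      unfolding pair_zero_NX(2)[OF rL] unfolding r_def using \<tau> r1 r2 r3 by (simp add: l2.nm_scale l2.V_diff)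
    also have "\<dots> = N2 (r1 - r2 - r3) / sqrt \<tau>" using \<tau> real_div_sqrt[of \<tau>] by (simp add: field_simps)
    also have "\<dots> \<le> (sqrt (b - a) * e1 + G * (NX (z' - z) / sqrt \<tau>) + e1 * N2 (snd z)) / sqrt \<tau>"
      using n \<tau> by (intro divide_right_mono) auto
    also have "\<dots> = e1 * K2 + (G / \<tau>) * NX (z' - z)"
      using \<tau> by (simp add: K2_def add_divide_distrib distrib_left)
    finally have "NX (0, r) \<le> e1 * K2 + (G / \<tau>) * NX (z' - z)" .
    moreover have "NX (P z' - P z) \<le> NX (z' - z) + NX (0, r)"
      unfolding eq using dX pair_zero_NX(1)[OF rL] by (rule xs.nm_triangle)
    ultimately have "NX (P z' - P z) \<le> K1 * NX (z' - z) + e1 * K2" by (simp add: K1_def distrib_right)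
    also have "\<dots> < K1 * d + e / 2" using z'(2) K e1 by (intro add_strict_mono) auto
    also have "K1 * d \<le> e / 2" using d(5) K by (simp add: field_simps)
    finally show ?thesis by simp
  qed
  then show ?thesis using d(1) that by blast
qed

text \<open>The linear part of Phi is the identity, compensating the shift by minus the identity
  inside A; its contribution |z|^2 cancels the -|z|^2 of \<open>Qform\<close>.\<close>

lemma Xinner_Phi:
  assumes z: "z \<in> X a b"
  shows "Xinner a b \<tau> \<epsilon> z (P z) = (NX z)\<^sup>2 + l2ip a b (snd z) (\<lambda>x. f (fst z x)) - l2ip a b (snd z) (\<lambda>x. g (fst z x) * snd z x)"
proof -
  let ?w = "snd z" and ?fu = "\<lambda>x. f (fst z x)" and ?gw = "\<lambda>x. g (fst z x) * snd z x"
  note L = X_D(4)[OF z] comp_L2(1,2)[OF z]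
  have "l2ip a b ?w (?w + (1 / \<tau>) *\<^sub>R (?fu - ?gw)) = l2ip a b ?w ?w + (1 / \<tau>) * (l2ip a b ?w ?fu - l2ip a b ?w ?gw)"
    using L by (simp only: l2.ip_add_right l2.ip_scale_right l2.ip_diff_right l2.V_diff l2.V_scale)
  then have "\<tau> * l2ip a b ?w (?w + (1 / \<tau>) *\<^sub>R (?fu - ?gw)) = \<tau> * l2ip a b ?w ?w + (l2ip a b ?w ?fu - l2ip a b ?w ?gw)"
    using \<tau> by (simp add: distrib_left)
  then show ?thesis
    unfolding xs.nm_square[OF z] Xinner_l2[OF z Phi_X[OF z]] Xinner_l2[OF z z] Phi_fst Phi_snd by simp
qed

lemma damping_lower_bound:
  assumes z: "z \<in> X a b"
  shows "\<sigma> * (N2 (snd z))\<^sup>2 \<le> l2ip a b (snd z) (\<lambda>x. g (fst z x) * snd z x)"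
proof -
  have "\<sigma> * (N2 (snd z))\<^sup>2 = (LINT x|Mab a b. \<sigma> * (snd z x)\<^sup>2)" using X_D(4)[OF z] by (simp add: l2nm_square)
  also have "\<dots> \<le> (LINT x|Mab a b. snd z x * (g (fst z x) * snd z x))"
  proof (rule integral_mono)
    show "integrable (Mab a b) (\<lambda>x. \<sigma> * (snd z x)\<^sup>2)" using L2_square[OF X_D(4)[OF z]] by simp
    show "integrable (Mab a b) (\<lambda>x. snd z x * (g (fst z x) * snd z x))" by (intro L2_mult X_D comp_L2 z)
    show "\<sigma> * (snd z x)\<^sup>2 \<le> snd z x * (g (fst z x) * snd z x)" for x
      using mult_right_mono[OF \<sigma>[of "fst z x"], of "(snd z x)\<^sup>2"] by (simp add: power2_eq_square ac_simps)
  qed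
  finally show ?thesis by (simp add: l2ip_def)
qed

text \<open>This is \<epsilon> times the energy, by \<open>Gen_energy\<close>. It is written through
  the X norm, to which \<open>S_half_square\<close> applies, with the surplus \<tau> |u|^2 / 2 of
  that norm subtracted.\<close>

definition "Gen z = (NX z)\<^sup>2 / 2 - \<tau> / 2 * (N2 (fst z))\<^sup>2 + (LINT x|Mab a b. F (fst z x))"

lemma Gen_Xeq:
  assumes "z \<in> X a b" "z' \<in> X a b" "Xeq a b \<tau> \<epsilon> z z'"
  shows "Gen z = Gen z'"
proof -
  have "N2 (fst z) = N2 (fst z')" using Xeq_N2(1)[OF assms] X_D(2)[OF assms(1)] X_D(2)[OF assms(2)] by (intro l2.nm_cong0)
  moreover have "(LINT x|Mab a b. F (fst z x)) = (LINT x|Mab a b. F (fst z' x))"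
    using Xeq_fst[OF assms] by (intro Bochner_Integration.integral_cong) auto
  ultimately show ?thesis using Xeq_NX[OF assms] by (simp add: Gen_def)
qed

lemma Gen_energy:
  assumes z: "z \<in> X a b"
  shows "Gen z = \<epsilon> * energy a b \<tau> \<epsilon> F z"
proof -
  obtain u w where uw: "z = (u, w)" by force
  note D = X_D[OF z, unfolded uw fst_conv snd_conv]
  have "energy a b \<tau> \<epsilon> F z = \<tau> / (2 * \<epsilon>) * (N2 w)\<^sup>2 + \<epsilon> / 2 * (N2 (weak_deriv a b u))\<^sup>2 + (LINT x|Mab a b. F (u x)) / \<epsilon>"
    unfolding energy_def uw using L2_square[OF D(4)] L2_square[OF D(3)] comp_L2(3)[OF z] D
    by (simp add: uw l2nm_square)
  then show ?thesis
    unfolding Gen_def NX_square[OF z] using \<epsilon> by (simp add: uw field_simps power2_eq_square)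
qed

lemma Gen_continuous:
  assumes y: "\<And>s. 0 \<le> s \<Longrightarrow> y s \<in> X a b" and t: "0 \<le> t"
    and lim: "((\<lambda>s. NX (y s - y t)) \<longlongrightarrow> 0) (at t within {0..})"
  shows "((\<lambda>s. Gen (y s)) \<longlongrightarrow> Gen (y t)) (at t within {0..})"
    and "((\<lambda>s. N2 (snd (y s))) \<longlongrightarrow> N2 (snd (y t))) (at t within {0..})"
    and "((\<lambda>s. N2 (fst (y s))) \<longlongrightarrow> N2 (fst (y t))) (at t within {0..})"
proof -
  let ?Q = "at t within {0..}"
  have ev: "\<forall>\<^sub>F s in ?Q. y s \<in> X a b" using y by (auto simp: eventually_at_filter)
  have evL: "\<forall>\<^sub>F s in ?Q. fst (y s) \<in> L2 a b" "\<forall>\<^sub>F s in ?Q. snd (y s) \<in> L2 a b"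
    using ev by (auto elim!: eventually_mono intro: X_D)
  have ytX: "y t \<in> X a b" using y t by simp
  have l: "((\<lambda>s. NX (y s - y t) / sqrt \<tau>) \<longlongrightarrow> 0) ?Q" using tendsto_divide_zero[OF lim] by simp
  have dX: "\<forall>\<^sub>F s in ?Q. y s - y t \<in> X a b" using ev by eventually_elim (intro xs.V_diff ytX)
  have le: "norm (N2 (fst (y s) - fst (y t))) \<le> NX (y s - y t) / sqrt \<tau>"
    "norm (N2 (snd (y s) - snd (y t))) \<le> NX (y s - y t) / sqrt \<tau>" if "y s - y t \<in> X a b" for s
    using N2_fst_le[OF that] N2_snd_le[OF that] l2.nm_nonneg[OF X_D(2)[OF that]] l2.nm_nonneg[OF X_D(4)[OF that]] by simp_all
  have "((\<lambda>s. N2 (fst (y s) - fst (y t))) \<longlongrightarrow> 0) ?Q"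
    by (rule Lim_null_comparison[OF eventually_mono[OF dX le(1)] l])
  then show l1: "((\<lambda>s. N2 (fst (y s))) \<longlongrightarrow> N2 (fst (y t))) ?Q"
    by (intro l2.nm_tendsto_eventually evL X_D ytX)
  have "((\<lambda>s. N2 (snd (y s) - snd (y t))) \<longlongrightarrow> 0) ?Q"
    by (rule Lim_null_comparison[OF eventually_mono[OF dX le(2)] l])
  then show "((\<lambda>s. N2 (snd (y s))) \<longlongrightarrow> N2 (snd (y t))) ?Q"
    by (intro l2.nm_tendsto_eventually evL X_D ytX)
  have l2: "((\<lambda>s. NX (y s)) \<longlongrightarrow> NX (y t)) ?Q" by (intro xs.nm_tendsto_eventually ev ytX lim)
  define R where "R = Csup * (NX (y t) + 1)"
  obtain L where L: "L \<ge> 0" "\<And>s. s \<in> {-R..R} \<Longrightarrow> \<bar>- f s\<bar> \<le> L"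
    using continuous_bounded_ivl[OF continuous_on_minus[OF continuous_on_subset[OF cf subset_UNIV]]] by blast
  have "((\<lambda>s. (LINT x|Mab a b. F (fst (y s) x)) - (LINT x|Mab a b. F (fst (y t) x))) \<longlongrightarrow> 0) ?Q"
  proof (rule Lim_null_comparison)
    show "((\<lambda>s. (b - a) * (L * (Csup * NX (y s - y t)))) \<longlongrightarrow> 0) ?Q"
      by (intro tendsto_mult_right_zero lim)
    have "\<forall>\<^sub>F s in ?Q. NX (y s - y t) < 1" using lim by (intro order_tendstoD) auto
    with ev dX show "\<forall>\<^sub>F s in ?Q. norm ((LINT x|Mab a b. F (fst (y s) x)) - (LINT x|Mab a b. F (fst (y t) x)))
      \<le> (b - a) * (L * (Csup * NX (y s - y t)))"
    proof eventually_elim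
      case (elim s)
      have "NX (y s) \<le> NX (y t) + 1" using xs.nm_diff_abs[OF elim(1) ytX] elim(3) by linarith
      then have "Csup * NX (y s) \<le> R" "Csup * NX (y t) \<le> R" unfolding R_def using Csup_pos by (auto intro!: mult_left_mono)
      then have uR: "fst (y s) x \<in> {-R..R}" "fst (y t) x \<in> {-R..R}" if "x \<in> {a..b}" for x
        using sup_le_NX[OF elim(1) that] sup_le_NX[OF ytX that] by auto
      have pt: "\<bar>F (fst (y s) x) - F (fst (y t) x)\<bar> \<le> L * (Csup * NX (y s - y t))" if x: "x \<in> {a..b}" for x
      proof -
        obtain \<xi> where \<xi>: "\<xi> \<in> closed_segment (fst (y t) x) (fst (y s) x)" "F (fst (y s) x) - F (fst (y t) x) = - f \<xi> * (fst (y s) x - fst (y t) x)"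
          using mean_value_segment[OF DF] by blast
        have "closed_segment (fst (y t) x) (fst (y s) x) \<subseteq> {-R..R}" using uR[OF x] by (intro closed_segment_subset) auto
        then have "\<bar>- f \<xi>\<bar> \<le> L" using L(2) \<xi>(1) by blast
        moreover have "\<bar>fst (y s) x - fst (y t) x\<bar> \<le> Csup * NX (y s - y t)" using sup_le_NX[OF elim(2) x] by simp
        ultimately show ?thesis unfolding \<xi>(2) abs_mult using L(1) by (intro mult_mono) auto
      qed
      note i = comp_L2(3)[OF elim(1)] comp_L2(3)[OF ytX]
      have "\<bar>(LINT x|Mab a b. F (fst (y s) x)) - (LINT x|Mab a b. F (fst (y t) x))\<bar> = \<bar>LINT x|Mab a b. F (fst (y s) x) - F (fst (y t) x)\<bar>"
        using i by simp
      also have "\<dots> \<le> (LINT x|Mab a b. \<bar>F (fst (y s) x) - F (fst (y t) x)\<bar>)" by (rule integral_abs_bound)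
      also have "\<dots> \<le> (LINT x|Mab a b. L * (Csup * NX (y s - y t)))"
        by (rule integral_mono) (use i finite_measure.integrable_const[OF finite_measure_Mab] pt in auto)
      also have "\<dots> = (b - a) * (L * (Csup * NX (y s - y t)))" using ab by (simp add: measure_restrict_space)
      finally show ?case by simp
    qed
  qed
  then have l3: "((\<lambda>s. LINT x|Mab a b. F (fst (y s) x)) \<longlongrightarrow> (LINT x|Mab a b. F (fst (y t) x))) ?Q"
    by (simp add: LIM_zero_iff)
  show "((\<lambda>s. Gen (y s)) \<longlongrightarrow> Gen (y t)) ?Q"
    unfolding Gen_def by (intro tendsto_intros l1 l2 l3) auto
qed

end

lemma eventually_shift_right:
  fixes t :: real
  assumes "\<forall>\<^sub>F s in at t within {0..}. Q s" "0 \<le> t"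
  shows "\<forall>\<^sub>F h in at_right 0. Q (t + h)"
proof -
  obtain d where "d > 0" "\<And>s. 0 \<le> s \<Longrightarrow> s \<noteq> t \<Longrightarrow> dist s t < d \<Longrightarrow> Q s"
    using assms(1) unfolding eventually_at by auto
  then show ?thesis using assms(2) unfolding eventually_at_right[OF zero_less_one]
    by (intro exI[of _ d]) (auto simp: dist_real_def)
qed

text \<open>From here on the Duhamel formula is forgotten: membership in X, continuity and the
  one-step expansion carry the whole energy balance.\<close>

locale wave_flow = wave_semigroup + damped_wave +
  fixes y :: "real \<Rightarrow> state"
  assumes yX: "\<And>t. 0 \<le> t \<Longrightarrow> y t \<in> X a b"
    and y_cont: "\<And>t. 0 \<le> t \<Longrightarrow> ((\<lambda>s. NX (y s - y t)) \<longlongrightarrow> 0) (at t within {0..})"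
    and y_step: "\<And>t e. 0 \<le> t \<Longrightarrow> 0 < e \<Longrightarrow> \<forall>\<^sub>F h in at_right 0. NX (y (t + h) - S h (y t) - h *\<^sub>R P (y t)) \<le> h * e"
begin

text \<open>The semigroup moves u with velocity w - u, and the first component of Phi adds u back.
  This gives u_t = w in the sense of right increments.\<close>

lemma velocity_step:
  assumes t: "0 \<le> t" and e: "0 < e"
  shows "\<forall>\<^sub>F h in at_right 0. N2 (fst (y (t + h)) - fst (y t) - h *\<^sub>R snd (y t)) \<le> h * e"
proof -
  have "\<forall>\<^sub>F h in at_right 0. NX (y (t + h) - S h (y t) - h *\<^sub>R P (y t)) \<le> h * (e / 2 * sqrt \<tau>)"
    using e \<tau> by (intro y_step t) simp
  moreover have "\<forall>\<^sub>F h in at_right 0. N2 (fst (S h (y t)) - fst (y t) - h *\<^sub>R (snd (y t) - fst (y t))) \<le> h * (e / 2)"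
    using e by (intro S_fst_expansion yX t) simp
  ultimately show ?thesis using eventually_at_right_less[of "0::real"]
  proof eventually_elim
    case (elim h)
    define \<rho> where "\<rho> = y (t + h) - S h (y t) - h *\<^sub>R P (y t)"
    have m: "y t \<in> X a b" "y (t + h) \<in> X a b" "S h (y t) \<in> X a b" "P (y t) \<in> X a b"
      using t elim by (auto intro!: yX S_X Phi_X)
    have \<rho>: "\<rho> \<in> X a b" unfolding \<rho>_def using m by (intro xs.V_diff xs.V_scale)
    have eq: "fst (y (t + h)) - fst (y t) - h *\<^sub>R snd (y t) = fst \<rho> + (fst (S h (y t)) - fst (y t) - h *\<^sub>R (snd (y t) - fst (y t)))"
      by (simp add: \<rho>_def Phi_fst algebra_simps)
    have "N2 (fst \<rho>) \<le> NX \<rho> / sqrt \<tau>" using \<rho> by (rule N2_fst_le)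
    also have "\<dots> \<le> h * (e / 2 * sqrt \<tau>) / sqrt \<tau>" using elim \<tau> by (intro divide_right_mono) (auto simp: \<rho>_def)
    also have "\<dots> = h * (e / 2)" using \<tau> by simp
    finally have 1: "N2 (fst \<rho>) \<le> h * (e / 2)" .
    have "N2 (fst \<rho> + (fst (S h (y t)) - fst (y t) - h *\<^sub>R (snd (y t) - fst (y t))))
      \<le> N2 (fst \<rho>) + N2 (fst (S h (y t)) - fst (y t) - h *\<^sub>R (snd (y t) - fst (y t)))"
      by (intro l2.nm_triangle l2.V_diff l2.V_scale X_D(2)[OF \<rho>] X_D(2)[OF m(3)] X_D(2)[OF m(1)] X_D(4)[OF m(1)])
    then show ?case unfolding eq using 1 elim by simp
  qed
qed

text \<open>The increments of the three summands of \<open>Gen\<close> are estimated separately. The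
  \<tau> <u, w> of \<open>Qform\<close> cancels against that of -\<tau> |u|^2 / 2, and <w, f(u)>
  cancels against the increment of the potential; the damping term is left.\<close>

lemma energy_step:
  assumes t: "0 \<le> t" and e0: "0 < e0"
  shows "\<forall>\<^sub>F h in at_right 0. Gen (y (t + h)) \<le> Gen (y t) + h * (- \<sigma> * (N2 (snd (y t)))\<^sup>2 + e0)"
proof -
  define z where "z = y t"
  define u where "u = fst z"
  define w where "w = snd z"
  define \<zeta> where "\<zeta> = P z"
  define fu where "fu = (\<lambda>x. f (u x))"
  define gw where "gw = (\<lambda>x. g (u x) * w x)"
  have zX: "z \<in> X a b" using t by (simp add: z_def yX)
  have \<zeta>X: "\<zeta> \<in> X a b" unfolding \<zeta>_def using zX by (rule Phi_X)
  have L: "u \<in> L2 a b" "w \<in> L2 a b" "fu \<in> L2 a b" "gw \<in> L2 a b"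
    using X_D[OF zX] comp_L2[OF zX] by (auto simp: u_def w_def fu_def gw_def)
  define R where "R = Csup * (NX z + 1)"
  obtain C where C: "C \<ge> 0" "\<And>s t. s \<in> {-R..R} \<Longrightarrow> t \<in> {-R..R} \<Longrightarrow> F t \<le> F s - f s * (t - s) + C * (t - s)\<^sup>2"
    using quadratic_upper_bound[OF DF Df cf'] by blast
  \<comment> \<open>K is the sum of the coefficients of e in the three estimates below; e is then
    chosen with e * K at most e0.\<close>
  define K where "K = (1 + NX \<zeta> + NX z + (NX \<zeta> + 1)\<^sup>2 / 2) + \<tau> * N2 u + (N2 fu + C * (N2 w + 1)\<^sup>2)"
  have nn: "0 \<le> NX \<zeta>" "0 \<le> NX z" "0 \<le> N2 u" "0 \<le> N2 fu" "0 \<le> N2 w"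
    using zX \<zeta>X L by (auto intro: xs.nm_nonneg l2.nm_nonneg)
  have K: "K \<ge> 1" using nn \<tau> C(1) unfolding K_def by (simp add: add_nonneg_nonneg)
  define e where "e = min 1 (e0 / K)"
  have e: "0 < e" "e \<le> 1" "e * K \<le> e0" using e0 K by (auto simp: e_def min_def field_simps)
  have main: "Qform z + Xinner a b \<tau> \<epsilon> z \<zeta> = \<tau> * l2ip a b u w + l2ip a b w fu - l2ip a b w gw"
    unfolding \<zeta>_def Xinner_Phi[OF zX] Qform_def by (simp add: u_def w_def fu_def gw_def)
  have damp: "\<sigma> * (N2 w)\<^sup>2 \<le> l2ip a b w gw" using damping_lower_bound[OF zX] by (simp add: u_def w_def gw_def)
  have ev1: "\<forall>\<^sub>F h in at_right 0. NX (y (t + h) - S h z - h *\<^sub>R \<zeta>) \<le> h * e"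
    unfolding z_def \<zeta>_def by (rule y_step[OF t e(1)])
  have ev2: "\<forall>\<^sub>F h in at_right 0. (NX (S h z))\<^sup>2 / 2 \<le> (NX z)\<^sup>2 / 2 + h * (Qform z + e)"
    by (rule S_half_square[OF zX e(1)])
  have ev3: "\<forall>\<^sub>F h in at_right 0. N2 (fst (y (t + h)) - u - h *\<^sub>R w) \<le> h * e"
    unfolding u_def w_def z_def by (rule velocity_step[OF t e(1)])
  have ev4: "\<forall>\<^sub>F h in at_right 0. NX (S h z - z) < e" using S_strong[OF zX] e(1) by (rule order_tendstoD)
  have ev5: "\<forall>\<^sub>F h in at_right 0. NX (y (t + h) - z) < 1"
  proof -
    have "\<forall>\<^sub>F s in at t within {0..}. NX (y s - y t) < 1" using y_cont[OF t] by (intro order_tendstoD) auto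
    then show ?thesis unfolding z_def by (rule eventually_shift_right[OF _ t])
  qed
  have ev6: "\<forall>\<^sub>F h in at_right 0. h < e" using e(1) by (rule eventually_at_right_real[THEN eventually_mono]) auto
  from ev1 ev2 ev3 ev4 ev5 ev6 eventually_at_right_less[of "0::real"]
  show ?thesis
  proof eventually_elim
    case (elim h)
    define y' where "y' = y (t + h)"
    define u' where "u' = fst y'"
    have y'X: "y' \<in> X a b" using t elim by (auto simp: y'_def intro: yX)
    have xX: "S h z \<in> X a b" using elim zX by (auto intro: S_X)
    have u'L: "u' \<in> L2 a b" unfolding u'_def using y'X by (rule X_D)
    have dL: "u' - u \<in> L2 a b" "u' - u - h *\<^sub>R w \<in> L2 a b" using u'L L by (auto intro!: l2.V_diff l2.V_scale)
    have h0: "0 \<le> h" using elim by simp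
    have rest: "N2 (u' - u - h *\<^sub>R w) \<le> h * e" using elim by (simp add: u'_def y'_def)
    have 1: "(NX y')\<^sup>2 / 2 \<le> (NX z)\<^sup>2 / 2 + h * (Qform z + Xinner a b \<tau> \<epsilon> z \<zeta> + e * (1 + NX \<zeta> + NX z + (NX \<zeta> + 1)\<^sup>2 / 2))"
    proof -
      have "(NX y')\<^sup>2 / 2 \<le> (NX (S h z))\<^sup>2 / 2 + h * (Xinner a b \<tau> \<epsilon> (S h z) \<zeta> + NX (S h z) * e + h * (NX \<zeta> + e)\<^sup>2 / 2)"
        using elim y'X xX \<zeta>X by (intro xs.half_square_step) (auto simp: y'_def)
      also have "\<dots> \<le> ((NX z)\<^sup>2 / 2 + h * (Qform z + e)) + h * ((Xinner a b \<tau> \<epsilon> z \<zeta> + e * NX \<zeta>) + NX z * e + e * (NX \<zeta> + 1)\<^sup>2 / 2)"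
      proof (intro add_mono mult_left_mono h0)
        show "(NX (S h z))\<^sup>2 / 2 \<le> (NX z)\<^sup>2 / 2 + h * (Qform z + e)" using elim by simp
        have "Xinner a b \<tau> \<epsilon> (S h z) \<zeta> - Xinner a b \<tau> \<epsilon> z \<zeta> = Xinner a b \<tau> \<epsilon> (S h z - z) \<zeta>"
          using xX zX \<zeta>X by (simp add: xs.ip_diff)
        also have "\<dots> \<le> NX (S h z - z) * NX \<zeta>" using xs.ip_abs_le[OF xs.V_diff[OF xX zX] \<zeta>X] by simp
        also have "\<dots> \<le> e * NX \<zeta>" using elim nn by (intro mult_right_mono) auto
        finally show "Xinner a b \<tau> \<epsilon> (S h z) \<zeta> \<le> Xinner a b \<tau> \<epsilon> z \<zeta> + e * NX \<zeta>" by simp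
        show "NX (S h z) * e \<le> NX z * e" using S_contr[OF h0 zX] e by (intro mult_right_mono) auto
        have "(NX \<zeta> + e)\<^sup>2 \<le> (NX \<zeta> + 1)\<^sup>2" using nn e by (intro power_mono) auto
        then show "h * (NX \<zeta> + e)\<^sup>2 / 2 \<le> e * (NX \<zeta> + 1)\<^sup>2 / 2"
          using elim h0 e by (intro divide_right_mono mult_mono) auto
      qed
      also have "\<dots> = (NX z)\<^sup>2 / 2 + h * (Qform z + Xinner a b \<tau> \<epsilon> z \<zeta> + e * (1 + NX \<zeta> + NX z + (NX \<zeta> + 1)\<^sup>2 / 2))"
        by (simp add: algebra_simps)
      finally show ?thesis .
    qed
    have 2: "- (\<tau> / 2 * (N2 u')\<^sup>2) \<le> - (\<tau> / 2 * (N2 u)\<^sup>2) + h * (- (\<tau> * l2ip a b u w) + e * (\<tau> * N2 u))"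
    proof -
      have "l2ip a b u (u' - u) = l2ip a b u (h *\<^sub>R w) + l2ip a b u (u' - u - h *\<^sub>R w)"
        using L dL by (simp add: l2.ip_diff_right l2.V_scale l2.V_diff u'L)
      moreover have "l2ip a b u (h *\<^sub>R w) = h * l2ip a b u w" using L by (simp add: l2.ip_scale_right)
      moreover have "l2ip a b u (u' - u - h *\<^sub>R w) \<ge> - (N2 u * (h * e))"
        using l2.ip_abs_le[OF L(1) dL(2)] mult_left_mono[OF rest nn(3)] by linarith
      ultimately have "l2ip a b u (u' - u) \<ge> h * l2ip a b u w - N2 u * (h * e)" by linarith
      then have "(N2 u)\<^sup>2 / 2 + (h * l2ip a b u w - N2 u * (h * e)) \<le> (N2 u')\<^sup>2 / 2"
        unfolding l2.half_square[OF L(1) u'L] using zero_le_power2[of "N2 (u' - u)"] by linarith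
      then have "\<tau> * ((N2 u)\<^sup>2 / 2 + (h * l2ip a b u w - N2 u * (h * e))) \<le> \<tau> * ((N2 u')\<^sup>2 / 2)"
        using \<tau> by (intro mult_left_mono) auto
      then show ?thesis by (simp add: algebra_simps)
    qed
    have 3: "(LINT x|Mab a b. F (u' x)) \<le> (LINT x|Mab a b. F (u x)) + h * (- l2ip a b w fu + e * (N2 fu + C * (N2 w + 1)\<^sup>2))"
    proof -
      have "NX y' \<le> NX z + 1" using xs.nm_diff_abs[OF y'X zX] elim by (simp add: y'_def)
      then have "Csup * NX y' \<le> R" "Csup * NX z \<le> R" unfolding R_def using Csup_pos by (auto intro!: mult_left_mono)
      then have uR: "u' x \<in> {-R..R}" "u x \<in> {-R..R}" if "x \<in> {a..b}" for x
        using sup_le_NX[OF y'X that] sup_le_NX[OF zX that] by (auto simp: u_def u'_def)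
      have i: "integrable (Mab a b) (\<lambda>x. F (u' x))" "integrable (Mab a b) (\<lambda>x. F (u x))"
        using comp_L2(3)[OF y'X] comp_L2(3)[OF zX] by (auto simp: u'_def u_def)
      have i2: "integrable (Mab a b) (\<lambda>x. fu x * (u' - u) x)" "integrable (Mab a b) (\<lambda>x. C * ((u' - u) x)\<^sup>2)"
        using L2_mult[OF L(3) dL(1)] L2_square[OF dL(1)] by auto
      have "(LINT x|Mab a b. F (u' x)) \<le> (LINT x|Mab a b. F (u x) - fu x * (u' - u) x + C * ((u' - u) x)\<^sup>2)"
      proof (rule integral_mono[OF i(1)])
        show "integrable (Mab a b) (\<lambda>x. F (u x) - fu x * (u' - u) x + C * ((u' - u) x)\<^sup>2)" using i i2 by simp
        show "F (u' x) \<le> F (u x) - fu x * (u' - u) x + C * ((u' - u) x)\<^sup>2" if "x \<in> space (Mab a b)" for x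
          using C(2)[of "u x" "u' x"] uR[of x] that by (simp add: fu_def)
      qed
      also have "\<dots> = (LINT x|Mab a b. F (u x)) - l2ip a b fu (u' - u) + C * (N2 (u' - u))\<^sup>2"
        using i i2 unfolding l2nm_square[OF dL(1)] l2ip_def by simp
      also have "\<dots> \<le> (LINT x|Mab a b. F (u x)) - (h * l2ip a b w fu - N2 fu * (h * e)) + C * (h * (e * (N2 w + 1)\<^sup>2))"
      proof (intro add_mono diff_mono mult_left_mono C(1) order_refl)
        have "l2ip a b fu (u' - u) = l2ip a b fu (h *\<^sub>R w) + l2ip a b fu (u' - u - h *\<^sub>R w)"
          using L dL by (simp add: l2.ip_diff_right l2.V_scale l2.V_diff u'L)
        moreover have "l2ip a b fu (h *\<^sub>R w) = h * l2ip a b w fu" using L l2.ip_commute[OF L(2,3)] by (simp add: l2.ip_scale_right)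
        moreover have "l2ip a b fu (u' - u - h *\<^sub>R w) \<ge> - (N2 fu * (h * e))"
          using l2.ip_abs_le[OF L(3) dL(2)] mult_left_mono[OF rest nn(4)] by linarith
        ultimately show "h * l2ip a b w fu - N2 fu * (h * e) \<le> l2ip a b fu (u' - u)" by linarith
        have "N2 (u' - u) \<le> N2 (u' - u - h *\<^sub>R w) + N2 (h *\<^sub>R w)"
          using l2.nm_triangle[OF dL(2) l2.V_scale[OF L(2), of h]] by simp
        also have "\<dots> \<le> h * (N2 w + 1)"
          using rest l2.nm_scale[OF L(2), of h] h0 mult_left_mono[OF e(2) h0] by (simp add: algebra_simps)
        finally have "(N2 (u' - u))\<^sup>2 \<le> (h * (N2 w + 1))\<^sup>2" using l2.nm_nonneg[OF dL(1)] by (intro power_mono)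
        also have "\<dots> = h * (h * (N2 w + 1)\<^sup>2)" by (simp add: power2_eq_square)
        also have "\<dots> \<le> h * (e * (N2 w + 1)\<^sup>2)" using elim h0 by (intro mult_left_mono mult_right_mono) auto
        finally show "(N2 (u' - u))\<^sup>2 \<le> h * (e * (N2 w + 1)\<^sup>2)" .
      qed
      also have "\<dots> = (LINT x|Mab a b. F (u x)) + h * (- l2ip a b w fu + e * (N2 fu + C * (N2 w + 1)\<^sup>2))"
        by (simp add: algebra_simps)
      finally show ?thesis .
    qed
    have collect: "(A + h * (Q + e * k1)) + (- B + h * (- t + e * k2)) + (D + h * (- l + e * k3))
      = (A - B + D) + h * (Q - t - l + e * (k1 + k2 + k3))" for A B D Q k1 k2 k3 t l :: real
      by (simp add: algebra_simps)
    have "Gen y' \<le> Gen z + h * (Qform z + Xinner a b \<tau> \<epsilon> z \<zeta> - \<tau> * l2ip a b u w - l2ip a b w fu + e * K)"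
    proof -
      have "Gen y' = (NX y')\<^sup>2 / 2 + - (\<tau> / 2 * (N2 u')\<^sup>2) + (LINT x|Mab a b. F (u' x))" by (simp add: Gen_def u'_def)
      also have "\<dots> \<le> ((NX z)\<^sup>2 / 2 + h * (Qform z + Xinner a b \<tau> \<epsilon> z \<zeta> + e * (1 + NX \<zeta> + NX z + (NX \<zeta> + 1)\<^sup>2 / 2)))
        + (- (\<tau> / 2 * (N2 u)\<^sup>2) + h * (- (\<tau> * l2ip a b u w) + e * (\<tau> * N2 u)))
        + ((LINT x|Mab a b. F (u x)) + h * (- l2ip a b w fu + e * (N2 fu + C * (N2 w + 1)\<^sup>2)))"
        by (intro add_mono 1 2 3)
      also have "\<dots> = Gen z + h * (Qform z + Xinner a b \<tau> \<epsilon> z \<zeta> - \<tau> * l2ip a b u w - l2ip a b w fu + e * K)"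
        unfolding Gen_def K_def u_def[symmetric] by (rule collect)
      finally show ?thesis .
    qed
    also have "\<dots> \<le> Gen z + h * (- \<sigma> * (N2 w)\<^sup>2 + e0)"
      unfolding main using damp e h0 by (intro add_left_mono mult_left_mono) auto
    finally show ?case by (simp add: y'_def z_def w_def)
  qed
qed

lemma speed_continuous: "continuous_on {0..T} (\<lambda>s. (N2 (snd (y s)))\<^sup>2)"
proof -
  have "continuous_on {0..} (\<lambda>s. N2 (snd (y s)))"
    unfolding continuous_on using Gen_continuous(2)[OF yX _ y_cont] by auto
  then show ?thesis by (intro continuous_intros) (auto elim: continuous_on_subset)
qed

lemma energy_dissipation:
  assumes "0 \<le> T"
  shows "Gen (y T) + \<sigma> * integral {0..T} (\<lambda>s. (N2 (snd (y s)))\<^sup>2) \<le> Gen (y 0)"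
proof -
  let ?\<Gamma> = "\<lambda>t. - \<sigma> * integral {0..t} (\<lambda>s. (N2 (snd (y s)))\<^sup>2)"
  have "Gen (y T) - Gen (y 0) \<le> ?\<Gamma> T - ?\<Gamma> 0"
  proof (rule dini_bound[OF assms])
    have "continuous_on {0..} (\<lambda>s. Gen (y s))"
      unfolding continuous_on using Gen_continuous(1)[OF yX _ y_cont] by auto
    then show "continuous_on {0..T} (\<lambda>s. Gen (y s))" by (rule continuous_on_subset) auto
    show "(?\<Gamma> has_real_derivative - \<sigma> * (N2 (snd (y t)))\<^sup>2) (at t within {0..T})" if "t \<in> {0..T}" for t
      by (intro DERIV_cmult integral_has_real_derivative speed_continuous that)
    show "\<forall>\<^sub>F h in at_right 0. Gen (y (t + h)) \<le> Gen (y t) + h * (- \<sigma> * (N2 (snd (y t)))\<^sup>2 + e)"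
      if "0 \<le> t" "t < T" "0 < e" for t e using that by (intro energy_step)
  qed
  then show ?thesis by simp
qed

text \<open>The speed is bounded by its square through Young's inequality with a free weight \<mu>,
  so that the displacement is expressed by the dissipation and the elapsed time. The weight is
  chosen only at the end.\<close>

lemma displacement_bound:
  assumes T: "0 \<le> T" and \<mu>: "0 < \<mu>"
  shows "N2 (fst (y T) - fst (y 0)) \<le> \<mu> / 2 * integral {0..T} (\<lambda>s. (N2 (snd (y s)))\<^sup>2) + T / (2 * \<mu>)"
proof -
  let ?I = "\<lambda>t. integral {0..t} (\<lambda>s. (N2 (snd (y s)))\<^sup>2)"
  let ?\<Gamma> = "\<lambda>t. \<mu> / 2 * ?I t + 1 / (2 * \<mu>) * t"
  have y0: "y 0 \<in> X a b" by (rule yX) simp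
  have "N2 (fst (y T) - fst (y 0)) - N2 (fst (y 0) - fst (y 0)) \<le> ?\<Gamma> T - ?\<Gamma> 0"
  proof (rule dini_bound[OF T])
    have "continuous_on {0..} (\<lambda>s. N2 (fst (y s - y 0)))"
      unfolding continuous_on
    proof (intro ballI Gen_continuous(3))
      show "y s - y 0 \<in> X a b" if "0 \<le> s" for s using that y0 by (intro xs.V_diff yX) auto
      show "((\<lambda>s. NX (y s - y 0 - (y t - y 0))) \<longlongrightarrow> 0) (at t within {0..})" if "t \<in> {0..}" for t
        using y_cont[of t] that by simp
    qed auto
    then show "continuous_on {0..T} (\<lambda>s. N2 (fst (y s) - fst (y 0)))" by (auto elim: continuous_on_subset)
    show "(?\<Gamma> has_real_derivative \<mu> / 2 * (N2 (snd (y t)))\<^sup>2 + 1 / (2 * \<mu>)) (at t within {0..T})" if "t \<in> {0..T}" for t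
    proof -
      have "((\<lambda>t. 1 / (2 * \<mu>) * t) has_real_derivative 1 / (2 * \<mu>)) (at t within {0..T})"
        using DERIV_cmult[OF DERIV_ident, of "1 / (2 * \<mu>)"] by simp
      then show ?thesis by (intro DERIV_add DERIV_cmult integral_has_real_derivative speed_continuous that)
    qed
    fix t e :: real assume t: "0 \<le> t" "t < T" "0 < e"
    have amgm: "s \<le> \<mu> / 2 * s\<^sup>2 + 1 / (2 * \<mu>)" for s
    proof -
      have "0 \<le> (\<mu> * s - 1)\<^sup>2 / (2 * \<mu>)" using \<mu> by simp
      also have "\<dots> = \<mu> / 2 * s\<^sup>2 + 1 / (2 * \<mu>) - s" using \<mu> by (simp add: power2_eq_square field_simps)
      finally show ?thesis by simp
    qed
    from velocity_step[OF t(1,3)] eventually_at_right_less[of "0::real"]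
    show "\<forall>\<^sub>F h in at_right 0. N2 (fst (y (t + h)) - fst (y 0)) \<le> N2 (fst (y t) - fst (y 0)) + h * (\<mu> / 2 * (N2 (snd (y t)))\<^sup>2 + 1 / (2 * \<mu>) + e)"
    proof eventually_elim
      case (elim h)
      have L: "fst (y t) \<in> L2 a b" "snd (y t) \<in> L2 a b" "fst (y 0) \<in> L2 a b" "fst (y (t + h)) \<in> L2 a b"
        using X_D[OF yX[OF t(1)]] X_D[OF y0] X_D[OF yX[of "t + h"]] t elim by auto
      let ?r = "fst (y (t + h)) - fst (y t) - h *\<^sub>R snd (y t)"
      have m: "fst (y t) - fst (y 0) \<in> L2 a b" "?r \<in> L2 a b" "h *\<^sub>R snd (y t) \<in> L2 a b"
        using L by (auto intro!: l2.V_diff l2.V_scale)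
      have eq: "fst (y (t + h)) - fst (y 0) = (fst (y t) - fst (y 0)) + (?r + h *\<^sub>R snd (y t))" by simp
      have "N2 (fst (y (t + h)) - fst (y 0)) \<le> N2 (fst (y t) - fst (y 0)) + N2 (?r + h *\<^sub>R snd (y t))"
        by (subst eq, rule l2.nm_triangle[OF m(1) l2.V_add[OF m(2,3)]])
      moreover have "N2 (?r + h *\<^sub>R snd (y t)) \<le> N2 ?r + N2 (h *\<^sub>R snd (y t))" by (rule l2.nm_triangle[OF m(2,3)])
      moreover have "N2 (h *\<^sub>R snd (y t)) = h * N2 (snd (y t))" using l2.nm_scale[OF L(2), of h] elim by simp
      moreover have "h * N2 (snd (y t)) \<le> h * (\<mu> / 2 * (N2 (snd (y t)))\<^sup>2 + 1 / (2 * \<mu>))" using elim amgm by (intro mult_left_mono) auto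
      ultimately show ?case using elim(1) unfolding distrib_left[of h _ e] by linarith
    qed
  qed
  then show ?thesis by (simp add: l2.nm_zero)
qed

end

context damped_wave
begin

text \<open>The flow estimates restated for the prescribed data z0, with which y 0 agrees up to a
  null element.\<close>

theorem mild_solution_energy:
  assumes mild: "mild_solution a b \<tau> \<epsilon> f g z0 y" and z0: "z0 \<in> X a b"
  shows "\<And>t. 0 \<le> t \<Longrightarrow> y t \<in> X a b"
    and "Xeq a b \<tau> \<epsilon> (y 0) z0"
    and "\<And>T. continuous_on {0..T} (\<lambda>s. (N2 (snd (y s)))\<^sup>2)"
    and "\<And>T. 0 \<le> T \<Longrightarrow> Gen (y T) + \<sigma> * integral {0..T} (\<lambda>s. (N2 (snd (y s)))\<^sup>2) \<le> Gen z0"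
    and "\<And>T \<mu>. 0 \<le> T \<Longrightarrow> 0 < \<mu> \<Longrightarrow>
      N2 (fst (y T) - fst z0) \<le> \<mu> / 2 * integral {0..T} (\<lambda>s. (N2 (snd (y s)))\<^sup>2) + T / (2 * \<mu>)"
proof -
  have yX: "y t \<in> X a b" and yc: "((\<lambda>s. NX (y s - y t)) \<longlongrightarrow> 0) (at t within {0..})" if "0 \<le> t" for t
    using mild that by (auto simp: mild_solution_def)
  obtain S where S: "contraction_semigroup_of_A a b \<tau> \<epsilon> S"
    and J: "\<And>t. 0 \<le> t \<Longrightarrow> \<exists>J. has_X_integral a b \<tau> \<epsilon> (\<lambda>s. S (t - s) (P (y s))) t J \<and> Xeq a b \<tau> \<epsilon> (y t) (S t z0 + J)"
    using mild by (auto simp: mild_solution_def)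
  interpret wave_semigroup a b \<tau> \<epsilon> S by unfold_locales (rule S)
  have PX: "P (y t) \<in> X a b" if "0 \<le> t" for t using that by (intro Phi_X yX)
  have Pc: "((\<lambda>s. NX (P (y s) - P (y t))) \<longlongrightarrow> 0) (at t within {0..})" if t: "0 \<le> t" for t
  proof (rule tendstoI)
    fix e :: real assume "e > 0"
    then obtain d where d: "d > 0" "\<And>z'. z' \<in> X a b \<Longrightarrow> NX (z' - y t) < d \<Longrightarrow> NX (P z' - P (y t)) < e"
      using Phi_continuous[OF yX[OF t]] by blast
    have "\<forall>\<^sub>F s in at t within {0..}. NX (y s - y t) < d" using yc[OF t] d(1) by (rule order_tendstoD)
    moreover have "\<forall>\<^sub>F s in at t within {0..}. 0 \<le> s" by (auto simp: eventually_at_filter)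
    ultimately show "\<forall>\<^sub>F s in at t within {0..}. dist (NX (P (y s) - P (y t))) 0 < e"
    proof eventually_elim
      case (elim s)
      then show ?case using d(2)[OF yX] xs.nm_nonneg[OF xs.V_diff[OF PX[of s] PX[OF t]]] by simp
    qed
  qed
  interpret wave_flow a b \<tau> \<epsilon> S f f' g F \<sigma> y
    by unfold_locales (auto intro: yX yc mild_increment[OF PX Pc yX z0 J])
  show "y t \<in> X a b" if "0 \<le> t" for t using that by (rule yX)
  obtain J0 where J0: "has_X_integral a b \<tau> \<epsilon> (\<lambda>s. S (0 - s) (P (y s))) 0 J0" "Xeq a b \<tau> \<epsilon> (y 0) (S 0 z0 + J0)"
    using J[of 0] by auto
  show eq0: "Xeq a b \<tau> \<epsilon> (y 0) z0" by (rule mild_initial[OF J0(1) z0 yX J0(2)]) simp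
  have G0: "Gen (y 0) = Gen z0" by (rule Gen_Xeq[OF yX z0 eq0]) simp
  show "continuous_on {0..T} (\<lambda>s. (N2 (snd (y s)))\<^sup>2)" for T by (rule speed_continuous)
  show "Gen (y T) + \<sigma> * integral {0..T} (\<lambda>s. (N2 (snd (y s)))\<^sup>2) \<le> Gen z0" if "0 \<le> T" for T
    using energy_dissipation[OF that] G0 by simp
  show "N2 (fst (y T) - fst z0) \<le> \<mu> / 2 * integral {0..T} (\<lambda>s. (N2 (snd (y s)))\<^sup>2) + T / (2 * \<mu>)" if "0 \<le> T" "0 < \<mu>" for T \<mu>
  proof -
    have L: "fst (y T) \<in> L2 a b" "fst (y 0) \<in> L2 a b" "fst z0 \<in> L2 a b"
      using X_D(2)[OF yX[OF that(1)]] X_D(2)[OF yX[of 0]] X_D(2)[OF z0] by auto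
    have "N2 (fst (y T) - fst z0) = N2 (fst (y T) - fst (y 0))"
      using l2.nm_replace[of "fst (y 0)" a b "fst z0" "fst (y T)" "fst (y T)" 0] Xeq_N2(1)[OF yX z0 eq0] L
        l2.nm_minus_commute[OF L(1,2)] l2.nm_minus_commute[OF L(1,3)] by (simp add: l2.V_zero l2.nm_zero)
    then show ?thesis using displacement_bound[OF that] by simp
  qed
qed

end

section \<open>Coercivity, nondegenerate wells and the transformation G\<close>

section \<open>The double-well potential\<close>

lemma indicator_integrable:
  fixes h :: "real \<Rightarrow> real"
  assumes "integrable (Mab a b) h" "A \<in> sets lebesgue"
  shows "integrable (Mab a b) (\<lambda>x. indicator A x * h x)"
proof -
  have "A \<inter> {a<..<b} \<in> sets (Mab a b)" using assms(2) by (auto simp: sets_restrict_space)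
  from integrable_mult_indicator[OF this assms(1)]
  have "integrable (Mab a b) (\<lambda>x. indicator (A \<inter> {a<..<b}) x * h x)" by simp
  then show ?thesis
    by (rule Bochner_Integration.integrable_cong[THEN iffD1, rotated 2]) (auto simp: indicator_def)
qed

text \<open>\<open>Gam\<close> is the Modica-Mortola transformation. Any antiderivative will do,
  because only its differences matter.\<close>

locale double_well =
  fixes F f f' Gam :: "real \<Rightarrow> real"
  assumes DF: "\<And>s. (F has_real_derivative - f s) (at s)" and Df: "\<And>s. (f has_real_derivative f' s) (at s)"
    and cf': "continuous_on UNIV f'"
    and F_top: "filterlim F at_top at_top" and F_bot: "filterlim F at_top at_bot"
    and F_wells: "F 1 = 0" "F (-1) = 0" "f 1 = 0" "f (-1) = 0"
    and f'_wells: "f' 1 < 0" "f' (-1) < 0"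
    and critical: "{s. f s = 0 \<and> F s \<le> 0} = {-1, 1}"
    and DGam: "\<And>s. (Gam has_real_derivative sqrt (2 * F s)) (at s)"
begin

lemma cF: "continuous_on S F"
  using has_field_derivative_at_within[OF DF] by (rule DERIV_continuous_on)

text \<open>By coercivity F has a global minimiser; it is critical with value at most F 1 = 0, hence
  one of the wells, where F vanishes.\<close>

lemma F_nonneg: "0 \<le> F s"
proof -
  obtain M1 where M1: "\<And>x. x \<ge> M1 \<Longrightarrow> F x \<ge> 1"
    using F_top unfolding filterlim_at_top eventually_at_top_linorder by blast
  obtain M2 where M2: "\<And>x. x \<le> M2 \<Longrightarrow> F x \<ge> 1"
    using F_bot unfolding filterlim_at_top eventually_at_bot_linorder by blast
  define lo where "lo = min M2 (-2)"
  define hi where "hi = max M1 2"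
  have "{lo..hi} \<noteq> {}" by (simp add: lo_def hi_def)
  then obtain m where m: "m \<in> {lo..hi}" "\<And>x. x \<in> {lo..hi} \<Longrightarrow> F m \<le> F x"
    using continuous_attains_inf[OF compact_Icc _ cF] by metis
  have "1 \<in> {lo..hi}" by (auto simp: lo_def hi_def)
  then have m0: "F m \<le> 0" using m(2) F_wells by fastforce
  have gm: "F m \<le> F x" for x
  proof (cases "x \<in> {lo..hi}")
    case False
    then have "F x \<ge> 1" using M1[of x] M2[of x] by (auto simp: lo_def hi_def not_le)
    then show ?thesis using m0 by simp
  qed (rule m)
  have "- f m = 0" by (rule DERIV_local_min[OF DF zero_less_one]) (use gm in auto)
  then have "m \<in> {s. f s = 0 \<and> F s \<le> 0}" using m0 by simp
  then have "F m = 0" unfolding critical using F_wells by auto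
  then show ?thesis using gm[of s] by simp
qed

lemma F_zero: "F s = 0 \<Longrightarrow> s = 1 \<or> s = -1"
proof -
  assume s: "F s = 0"
  have "- f s = 0" by (rule DERIV_local_min[OF DF zero_less_one]) (use F_nonneg s in auto)
  then have "s \<in> {s. f s = 0 \<and> F s \<le> 0}" using s by simp
  then show ?thesis unfolding critical by auto
qed

text \<open>The derivative is nonnegative and vanishes only at the two wells, so every interval
  contains a point where it is positive.\<close>

lemma Gam_strict_mono: "s < t \<Longrightarrow> Gam s < Gam t"
proof -
  assume st: "s < t"
  have mono: "Gam x \<le> Gam y" if "x \<le> y" for x y
  proof (rule DERIV_nonneg_imp_nondecreasing[OF that])
    show "\<exists>d. DERIV Gam z :> d \<and> 0 \<le> d" for z
      using DGam[of z] F_nonneg[of z] by (intro exI[of _ "sqrt (2 * F z)"]) simp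
  qed
  have "\<exists>x \<in> {s<..<t}. F x \<noteq> 0"
  proof (rule ccontr)
    assume "\<not> ?thesis"
    then have "{s<..<t} \<subseteq> {1, -1}" using F_zero by blast
    then have "finite {s<..<t}" by (rule finite_subset) simp
    then show False using st infinite_Ioo by blast
  qed
  then obtain x where x: "s < x" "x < t" "F x > 0" using F_nonneg by (metis greaterThanLessThan_iff less_eq_real_def)
  have "\<exists>d>0. \<forall>h>0. h < d \<longrightarrow> Gam x < Gam (x + h)"
    using DGam[of x] x(3) by (intro DERIV_pos_inc_right[of Gam "sqrt (2 * F x)"]) auto
  then obtain d where d: "d > 0" "\<And>h. 0 < h \<Longrightarrow> h < d \<Longrightarrow> Gam x < Gam (x + h)" by blast
  define h where "h = min (d / 2) (t - x)"
  have h: "0 < h" "h < d" "x + h \<le> t" using d x by (auto simp: h_def min_def)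
  have "Gam s \<le> Gam x" using mono x by simp
  also have "\<dots> < Gam (x + h)" using d(2) h by blast
  also have "\<dots> \<le> Gam t" using mono h by blast
  finally show ?thesis .
qed

lemma Gam_less_iff: "Gam s < Gam t \<longleftrightarrow> s < t"
  using Gam_strict_mono by (metis less_asym linorder_neqE)

lemma Gam_le_iff: "Gam s \<le> Gam t \<longleftrightarrow> s \<le> t"
  using Gam_less_iff by (metis not_less)

text \<open>Close to p the sign of f' gives the bound by two mean values. On the rest of the
  interval of radius 1/2, which excludes the other well, F has a positive minimum by
  compactness.\<close>

lemma F_quadratic_lower:
  assumes p: "p \<in> {-1, 1}"
  obtains \<kappa> where "\<kappa> > 0" "\<And>s. \<bar>s - p\<bar> \<le> 1/2 \<Longrightarrow> \<kappa> * (s - p)\<^sup>2 \<le> F s"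
proof -
  have p0: "F p = 0" "f p = 0" "f' p < 0" using p F_wells f'_wells by auto
  \<comment> \<open>Half of the second derivative of F at p, so that by continuity f' stays below -c
    near p.\<close>
  define c where "c = - f' p / 2"
  have c: "c > 0" using p0 by (simp add: c_def)
  have "isCont f' p" using cf' by (simp add: continuous_on_eq_continuous_at)
  then have "\<forall>\<^sub>F x in nhds p. f' x < - c"
    using p0 unfolding isCont_def tendsto_at_iff_tendsto_nhds by (intro order_tendstoD) (auto simp: c_def)
  then obtain \<rho> where \<rho>: "\<rho> > 0" "\<And>x. dist x p < \<rho> \<Longrightarrow> f' x < - c"
    unfolding eventually_nhds_metric by blast
  have near: "c / 2 * (s - p)\<^sup>2 \<le> F s" if s: "\<bar>s - p\<bar> < \<rho>" for s
  proof -
    have D: "((\<lambda>s. F s - c / 2 * (s - p)\<^sup>2) has_real_derivative (- f s - c * (s - p))) (at s)" for s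
      by (auto intro!: derivative_eq_intros DF)
    obtain \<xi> where \<xi>: "\<xi> \<in> closed_segment p s" "(F s - c / 2 * (s - p)\<^sup>2) - (F p - c / 2 * (p - p)\<^sup>2) = (- f \<xi> - c * (\<xi> - p)) * (s - p)"
      using mean_value_segment[OF D] by blast
    obtain \<eta> where \<eta>: "\<eta> \<in> closed_segment p \<xi>" "f \<xi> - f p = f' \<eta> * (\<xi> - p)"
      using mean_value_segment[OF Df] by blast
    have "\<bar>\<xi> - p\<bar> \<le> \<bar>s - p\<bar>" "\<bar>\<eta> - p\<bar> \<le> \<bar>\<xi> - p\<bar>" and sg: "0 \<le> (\<xi> - p) * (s - p)"
      using \<xi>(1) \<eta>(1) by (auto simp: closed_segment_eq_real_ivl zero_le_mult_iff split: if_splits)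
    then have "f' \<eta> < - c" using s by (intro \<rho>(2)) (auto simp: dist_real_def)
    then have "0 \<le> (- f' \<eta> - c) * ((\<xi> - p) * (s - p))" by (intro mult_nonneg_nonneg[OF _ sg]) simp
    also have "\<dots> = (- (f' \<eta> * (\<xi> - p)) - c * (\<xi> - p)) * (s - p)" by (simp add: algebra_simps)
    also have "\<dots> = F s - c / 2 * (s - p)\<^sup>2" using \<xi>(2) \<eta>(2) p0 by simp
    finally show ?thesis by simp
  qed
  define A where "A = {p - 1/2 .. p + 1/2} - {p - \<rho> <..< p + \<rho>}"
  have "compact A" unfolding A_def by (intro compact_diff) auto
  obtain m where m: "m > 0" "\<And>s. s \<in> A \<Longrightarrow> m \<le> F s"
  proof (cases "A = {}")
    case True
    then show ?thesis using that[of 1] by simp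
  next
    case False
    obtain q where q: "q \<in> A" "\<And>s. s \<in> A \<Longrightarrow> F q \<le> F s"
      using continuous_attains_inf[OF \<open>compact A\<close> False cF] by blast
    have "q \<noteq> 1 \<and> q \<noteq> -1" using q(1) p \<rho>(1) by (auto simp: A_def)
    then have "F q > 0" using F_zero[of q] F_nonneg[of q] by (auto simp: less_le)
    then show ?thesis using q that by blast
  qed
  \<comment> \<open>The factor 4 compensates (s - p)^2 <= 1/4 on this interval.\<close>
  have "min (c / 2) (4 * m) * (s - p)\<^sup>2 \<le> F s" if s: "\<bar>s - p\<bar> \<le> 1/2" for s
  proof (cases "\<bar>s - p\<bar> < \<rho>")
    case True
    have "min (c / 2) (4 * m) * (s - p)\<^sup>2 \<le> c / 2 * (s - p)\<^sup>2" by (intro mult_right_mono) auto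
    then show ?thesis using near[OF True] by simp
  next
    case False
    then have "s \<in> A" using s by (auto simp: A_def abs_if split: if_splits)
    have "\<bar>s - p\<bar>\<^sup>2 \<le> (1/2)\<^sup>2" using s by (intro power_mono) auto
    then have "min (c / 2) (4 * m) * (s - p)\<^sup>2 \<le> (4 * m) * (1/4)" using m(1) c
      by (intro mult_mono) (auto simp: power2_eq_square)
    then show ?thesis using m(2)[OF \<open>s \<in> A\<close>] by simp
  qed
  then show ?thesis using that[of "min (c / 2) (4 * m)"] c m by simp
qed

text \<open>Nondegeneracy of the wells: the transition cost from a point near a well is controlled by the
  potential itself, which is what lets the lower bound gain one power of \<open>\<epsilon>\<close> per iteration.\<close>

lemma Gam_near_well:
  obtains Cw where "Cw > 0" "\<And>p s. p \<in> {-1, 1} \<Longrightarrow> \<bar>s - p\<bar> \<le> 1/2 \<Longrightarrow> \<bar>Gam s - Gam p\<bar> \<le> Cw * F s"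
proof -
  obtain C where C: "C \<ge> 0" "\<And>s t. s \<in> {-2..2} \<Longrightarrow> t \<in> {-2..2} \<Longrightarrow> F t \<le> F s - f s * (t - s) + C * (t - s)\<^sup>2"
    using quadratic_upper_bound[OF DF Df cf', of 2] by blast
  obtain k1 where k1: "k1 > 0" "\<And>s. \<bar>s - 1\<bar> \<le> 1/2 \<Longrightarrow> k1 * (s - 1)\<^sup>2 \<le> F s" using F_quadratic_lower[of 1] by auto
  obtain k2 where k2: "k2 > 0" "\<And>s. \<bar>s - (-1)\<bar> \<le> 1/2 \<Longrightarrow> k2 * (s - (-1))\<^sup>2 \<le> F s" using F_quadratic_lower[of "-1"] by auto
  define \<kappa> where "\<kappa> = min k1 k2"
  have \<kappa>: "\<kappa> > 0" using k1 k2 by (simp add: \<kappa>_def)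
  \<comment> \<open>G changes by at most sqrt (2 C) (s - p)^2 and (s - p)^2 is at most F s /
    \<kappa>; the summand 1 makes the constant positive.\<close>
  define Cw where "Cw = sqrt (2 * C) / \<kappa> + 1"
  have "\<bar>Gam s - Gam p\<bar> \<le> Cw * F s" if p: "p \<in> {-1, 1}" and s: "\<bar>s - p\<bar> \<le> 1/2" for p s
  proof -
    have low: "\<kappa> * (s - p)\<^sup>2 \<le> F s"
    proof -
      consider "p = 1" | "p = -1" using p by blast
      then show ?thesis
      proof cases
        case 1
        have "\<kappa> * (s - 1)\<^sup>2 \<le> k1 * (s - 1)\<^sup>2" by (intro mult_right_mono) (auto simp: \<kappa>_def)
        then show ?thesis using 1 k1(2)[of s] s by simp
      next
        case 2
        have "\<kappa> * (s - (-1))\<^sup>2 \<le> k2 * (s - (-1))\<^sup>2" by (intro mult_right_mono) (auto simp: \<kappa>_def)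
        then show ?thesis using 2 k2(2)[of s] s by simp
      qed
    qed
    obtain \<xi> where \<xi>: "\<xi> \<in> closed_segment p s" "Gam s - Gam p = sqrt (2 * F \<xi>) * (s - p)"
      using mean_value_segment[OF DGam] by blast
    have d: "\<bar>\<xi> - p\<bar> \<le> \<bar>s - p\<bar>" using \<xi>(1) by (auto simp: closed_segment_eq_real_ivl split: if_splits)
    have "\<bar>\<xi> - p\<bar> \<le> 1/2" using d s by simp
    moreover have "\<bar>p\<bar> = 1" using p by auto
    ultimately have "\<xi> \<in> {-2..2}" "p \<in> {-2..2}" unfolding atLeastAtMost_iff by linarith+
    then have "F \<xi> \<le> F p - f p * (\<xi> - p) + C * (\<xi> - p)\<^sup>2" by (intro C(2))
    also have "\<dots> = C * (\<xi> - p)\<^sup>2" using p F_wells by auto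
    also have "\<dots> \<le> C * \<bar>s - p\<bar>\<^sup>2" using power_mono[OF d, of 2] C(1) by (intro mult_left_mono) auto
    finally have "sqrt (2 * F \<xi>) \<le> sqrt (2 * C * \<bar>s - p\<bar>\<^sup>2)" by simp
    also have "\<dots> = sqrt (2 * C) * \<bar>s - p\<bar>" by (simp add: real_sqrt_mult)
    finally have "\<bar>Gam s - Gam p\<bar> \<le> sqrt (2 * C) * \<bar>s - p\<bar> * \<bar>s - p\<bar>"
      unfolding \<xi>(2) abs_mult using F_nonneg by (intro mult_right_mono) auto
    also have "\<dots> = sqrt (2 * C) / \<kappa> * (\<kappa> * (s - p)\<^sup>2)" using \<kappa> by (simp add: power2_eq_square)
    also have "\<dots> \<le> sqrt (2 * C) / \<kappa> * F s" using low \<kappa> C(1) by (intro mult_left_mono) auto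
    also have "\<dots> \<le> Cw * F s" using F_nonneg[of s] by (simp add: Cw_def distrib_right)
    finally show ?thesis .
  qed
  moreover have "Cw > 0" using \<kappa> C(1) by (simp add: Cw_def add_nonneg_pos)
  ultimately show ?thesis using that by blast
qed

text \<open>A closed set that misses a well misses a neighbourhood of it. Strict monotonicity of G
  turns this into a gap of G values that is uniform even when K is unbounded.\<close>

lemma Gam_gap:
  assumes K: "closed K" "K \<subseteq> UNIV - {-1, 1}"
  obtains g where "g > 0" "\<And>p s. p \<in> {-1, 1} \<Longrightarrow> s \<in> K \<Longrightarrow> g \<le> \<bar>Gam s - Gam p\<bar>"
proof -
  have "\<exists>g>0. \<forall>s\<in>K. g \<le> \<bar>Gam s - Gam p\<bar>" if p: "p \<in> {-1, 1}" for p
  proof -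
    have "open (- K)" "p \<in> - K" using K p by auto
    then obtain d where d: "d > 0" "\<And>s. dist s p < d \<Longrightarrow> s \<notin> K" unfolding open_dist by blast
    define g where "g = min (Gam (p + d) - Gam p) (Gam p - Gam (p - d))"
    have "g > 0" using d(1) Gam_strict_mono by (simp add: g_def)
    moreover have "g \<le> \<bar>Gam s - Gam p\<bar>" if "s \<in> K" for s
    proof -
      have "s \<ge> p + d \<or> s \<le> p - d" using d(2)[of s] that by (force simp: dist_real_def)
      then have "Gam s \<ge> Gam (p + d) \<or> Gam s \<le> Gam (p - d)" by (simp add: Gam_le_iff)
      then show ?thesis unfolding g_def by linarith
    qed
    ultimately show ?thesis by blast
  qed
  then obtain g1 g2 where "g1 > 0" "\<forall>s\<in>K. g1 \<le> \<bar>Gam s - Gam 1\<bar>" "g2 > 0" "\<forall>s\<in>K. g2 \<le> \<bar>Gam s - Gam (-1)\<bar>"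
    by (metis insertI1 insertI2)
  then show ?thesis using that[of "min g1 g2"] by fastforce
qed

section \<open>The chain rule inequality for G along an H1 function\<close>

section \<open>Transition cost\<close>

text \<open>For u in H1 the chain rule is replaced by a subdivision. On a short cell the increment
  of G(u) is sqrt (2 F) at some value of u there times the increment of u, which is an integral of
  p; uniform continuity lets the factor be replaced by its values under the integral at the price
  e.\<close>

lemma Gam_chain:
  assumes wd: "has_weak_deriv a b u p" and u: "continuous_on {a..b} u" and cd: "a \<le> c" "c \<le> d" "d \<le> b"
  shows "\<bar>Gam (u d) - Gam (u c)\<bar> \<le> (LINT x|Mab a b. indicator {c<..<d} x * (sqrt (2 * F (u x)) * \<bar>p x\<bar>))"
proof (cases "c = d")
  case False
  then have cd': "c < d" using cd by simp
  have pL: "p \<in> L2 a b" using wd by (rule has_weak_deriv_L2)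
  let ?W = "\<lambda>x. sqrt (2 * F (u x))"
  have cW: "continuous_on {a..b} ?W" by (intro continuous_intros continuous_on_compose2[OF cF[of UNIV] u]) auto
  obtain B where B: "B \<ge> 0" "\<And>x. x \<in> {a..b} \<Longrightarrow> \<bar>?W x\<bar> \<le> B" using continuous_bounded_ivl[OF cW] by blast
  have absL: "(\<lambda>x. \<bar>p x\<bar>) \<in> L2 a b"
    using pL borel_measurable_abs[OF L2_measurable[OF pL]] by (simp add: L2_def)
  have int: "integrable (Mab a b) (\<lambda>x. ?W x * \<bar>p x\<bar>)"
    by (rule L2_mult[OF continuous_L2[OF cW] absL])
  have ip: "integrable (Mab a b) (\<lambda>x. \<bar>p x\<bar>)" by (rule L2_integrable[OF absL])
  have p0: "0 \<le> (LINT x|Mab a b. \<bar>p x\<bar>)" by simp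
  show ?thesis
  proof (rule field_le_epsilon)
    fix e0 :: real assume e0: "e0 > 0"
    \<comment> \<open>The total price is e times the integral of |p|; adding 1 avoids a zero
      denominator.\<close>
    define e where "e = e0 / ((LINT x|Mab a b. \<bar>p x\<bar>) + 1)"
    have "e0 / (I + 1) > 0 \<and> e0 / (I + 1) * I \<le> e0" if "0 \<le> I" for I
      using e0 that by (auto simp: field_simps)
    from this[OF p0] have e: "e > 0" "e * (LINT x|Mab a b. \<bar>p x\<bar>) \<le> e0" unfolding e_def by auto
    obtain \<delta> where \<delta>: "\<delta> > 0" "\<And>x y. x \<in> {a..b} \<Longrightarrow> y \<in> {a..b} \<Longrightarrow> dist y x < \<delta> \<Longrightarrow> dist (?W y) (?W x) < e"
      using compact_uniformly_continuous[OF cW compact_Icc] e(1) unfolding uniformly_continuous_on_def by metis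
    obtain n :: nat where n: "real n > (d - c) / \<delta>" using reals_Archimedean2 by blast
    have n0: "real n > 0" using n cd' \<delta>(1) by (meson divide_pos_pos diff_gt_0_iff_gt less_trans)
    define h where "h = (d - c) / real n"
    have h: "h > 0" "h < \<delta>" using n n0 cd' \<delta>(1) by (auto simp: h_def field_simps)
    define x where "x i = c + real i * h" for i
    have xn: "x 0 = c" "x n = d" using n0 by (auto simp: x_def h_def)
    have xm: "x i \<le> x j" if "i \<le> j" for i j using that h by (simp add: x_def)
    have xin: "x i \<in> {c..d}" if "i \<le> n" for i using xm[of 0 i] xm[of i n] xn that by auto
    have cell: "\<bar>Gam (u (x (Suc i))) - Gam (u (x i))\<bar> \<le> (LINT t|Mab a b. indicator {x i<..<x (Suc i)} t * ((?W t + e) * \<bar>p t\<bar>))"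
      if i: "i < n" for i
    proof -
      have lt: "x i < x (Suc i)" using h by (simp add: x_def algebra_simps)
      have inab: "a \<le> x i" "x (Suc i) \<le> b" using xin[of i] xin[of "Suc i"] i cd by auto
      obtain \<xi> where \<xi>: "\<xi> \<in> closed_segment (u (x i)) (u (x (Suc i)))" "Gam (u (x (Suc i))) - Gam (u (x i)) = sqrt (2 * F \<xi>) * (u (x (Suc i)) - u (x i))"
        using mean_value_segment[OF DGam] by blast
      have cu: "continuous_on {x i..x (Suc i)} u" using u by (rule continuous_on_subset) (use inab in auto)
      \<comment> \<open>The intermediate value \<xi> from the mean value theorem is attained by u
        inside the cell, so uniform continuity can be applied at that point.\<close>
      have "connected (u ` {x i..x (Suc i)})" using cu by (intro connected_continuous_image) auto
      moreover have "u (x i) \<in> u ` {x i..x (Suc i)}" "u (x (Suc i)) \<in> u ` {x i..x (Suc i)}" using lt by auto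
      ultimately have "closed_segment (u (x i)) (u (x (Suc i))) \<subseteq> u ` {x i..x (Suc i)}"
        by (simp add: closed_segment_subset is_interval_connected_1 is_interval_convex)
      then obtain q where q: "q \<in> {x i..x (Suc i)}" "\<xi> = u q" using \<xi>(1) by blast
      have Wq: "?W q \<le> ?W t + e" if t: "t \<in> {x i<..<x (Suc i)}" for t
      proof -
        have "dist q t < \<delta>" using q(1) t h by (auto simp: dist_real_def x_def algebra_simps)
        then show ?thesis using \<delta>(2)[of t q] q(1) t inab by (auto simp: dist_real_def)
      qed
      have ii: "integrable (Mab a b) (\<lambda>t. indicator {x i<..<x (Suc i)} t * p t)"
        by (rule indicator_integrable[OF L2_integrable[OF pL]]) simp
      have "\<bar>Gam (u (x (Suc i))) - Gam (u (x i))\<bar> = ?W q * \<bar>LINT t|Mab a b. indicator {x i<..<x (Suc i)} t * p t\<bar>"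
        unfolding \<xi>(2) abs_mult weak_deriv_FTC[OF wd u inab(1) lt inab(2), symmetric] using F_nonneg q(2) by simp
      also have "\<dots> \<le> ?W q * (LINT t|Mab a b. \<bar>indicator {x i<..<x (Suc i)} t * p t\<bar>)"
        using F_nonneg by (intro mult_left_mono integral_abs_bound) auto
      also have "\<dots> = (LINT t|Mab a b. ?W q * \<bar>indicator {x i<..<x (Suc i)} t * p t\<bar>)" by simp
      also have "\<dots> \<le> (LINT t|Mab a b. indicator {x i<..<x (Suc i)} t * ((?W t + e) * \<bar>p t\<bar>))"
      proof (rule integral_mono)
        show "integrable (Mab a b) (\<lambda>t. ?W q * \<bar>indicator {x i<..<x (Suc i)} t * p t\<bar>)"
          using integrable_abs[OF ii] by simp
        show "integrable (Mab a b) (\<lambda>t. indicator {x i<..<x (Suc i)} t * ((?W t + e) * \<bar>p t\<bar>))"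
          using int ip by (intro indicator_integrable) (auto simp: distrib_right)
        show "?W q * \<bar>indicator {x i<..<x (Suc i)} t * p t\<bar> \<le> indicator {x i<..<x (Suc i)} t * ((?W t + e) * \<bar>p t\<bar>)" for t
          using Wq[of t] by (auto simp: indicator_def intro!: mult_right_mono)
      qed
      finally show ?thesis .
    qed
    have iq: "integrable (Mab a b) (\<lambda>t. indicator {x i<..<x (Suc i)} t * ((?W t + e) * \<bar>p t\<bar>))" for i
      using int ip by (intro indicator_integrable) (auto simp: distrib_right)
    have "\<bar>Gam (u d) - Gam (u c)\<bar> = \<bar>\<Sum>i<n. Gam (u (x (Suc i))) - Gam (u (x i))\<bar>"
      using sum_lessThan_telescope[of "\<lambda>i. Gam (u (x i))" n] xn by simp
    also have "\<dots> \<le> (\<Sum>i<n. \<bar>Gam (u (x (Suc i))) - Gam (u (x i))\<bar>)" by (rule sum_abs)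
    also have "\<dots> \<le> (\<Sum>i<n. LINT t|Mab a b. indicator {x i<..<x (Suc i)} t * ((?W t + e) * \<bar>p t\<bar>))"
      by (intro sum_mono cell) simp
    also have "\<dots> = (LINT t|Mab a b. (\<Sum>i<n. indicator {x i<..<x (Suc i)} t * ((?W t + e) * \<bar>p t\<bar>)))"
      using iq by (intro Bochner_Integration.integral_sum[symmetric])
    also have "\<dots> \<le> (LINT t|Mab a b. indicator {c<..<d} t * (?W t * \<bar>p t\<bar>) + e * \<bar>p t\<bar>)"
    proof (rule integral_mono)
      show "integrable (Mab a b) (\<lambda>t. \<Sum>i<n. indicator {x i<..<x (Suc i)} t * ((?W t + e) * \<bar>p t\<bar>))"
        using iq by (intro Bochner_Integration.integrable_sum)
      show "integrable (Mab a b) (\<lambda>t. indicator {c<..<d} t * (?W t * \<bar>p t\<bar>) + e * \<bar>p t\<bar>)"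
        using indicator_integrable[OF int, of "{c<..<d}"] ip by simp
      fix t
      have disj: "disjoint_family_on (\<lambda>i. {x i<..<x (Suc i)}) {..<n}"
        unfolding disjoint_family_on_def
      proof (intro ballI impI)
        fix i j :: nat assume "i \<noteq> j"
        then have "x (Suc i) \<le> x j \<or> x (Suc j) \<le> x i" using xm by (metis Suc_leI linorder_neqE_nat)
        then show "{x i<..<x (Suc i)} \<inter> {x j<..<x (Suc j)} = {}" by auto
      qed
      have "(\<Sum>i<n. indicator {x i<..<x (Suc i)} t :: real) = indicator (\<Union>i<n. {x i<..<x (Suc i)}) t"
        by (rule indicator_UN_disjoint[symmetric]) (use disj in auto)
      also have "\<dots> \<le> indicator {c<..<d} t"
      proof -
        have "(\<Union>i<n. {x i<..<x (Suc i)}) \<subseteq> {c<..<d}"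
        proof
          fix t assume "t \<in> (\<Union>i<n. {x i<..<x (Suc i)})"
          then obtain i where "i < n" "x i < t" "t < x (Suc i)" by auto
          then show "t \<in> {c<..<d}" using xin[of i] xin[of "Suc i"] by auto
        qed
        then have "t \<in> (\<Union>i<n. {x i<..<x (Suc i)}) \<Longrightarrow> t \<in> {c<..<d}" by blast
        then show ?thesis unfolding indicator_def of_bool_def by (simp only: split: if_split) simp
      qed
      finally have s: "(\<Sum>i<n. indicator {x i<..<x (Suc i)} t :: real) \<le> indicator {c<..<d} t" .
      have "(\<Sum>i<n. indicator {x i<..<x (Suc i)} t * ((?W t + e) * \<bar>p t\<bar>)) = (\<Sum>i<n. indicator {x i<..<x (Suc i)} t) * ((?W t + e) * \<bar>p t\<bar>)"
        by (simp add: sum_distrib_right)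
      also have "\<dots> \<le> indicator {c<..<d} t * ((?W t + e) * \<bar>p t\<bar>)"
        using s e F_nonneg by (intro mult_right_mono) auto
      also have "\<dots> \<le> indicator {c<..<d} t * (?W t * \<bar>p t\<bar>) + e * \<bar>p t\<bar>"
        using e by (auto simp: indicator_def distrib_right)
      finally show "(\<Sum>i<n. indicator {x i<..<x (Suc i)} t * ((?W t + e) * \<bar>p t\<bar>)) \<le> indicator {c<..<d} t * (?W t * \<bar>p t\<bar>) + e * \<bar>p t\<bar>" .
    qed
    also have "\<dots> = (LINT t|Mab a b. indicator {c<..<d} t * (?W t * \<bar>p t\<bar>)) + e * (LINT t|Mab a b. \<bar>p t\<bar>)"
      using indicator_integrable[OF int, of "{c<..<d}"] ip by simp
    also have "\<dots> \<le> (LINT t|Mab a b. indicator {c<..<d} t * (?W t * \<bar>p t\<bar>)) + e0" using e by simp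
    finally show "\<bar>Gam (u d) - Gam (u c)\<bar> \<le> (LINT t|Mab a b. indicator {c<..<d} t * (?W t * \<bar>p t\<bar>)) + e0" .
  qed
qed simp

end

section \<open>Static estimates at fixed \<epsilon>: cost of the jumps, position of the
  interface\<close>

section \<open>Energy lower bounds and location of the interface\<close>

locale layers = double_well +
  fixes Cw a b \<tau> r0 :: real and v :: "real \<Rightarrow> real" and D :: "real set"
  assumes Cw: "Cw > 0" "\<And>p s. p \<in> {-1, 1} \<Longrightarrow> \<bar>s - p\<bar> \<le> 1/2 \<Longrightarrow> \<bar>Gam s - Gam p\<bar> \<le> Cw * F s"
    and ab: "a < b" and \<tau>: "\<tau> > 0" and finD: "finite D" and D_ne: "D \<noteq> {}" and r0: "r0 > 0"
    and D_inside: "\<And>z. z \<in> D \<Longrightarrow> a \<le> z - r0 \<and> z + r0 \<le> b"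
    and D_sep: "\<And>z z'. z \<in> D \<Longrightarrow> z' \<in> D \<Longrightarrow> z \<noteq> z' \<Longrightarrow> 2 * r0 \<le> \<bar>z - z'\<bar>"
    and v_const: "\<And>x y. a < x \<Longrightarrow> x \<le> y \<Longrightarrow> y < b \<Longrightarrow> {x..y} \<inter> D = {} \<Longrightarrow> v x = v y"
    and v_val: "\<And>x. x \<in> {a<..<b} \<Longrightarrow> v x \<in> {-1, 1}"
    and v_jump: "\<And>z x y. z \<in> D \<Longrightarrow> z - r0 < x \<Longrightarrow> x < z \<Longrightarrow> z < y \<Longrightarrow> y < z + r0 \<Longrightarrow> v y = - v x"
    and v_meas: "v \<in> borel_measurable (Mab a b)"
begin

definition c0 :: real where "c0 = Gam 1 - Gam (-1)"

lemma c0_pos: "c0 > 0" using Gam_strict_mono[of "-1" 1] by (simp add: c0_def)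

definition edens :: "real \<Rightarrow> state \<Rightarrow> real \<Rightarrow> real" where
  "edens \<epsilon> z x = \<tau> / (2 * \<epsilon>) * (snd z x)\<^sup>2 + \<epsilon> / 2 * (weak_deriv a b (fst z) x)\<^sup>2 + F (fst z x) / \<epsilon>"

definition Eon :: "real \<Rightarrow> state \<Rightarrow> real set \<Rightarrow> real" where
  "Eon \<epsilon> z A = (LINT x|Mab a b. indicator A x * edens \<epsilon> z x)"

definition U :: "real \<Rightarrow> real set" where "U \<rho> = (\<Union>z\<in>D. {z - \<rho><..<z + \<rho>})"

definition L1dist :: "state \<Rightarrow> real" where "L1dist z = (LINT x|Mab a b. \<bar>fst z x - v x\<bar>)"

abbreviation "E \<epsilon> z \<equiv> energy a b \<tau> \<epsilon> F z"

lemma U_sets: "U \<rho> \<in> sets lebesgue"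
  unfolding U_def using finD by (intro sets.finite_UN) auto

context
  fixes \<epsilon> :: real and z :: state
  assumes \<epsilon>: "\<epsilon> > 0" and z: "z \<in> X a b"
begin

lemma edens_nonneg: "0 \<le> edens \<epsilon> z x"
  using \<epsilon> \<tau> F_nonneg by (simp add: edens_def)

lemma edens_integrable: "integrable (Mab a b) (edens \<epsilon> z)"
proof -
  have "continuous_on {a..b} (\<lambda>x. F (fst z x))"
    using X_D(5)[OF z] cF by (rule continuous_on_compose_UNIV)
  from L2_integrable[OF continuous_L2[OF this]] L2_square[OF X_D(3)[OF z]] L2_square[OF X_D(4)[OF z]]
  show ?thesis unfolding edens_def by simp
qed

lemma Eon_integrable: "A \<in> sets lebesgue \<Longrightarrow> integrable (Mab a b) (\<lambda>x. indicator A x * edens \<epsilon> z x)"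
  by (rule indicator_integrable[OF edens_integrable])

lemma energy_Eon: "E \<epsilon> z = Eon \<epsilon> z UNIV"
  by (simp add: Eon_def edens_def energy_def case_prod_beta)

lemma Eon_sum:
  assumes I: "finite I" "disjoint_family_on A I" "\<And>i. i \<in> I \<Longrightarrow> A i \<in> sets lebesgue" "\<And>i. i \<in> I \<Longrightarrow> A i \<subseteq> B"
    and B: "B \<in> sets lebesgue"
  shows "(\<Sum>i\<in>I. Eon \<epsilon> z (A i)) \<le> Eon \<epsilon> z B"
proof -
  have "(\<Sum>i\<in>I. Eon \<epsilon> z (A i)) = (LINT x|Mab a b. (\<Sum>i\<in>I. indicator (A i) x * edens \<epsilon> z x))"
    unfolding Eon_def using I(3) Eon_integrable by (intro Bochner_Integration.integral_sum[symmetric]) auto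
  also have "\<dots> \<le> (LINT x|Mab a b. indicator B x * edens \<epsilon> z x)"
  proof (rule integral_mono)
    show "integrable (Mab a b) (\<lambda>x. \<Sum>i\<in>I. indicator (A i) x * edens \<epsilon> z x)"
      using I(3) Eon_integrable by (intro Bochner_Integration.integrable_sum) auto
    show "integrable (Mab a b) (\<lambda>x. indicator B x * edens \<epsilon> z x)" using B by (rule Eon_integrable)
    fix x
    have "(\<Sum>i\<in>I. indicator (A i) x :: real) = indicator (\<Union>i\<in>I. A i) x"
      by (rule indicator_UN_disjoint[symmetric]) (use I in auto)
    moreover have "x \<in> (\<Union>i\<in>I. A i) \<Longrightarrow> x \<in> B" using I(4) by blast
    ultimately have "(\<Sum>i\<in>I. indicator (A i) x :: real) \<le> indicator B x" by (auto simp: indicator_def)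
    then have "(\<Sum>i\<in>I. indicator (A i) x) * edens \<epsilon> z x \<le> indicator B x * edens \<epsilon> z x"
      using edens_nonneg by (rule mult_right_mono)
    then show "(\<Sum>i\<in>I. indicator (A i) x * edens \<epsilon> z x) \<le> indicator B x * edens \<epsilon> z x"
      by (simp add: sum_distrib_right)
  qed
  finally show ?thesis by (simp add: Eon_def)
qed

lemma Eon_mono: "A \<subseteq> B \<Longrightarrow> A \<in> sets lebesgue \<Longrightarrow> B \<in> sets lebesgue \<Longrightarrow> Eon \<epsilon> z A \<le> Eon \<epsilon> z B"
  using Eon_sum[of "{()}" "\<lambda>_. A" B] by (simp add: disjoint_family_on_def)

lemma Eon_nonneg: "0 \<le> Eon \<epsilon> z A"
  unfolding Eon_def using edens_nonneg by (intro Bochner_Integration.integral_nonneg) simp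

lemma Eon_two:
  assumes "A \<inter> B = {}" "A \<subseteq> C" "B \<subseteq> C" "A \<in> sets lebesgue" "B \<in> sets lebesgue" "C \<in> sets lebesgue"
  shows "Eon \<epsilon> z A + Eon \<epsilon> z B \<le> Eon \<epsilon> z C"
proof -
  have "(\<Sum>i\<in>{True, False}. Eon \<epsilon> z (if i then A else B)) \<le> Eon \<epsilon> z C"
    using assms by (intro Eon_sum) (auto simp: disjoint_family_on_def)
  then show ?thesis by simp
qed

text \<open>Young's inequality with weight \<epsilon> bounds the integrand of
  \<open>Gam_chain\<close> by the gradient and potential parts of the energy density.\<close>

lemma Gam_le_Eon:
  assumes "a \<le> c" "c \<le> d" "d \<le> b"
  shows "\<bar>Gam (fst z d) - Gam (fst z c)\<bar> \<le> Eon \<epsilon> z {c<..<d}"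
proof -
  let ?p = "weak_deriv a b (fst z)"
  have cW: "continuous_on {a..b} (\<lambda>x. sqrt (2 * F (fst z x)))"
    by (intro continuous_intros continuous_on_compose2[OF cF[of UNIV] X_D(5)[OF z]]) auto
  have absL: "(\<lambda>x. \<bar>?p x\<bar>) \<in> L2 a b"
    using X_D(3)[OF z] borel_measurable_abs[OF L2_measurable[OF X_D(3)[OF z]]] by (simp add: L2_def)
  have int: "integrable (Mab a b) (\<lambda>x. sqrt (2 * F (fst z x)) * \<bar>?p x\<bar>)"
    by (rule L2_mult[OF continuous_L2[OF cW] absL])
  have "\<bar>Gam (fst z d) - Gam (fst z c)\<bar> \<le> (LINT x|Mab a b. indicator {c<..<d} x * (sqrt (2 * F (fst z x)) * \<bar>?p x\<bar>))"
    by (rule Gam_chain[OF X_D(6,5)[OF z] assms])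
  also have "\<dots> \<le> Eon \<epsilon> z {c<..<d}"
    unfolding Eon_def
  proof (rule integral_mono[OF indicator_integrable[OF int] Eon_integrable])
    fix x
    have "sqrt (2 * F (fst z x)) * \<bar>?p x\<bar> \<le> edens \<epsilon> z x"
    proof -
      let ?A = "sqrt (2 * F (fst z x) / \<epsilon>)" and ?B = "sqrt \<epsilon> * \<bar>?p x\<bar>"
      have "sqrt (2 * F (fst z x)) * \<bar>?p x\<bar> = ?A * ?B" using \<epsilon> by (simp add: real_sqrt_divide)
      also have "2 * (?A * ?B) \<le> ?A\<^sup>2 + ?B\<^sup>2" using sum_squares_bound[of ?A ?B] by (simp add: mult.assoc)
      then have "?A * ?B \<le> (?A\<^sup>2 + ?B\<^sup>2) / 2" by simp
      also have "(?A\<^sup>2 + ?B\<^sup>2) / 2 = F (fst z x) / \<epsilon> + \<epsilon> / 2 * (?p x)\<^sup>2"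
        using \<epsilon> F_nonneg[of "fst z x"] by (simp add: power_mult_distrib add_divide_distrib)
      also have "\<dots> \<le> edens \<epsilon> z x" using \<epsilon> \<tau> by (simp add: edens_def)
      finally show ?thesis .
    qed
    then show "indicator {c<..<d} x * (sqrt (2 * F (fst z x)) * \<bar>?p x\<bar>) \<le> indicator {c<..<d} x * edens \<epsilon> z x"
      by (intro mult_left_mono) auto
  qed auto
  finally show ?thesis .
qed

lemma outside_energy:
  assumes "A \<inter> U \<rho> = {}" "A \<in> sets lebesgue"
  shows "Eon \<epsilon> z A \<le> E \<epsilon> z - Eon \<epsilon> z (U \<rho>)"
  using Eon_two[of A "U \<rho>" UNIV] assms U_sets by (simp add: energy_Eon)

text \<open>If no such point existed, then everywhere on the interval either |u - v| > 1/2 or the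
  energy density would exceed 4 \<eta> / l, with l the length. A Chebyshev estimate shows that both
  sets together are too small to fill the interval.\<close>

lemma good_point:
  assumes \<alpha>\<beta>: "a \<le> \<alpha>" "\<alpha> < \<beta>" "\<beta> \<le> b" and s: "s \<in> {-1, 1}" "\<And>x. x \<in> {\<alpha><..<\<beta>} \<Longrightarrow> v x = s"
    and \<delta>: "L1dist z \<le> \<delta>" "4 * \<delta> \<le> \<beta> - \<alpha>" and \<eta>: "\<eta> > 0" "Eon \<epsilon> z {\<alpha><..<\<beta>} \<le> \<eta>"
  obtains x where "x \<in> {\<alpha><..<\<beta>}" "\<bar>Gam (fst z x) - Gam s\<bar> \<le> Cw * (4 * \<epsilon> * \<eta> / (\<beta> - \<alpha>))"
proof -
  define l where "l = \<beta> - \<alpha>"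
  have l: "l > 0" using \<alpha>\<beta> by (simp add: l_def)
  let ?u = "fst z"
  have "\<exists>x\<in>{\<alpha><..<\<beta>}. \<bar>?u x - s\<bar> \<le> 1/2 \<and> F (?u x) \<le> 4 * \<epsilon> * \<eta> / l"
  proof (rule ccontr)
    assume neg: "\<not> ?thesis"
    have iv: "integrable (Mab a b) (\<lambda>x. \<bar>?u x - v x\<bar>)"
    proof -
      have "v \<in> L2 a b" by (rule bounded_L2[OF v_meas, of 1]) (use v_val in force)
      then have "(?u - v) \<in> L2 a b" using X_D(2)[OF z] by (intro l2.V_diff)
      from L2_integrable_abs[OF this] show ?thesis by simp
    qed
    have ie: "integrable (Mab a b) (\<lambda>x. indicator {\<alpha><..<\<beta>} x * edens \<epsilon> z x)" by (rule Eon_integrable) simp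
    have "l = (LINT x|Mab a b. indicator {\<alpha><..<\<beta>} x)"
    proof -
      have "{\<alpha><..<\<beta>} \<inter> {a<..<b} = {\<alpha><..<\<beta>}" using \<alpha>\<beta> by auto
      moreover have "{\<alpha><..<\<beta>} \<subseteq> {a<..<b}" using \<alpha>\<beta> by auto
      ultimately show ?thesis using \<alpha>\<beta> by (simp add: l_def measure_restrict_space)
    qed
    \<comment> \<open>In either case the integrand is at least 1. Integrated, the two terms are at
      most l / 2, because 4 \<delta> <= l, and l / 4, which contradicts the length l.\<close>
    also have "\<dots> \<le> (LINT x|Mab a b. 2 * \<bar>?u x - v x\<bar> + l / (4 * \<eta>) * (indicator {\<alpha><..<\<beta>} x * edens \<epsilon> z x))"
    proof (rule integral_mono)
      show "integrable (Mab a b) (indicat_real {\<alpha><..<\<beta>})"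
      proof -
        have "integrable (Mab a b) (\<lambda>_. 1 :: real)" by (rule finite_measure.integrable_const[OF finite_measure_Mab])
        from indicator_integrable[OF this, of "{\<alpha><..<\<beta>}"] show ?thesis by simp
      qed
      show "integrable (Mab a b) (\<lambda>x. 2 * \<bar>?u x - v x\<bar> + l / (4 * \<eta>) * (indicator {\<alpha><..<\<beta>} x * edens \<epsilon> z x))"
        using iv ie by simp
      fix x
      show "indicat_real {\<alpha><..<\<beta>} x \<le> 2 * \<bar>?u x - v x\<bar> + l / (4 * \<eta>) * (indicator {\<alpha><..<\<beta>} x * edens \<epsilon> z x)"
      proof (cases "x \<in> {\<alpha><..<\<beta>}")
        case True
        have pos: "0 \<le> l / (4 * \<eta>) * edens \<epsilon> z x" using l \<eta> edens_nonneg by simp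
        have "1 \<le> 2 * \<bar>?u x - v x\<bar> + l / (4 * \<eta>) * edens \<epsilon> z x"
        proof (cases "\<bar>?u x - s\<bar> \<le> 1/2")
          case False
          then show ?thesis using s(2)[OF True] pos by simp
        next
          case t: True
          then have "4 * \<epsilon> * \<eta> / l < F (?u x)" using neg True by force
          then have "4 * \<eta> / l \<le> F (?u x) / \<epsilon>" using \<epsilon> l by (simp add: field_simps)
          also have "\<dots> \<le> edens \<epsilon> z x" using \<epsilon> \<tau> by (simp add: edens_def)
          finally have le: "4 * \<eta> / l \<le> edens \<epsilon> z x" .
          have one: "l / (4 * \<eta>) * (4 * \<eta> / l) = 1" using l \<eta> by simp
          have "0 \<le> l / (4 * \<eta>)" using l \<eta> by simp
          from mult_left_mono[OF le this] have "1 \<le> l / (4 * \<eta>) * edens \<epsilon> z x" unfolding one .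
          then show ?thesis by (intro add_increasing) simp_all
        qed
        then show ?thesis using True by simp
      qed simp
    qed
    also have "\<dots> = 2 * L1dist z + l / (4 * \<eta>) * Eon \<epsilon> z {\<alpha><..<\<beta>}"
      using iv ie by (simp add: L1dist_def Eon_def)
    also have "\<dots> \<le> 2 * \<delta> + l / (4 * \<eta>) * \<eta>"
      using \<delta> \<eta> l by (intro add_mono mult_left_mono) auto
    also have "\<dots> \<le> l / 2 + l / 4" using \<delta>(2)[folded l_def] \<eta>(1) by simp
    finally show False using l by simp
  qed
  then obtain x where x: "x \<in> {\<alpha><..<\<beta>}" "\<bar>?u x - s\<bar> \<le> 1/2" "F (?u x) \<le> 4 * \<epsilon> * \<eta> / l" by blast
  have "\<bar>Gam (?u x) - Gam s\<bar> \<le> Cw * F (?u x)" by (rule Cw(2)[OF s(1) x(2)])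
  also have "\<dots> \<le> Cw * (4 * \<epsilon> * \<eta> / l)" using x(3) Cw(1) by (intro mult_left_mono) auto
  finally show ?thesis using that x(1) unfolding l_def by blast
qed

text \<open>\<open>good_point\<close> is applied to the flanks at distance r1 to r2 from the jump.
  They lie outside \<open>U r1\<close>, so their energy is at most \<eta>, and v has opposite
  constant values on them.\<close>

lemma crossing_points:
  assumes r: "0 \<le> r1" "r1 < r2" "r2 \<le> r0" and \<delta>: "L1dist z \<le> \<delta>" "4 * \<delta> \<le> r2 - r1"
    and \<eta>: "\<eta> > 0" "E \<epsilon> z - Eon \<epsilon> z (U r1) \<le> \<eta>" and p: "p \<in> D"
  obtains xl xr s where "s \<in> {-1, 1}" "p - r2 < xl" "xl < p - r1" "p + r1 < xr" "xr < p + r2"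
    "\<bar>Gam (fst z xl) - Gam s\<bar> \<le> Cw * (4 * \<epsilon> * \<eta> / (r2 - r1))"
    "\<bar>Gam (fst z xr) - Gam (- s)\<bar> \<le> Cw * (4 * \<epsilon> * \<eta> / (r2 - r1))"
proof -
  note in_ab = D_inside[OF p]
  define m where "m = p - (r1 + r2) / 2"
  define s where "s = v m"
  have mm: "p - r0 < m" "m < p" "m \<in> {p - r2<..<p - r1}" using r by (auto simp: m_def field_simps)
  have s: "s \<in> {-1, 1}" unfolding s_def using mm in_ab r0 by (intro v_val) auto
  have right: "v x = - s" if "x \<in> {p + r1<..<p + r2}" for x
    unfolding s_def using that mm r p by (intro v_jump[OF p]) auto
  \<comment> \<open>\<open>v_jump\<close> compares opposite sides of the jump only, so two points on
    the left are compared through a point on the right.\<close>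
  have left: "v x = s" if "x \<in> {p - r2<..<p - r1}" for x
  proof -
    have "v (p + (r1 + r2) / 2) = - v x" using that r p by (intro v_jump[OF p]) (auto simp: field_simps)
    moreover have "v (p + (r1 + r2) / 2) = - s" using r by (intro right) (auto simp: field_simps)
    ultimately show ?thesis by simp
  qed
  have disj: "{p - r2<..<p - r1} \<inter> U r1 = {}" "{p + r1<..<p + r2} \<inter> U r1 = {}"
  proof -
    have nin: "x \<notin> {q - r1<..<q + r1}" if "q \<in> D" "r1 < \<bar>x - p\<bar>" "\<bar>x - p\<bar> < r2" for x q
    proof (cases "q = p")
      case False
      then have "2 * r0 \<le> \<bar>p - q\<bar>" using D_sep[OF p that(1)] by blast
      then show ?thesis using that r by auto
    qed (use that in auto)
    have out: "x \<notin> U r1" if "r1 < \<bar>x - p\<bar>" "\<bar>x - p\<bar> < r2" for x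
      unfolding U_def using nin[OF _ that] by blast
    have "r1 < \<bar>x - p\<bar> \<and> \<bar>x - p\<bar> < r2" if "x \<in> {p - r2<..<p - r1} \<or> x \<in> {p + r1<..<p + r2}" for x
      using that r by auto
    then show "{p - r2<..<p - r1} \<inter> U r1 = {}" "{p + r1<..<p + r2} \<inter> U r1 = {}"
      using out by blast+
  qed
  obtain xl where xl: "xl \<in> {p - r2<..<p - r1}" "\<bar>Gam (fst z xl) - Gam s\<bar> \<le> Cw * (4 * \<epsilon> * \<eta> / ((p - r1) - (p - r2)))"
  proof (rule good_point[OF _ _ _ s left \<delta>(1) _ \<eta>(1)])
    show "Eon \<epsilon> z {p - r2<..<p - r1} \<le> \<eta>" using outside_energy[OF disj(1)] \<eta>(2) by simp
  qed (use r in_ab \<delta> r0 in auto)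
  obtain xr where xr: "xr \<in> {p + r1<..<p + r2}" "\<bar>Gam (fst z xr) - Gam (- s)\<bar> \<le> Cw * (4 * \<epsilon> * \<eta> / ((p + r2) - (p + r1)))"
  proof (rule good_point[OF _ _ _ _ right \<delta>(1) _ \<eta>(1)])
    show "Eon \<epsilon> z {p + r1<..<p + r2} \<le> \<eta>" using outside_energy[OF disj(2)] \<eta>(2) by simp
  qed (use r in_ab \<delta> r0 s in auto)
  show ?thesis using that[OF s, of xl xr] xl xr by simp
qed

text \<open>Each jump costs the difference of G between its two crossing points, which is c0 up to
  the two errors. The windows around different jumps are disjoint because r2 <= r0, so the costs add
  up.\<close>

lemma inner_step:
  assumes r: "0 \<le> r1" "r1 < r2" "r2 \<le> r0" and \<delta>: "L1dist z \<le> \<delta>" "4 * \<delta> \<le> r2 - r1"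
    and \<eta>: "\<eta> > 0" "E \<epsilon> z - Eon \<epsilon> z (U r1) \<le> \<eta>"
  shows "real (card D) * (c0 - 2 * (Cw * (4 * \<epsilon> * \<eta> / (r2 - r1)))) \<le> Eon \<epsilon> z (U r2)"
proof -
  let ?q = "Cw * (4 * \<epsilon> * \<eta> / (r2 - r1))"
  have "real (card D) * (c0 - 2 * ?q) = (\<Sum>p\<in>D. c0 - 2 * ?q)" by simp
  also have "\<dots> \<le> (\<Sum>p\<in>D. Eon \<epsilon> z {p - r2<..<p + r2})"
  proof (rule sum_mono)
    fix p assume p: "p \<in> D"
    obtain xl xr s where x: "s \<in> {-1, 1}" "p - r2 < xl" "xl < p - r1" "p + r1 < xr" "xr < p + r2"
      "\<bar>Gam (fst z xl) - Gam s\<bar> \<le> ?q" "\<bar>Gam (fst z xr) - Gam (- s)\<bar> \<le> ?q"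
      using crossing_points[OF r \<delta> \<eta> p] by metis
    have "c0 - 2 * ?q \<le> \<bar>Gam (fst z xr) - Gam (fst z xl)\<bar>"
      using x(1,6,7) unfolding c0_def by auto
    also have "\<dots> \<le> Eon \<epsilon> z {xl<..<xr}"
      using x r D_inside[OF p] by (intro Gam_le_Eon) auto
    also have "\<dots> \<le> Eon \<epsilon> z {p - r2<..<p + r2}" using x by (intro Eon_mono) auto
    finally show "c0 - 2 * ?q \<le> Eon \<epsilon> z {p - r2<..<p + r2}" .
  qed
  also have "\<dots> \<le> Eon \<epsilon> z (U r2)"
  proof (rule Eon_sum[OF finD])
    show "disjoint_family_on (\<lambda>p. {p - r2<..<p + r2}) D"
      unfolding disjoint_family_on_def
    proof (intro ballI impI)
      fix p q assume "p \<in> D" "q \<in> D" "p \<noteq> q"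
      from D_sep[OF this] show "{p - r2<..<p + r2} \<inter> {q - r2<..<q + r2} = {}" using r by (auto simp: abs_if split: if_splits)
    qed
  qed (auto simp: U_def intro: U_sets[unfolded U_def])
  finally show ?thesis .
qed

end

text \<open>Induction on the exponent j, enlarging the radius by l = r/(k+1) each time. A deficit of
  order \<epsilon>^j inside leaves an energy of the same order outside, and
  \<open>inner_step\<close> on the slightly larger neighbourhood multiplies it by \<epsilon>. The
  start uses radius l, so exponent k is reached exactly at radius r.\<close>

lemma energy_lower_bound:
  assumes r: "0 < r" "r \<le> r0" and C: "C > 0" and \<delta>: "4 * \<delta> \<le> r / real (Suc k)"
  obtains A where "A \<ge> 0" "\<And>\<epsilon> z. 0 < \<epsilon> \<Longrightarrow> \<epsilon> \<le> 1 \<Longrightarrow> z \<in> X a b \<Longrightarrow> L1dist z \<le> \<delta> \<Longrightarrow>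
    E \<epsilon> z \<le> real (card D) * c0 + C * \<epsilon> ^ k \<Longrightarrow> real (card D) * c0 - A * \<epsilon> ^ k \<le> Eon \<epsilon> z (U r)"
proof -
  define l where "l = r / real (Suc k)"
  have l: "l > 0" using r by (simp add: l_def)
  have "\<exists>A\<ge>0. \<forall>\<epsilon> z. 0 < \<epsilon> \<longrightarrow> \<epsilon> \<le> 1 \<longrightarrow> z \<in> X a b \<longrightarrow> L1dist z \<le> \<delta> \<longrightarrow>
    E \<epsilon> z \<le> real (card D) * c0 + C * \<epsilon> ^ k \<longrightarrow> real (card D) * c0 - A * \<epsilon> ^ j \<le> Eon \<epsilon> z (U (l * real (Suc j)))"
    if "j \<le> k" for j
    using that
  proof (induction j)
    case 0
    \<comment> \<open>With A equal to the full cost of the jumps, the bound at exponent 0 says only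
      that the energy is nonnegative.\<close>
    show ?case
      using Eon_nonneg c0_pos by (intro exI[of _ "real (card D) * c0"]) auto
  next
    case (Suc j)
    then obtain A where A: "A \<ge> 0" "\<And>\<epsilon> z. 0 < \<epsilon> \<Longrightarrow> \<epsilon> \<le> 1 \<Longrightarrow> z \<in> X a b \<Longrightarrow> L1dist z \<le> \<delta> \<Longrightarrow>
      E \<epsilon> z \<le> real (card D) * c0 + C * \<epsilon> ^ k \<Longrightarrow> real (card D) * c0 - A * \<epsilon> ^ j \<le> Eon \<epsilon> z (U (l * real (Suc j)))"
      by auto
    \<comment> \<open>The loss of \<open>inner_step\<close> over a width l, with (C + A)
      \<epsilon>^j as the energy outside.\<close>
    define A' where "A' = real (card D) * (2 * (Cw * (4 * (C + A) / l)))"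
    have "real (card D) * c0 - A' * \<epsilon> ^ Suc j \<le> Eon \<epsilon> z (U (l * real (Suc (Suc j))))"
      if e: "0 < \<epsilon>" "\<epsilon> \<le> 1" and z: "z \<in> X a b" "L1dist z \<le> \<delta>" "E \<epsilon> z \<le> real (card D) * c0 + C * \<epsilon> ^ k" for \<epsilon> z
    proof -
      let ?r1 = "l * real (Suc j)" and ?r2 = "l * real (Suc (Suc j))"
      let ?\<eta> = "(C + A) * \<epsilon> ^ j"
      have d: "?r2 - ?r1 = l" by (simp add: algebra_simps)
      have "real (Suc (Suc j)) \<le> real (Suc k)" using Suc.prems by simp
      then have "?r2 \<le> l * real (Suc k)" using l by (intro mult_left_mono) auto
      then have r2: "?r2 \<le> r0" using r by (simp add: l_def del: of_nat_Suc)
      have "\<epsilon> ^ k \<le> \<epsilon> ^ j" using e Suc.prems by (intro power_decreasing) auto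
      then have "C * \<epsilon> ^ k \<le> C * \<epsilon> ^ j" using C by simp
      then have \<eta>: "E \<epsilon> z - Eon \<epsilon> z (U ?r1) \<le> ?\<eta>"
        using A(2)[OF e z] z(3) by (simp add: distrib_right del: of_nat_Suc)
      have "real (card D) * (c0 - 2 * (Cw * (4 * \<epsilon> * ?\<eta> / (?r2 - ?r1)))) \<le> Eon \<epsilon> z (U ?r2)"
      proof (rule inner_step[OF e(1) z(1) _ _ r2 z(2) _ _ \<eta>])
        show "4 * \<delta> \<le> ?r2 - ?r1" unfolding d using \<delta> by (simp add: l_def del: of_nat_Suc)
        show "0 < ?\<eta>" using C A(1) e by simp
        show "?r1 < ?r2" using d l by linarith
        show "0 \<le> ?r1" using l by simp
      qed
      moreover have "real (card D) * (c0 - 2 * (Cw * (4 * \<epsilon> * ?\<eta> / (?r2 - ?r1)))) = real (card D) * c0 - A' * \<epsilon> ^ Suc j"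
        unfolding d A'_def by (simp add: algebra_simps)
      ultimately show ?thesis by simp
    qed
    moreover have "A' \<ge> 0" unfolding A'_def using Cw(1) C A(1) l by simp
    ultimately show ?case by blast
  qed
  from this[of k] obtain A where "A \<ge> 0" "\<And>\<epsilon> z. 0 < \<epsilon> \<Longrightarrow> \<epsilon> \<le> 1 \<Longrightarrow> z \<in> X a b \<Longrightarrow> L1dist z \<le> \<delta> \<Longrightarrow>
    E \<epsilon> z \<le> real (card D) * c0 + C * \<epsilon> ^ k \<Longrightarrow> real (card D) * c0 - A * \<epsilon> ^ k \<le> Eon \<epsilon> z (U (l * real (Suc k)))"
    by auto
  moreover have "l * real (Suc k) = r" by (simp add: l_def del: of_nat_Suc)
  ultimately show ?thesis using that by metis
qed

end

context layers
begin

text \<open>Away from the jumps too little energy is left for u to travel from near a well to K. At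
  a jump u passes from one well to the other and takes every value in (-1,1), so it meets K if K has
  such a value. Otherwise a point of the interface near a jump forces u beyond a well, and the
  overshoot costs more than the energy budget allows.\<close>

lemma interface_location:
  assumes K: "closed K" "K \<subseteq> UNIV - {-1, 1}" and k: "k \<ge> 1" and r: "0 < r" "4 * r \<le> r0"
    and C: "C > 0" and \<delta>: "4 * \<delta> \<le> r / real (Suc k)"
  obtains A \<epsilon>1 where "A \<ge> 0" "0 < \<epsilon>1" "\<epsilon>1 \<le> 1"
    "\<And>\<epsilon> z. 0 < \<epsilon> \<Longrightarrow> \<epsilon> < \<epsilon>1 \<Longrightarrow> z \<in> X a b \<Longrightarrow> L1dist z \<le> \<delta> \<Longrightarrow> E \<epsilon> z \<le> real (card D) * c0 + C * \<epsilon> ^ k \<Longrightarrow>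
      real (card D) * c0 - A * \<epsilon> ^ k \<le> E \<epsilon> z \<and>
      (if K \<inter> {-1<..<1} = {} then interface a b K (fst z) = {}
       else (\<forall>x\<in>interface a b K (fst z). \<exists>p\<in>D. \<bar>x - p\<bar> < 2 * r) \<and>
            (\<forall>p\<in>D. \<exists>x\<in>interface a b K (fst z). \<bar>x - p\<bar> < 2 * r))"
proof -
  have rr0: "r \<le> r0" using r by simp
  obtain A where A: "A \<ge> 0" "\<And>\<epsilon> z. 0 < \<epsilon> \<Longrightarrow> \<epsilon> \<le> 1 \<Longrightarrow> z \<in> X a b \<Longrightarrow> L1dist z \<le> \<delta> \<Longrightarrow>
    E \<epsilon> z \<le> real (card D) * c0 + C * \<epsilon> ^ k \<Longrightarrow> real (card D) * c0 - A * \<epsilon> ^ k \<le> Eon \<epsilon> z (U r)"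
    using energy_lower_bound[OF r(1) rr0 C \<delta>] by metis
  obtain g where g: "g > 0" "\<And>p s. p \<in> {-1, 1} \<Longrightarrow> s \<in> K \<Longrightarrow> g \<le> \<bar>Gam s - Gam p\<bar>"
    using Gam_gap[OF K] by blast
  \<comment> \<open>M \<epsilon> bounds both the outer energy \<eta> and the error q at the crossing
    points. B is large enough for B \<epsilon> to cover \<eta> + q and also the total of the
    crossing errors plus the excess C \<epsilon>^k; \<epsilon>1 keeps it below the gap g.\<close>
  define M where "M = (C + A) + Cw * (4 * (C + A) / r)"
  define B where "B = 2 * (real (card D) + 1) * M"
  have CA: "C + A > 0" using C A by simp
  have M: "M > 0" "C + A \<le> M" "Cw * (4 * (C + A) / r) \<le> M" using CA Cw r by (auto simp: M_def add_pos_pos)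
  have B_eq: "B = 2 * (real (card D) * M) + 2 * M" by (simp add: B_def algebra_simps)
  have "0 \<le> real (card D) * M" using M(1) by simp
  with M(1) have B: "B > 0" "2 * M \<le> B" "2 * (real (card D) * M) + M \<le> B" unfolding B_eq by linarith+
  define \<epsilon>1 where "\<epsilon>1 = min 1 (g / B)"
  have \<epsilon>1: "0 < \<epsilon>1" "\<epsilon>1 \<le> 1" using g B by (auto simp: \<epsilon>1_def)
  have \<delta>r: "4 * \<delta> \<le> r"
  proof -
    have "r / real (Suc k) \<le> r / 1" using r by (intro divide_left_mono) auto
    then show ?thesis using \<delta> by simp
  qed
  have main: "real (card D) * c0 - A * \<epsilon> ^ k \<le> E \<epsilon> z \<and>
      (if K \<inter> {-1<..<1} = {} then interface a b K (fst z) = {}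
       else (\<forall>x\<in>interface a b K (fst z). \<exists>p\<in>D. \<bar>x - p\<bar> < 2 * r) \<and>
            (\<forall>p\<in>D. \<exists>x\<in>interface a b K (fst z). \<bar>x - p\<bar> < 2 * r))"
    if e: "0 < \<epsilon>" "\<epsilon> < \<epsilon>1" and z: "z \<in> X a b" "L1dist z \<le> \<delta>" and en: "E \<epsilon> z \<le> real (card D) * c0 + C * \<epsilon> ^ k" for \<epsilon> z
  proof -
    let ?u = "fst z"
    have e1: "\<epsilon> \<le> 1" using e \<epsilon>1 by simp
    have low: "real (card D) * c0 - A * \<epsilon> ^ k \<le> Eon \<epsilon> z (U r)" by (rule A(2)[OF e(1) e1 z en])
    define \<eta> where "\<eta> = (C + A) * \<epsilon> ^ k"
    define q where "q = Cw * (4 * \<epsilon> * \<eta> / r)"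
    have \<eta>0: "\<eta> > 0" using CA e by (simp add: \<eta>_def)
    have out: "E \<epsilon> z - Eon \<epsilon> z (U r) \<le> \<eta>" using low en by (simp add: \<eta>_def distrib_right)
    have ek: "\<epsilon> ^ k \<le> \<epsilon>" using power_decreasing[of 1 k \<epsilon>] k e e1 by simp
    have BE: "B * \<epsilon> < g" using e(2) B by (simp add: \<epsilon>1_def field_simps)
    have \<eta>M: "\<eta> \<le> M * \<epsilon>" unfolding \<eta>_def using M(2) ek CA e by (intro mult_mono) auto
    have qM: "q \<le> M * \<epsilon>"
    proof -
      have "\<epsilon> ^ k \<le> 1" using ek e1 by simp
      then have "\<eta> \<le> C + A" unfolding \<eta>_def using CA by (simp add: mult_left_le)
      then have "4 * \<epsilon> * \<eta> / r \<le> 4 * \<epsilon> * (C + A) / r" using e r by (intro divide_right_mono mult_left_mono) auto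
      then have "q \<le> Cw * (4 * \<epsilon> * (C + A) / r)" unfolding q_def using Cw by (intro mult_left_mono) auto
      also have "\<dots> = Cw * (4 * (C + A) / r) * \<epsilon>" by simp
      also have "\<dots> \<le> M * \<epsilon>" using M(3) e by (intro mult_right_mono) auto
      finally show ?thesis .
    qed
    have M2: "2 * (M * \<epsilon>) \<le> B * \<epsilon>" using mult_right_mono[OF B(2), of \<epsilon>] e by simp
    have small: "\<eta> + q < g" using \<eta>M qM M2 BE by simp
    have q0: "0 \<le> q" using Cw e \<eta>0 r by (simp add: q_def)
    have qg: "q < g" using small \<eta>0 by simp
    have far: "\<exists>p\<in>D. \<bar>x - p\<bar> < 2 * r" if x: "x \<in> interface a b K ?u" for x
    proof (rule ccontr)
      assume "\<not> ?thesis"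
      then have away: "\<And>p. p \<in> D \<Longrightarrow> 2 * r \<le> \<bar>x - p\<bar>" by (simp add: not_less)
      have xab: "a \<le> x" "x \<le> b" and xK: "?u x \<in> K" using x by (auto simp: interface_def)
      obtain d where "d \<in> D" using D_ne by blast
      then have wide: "2 * r0 \<le> b - a" using D_inside[of d] by auto
      \<comment> \<open>An interval of length r with x at one end, to the right of x if it fits into
        [a, b]; otherwise it fits on the left because b - a is at least 2 r0.\<close>
      define \<alpha> where "\<alpha> = (if x + r \<le> b then x else x - r)"
      have \<alpha>: "a \<le> \<alpha>" "\<alpha> + r \<le> b" "\<alpha> \<le> x" "x \<le> \<alpha> + r" using xab wide r by (auto simp: \<alpha>_def)
      have nD: "p \<notin> {\<alpha>..\<alpha> + r}" if "p \<in> D" for p using away[OF that] \<alpha> r by auto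
      define s where "s = v (\<alpha> + r / 2)"
      have s: "s \<in> {-1, 1}" unfolding s_def using \<alpha> r by (intro v_val) auto
      have vs: "v y = s" if y: "y \<in> {\<alpha><..<\<alpha> + r}" for y
      proof (cases "y \<le> \<alpha> + r / 2")
        case True
        have "{y..\<alpha> + r / 2} \<inter> D = {}" using nD y r by force
        then show ?thesis unfolding s_def using True y \<alpha> r by (intro v_const) auto
      next
        case False
        have "{\<alpha> + r / 2..y} \<inter> D = {}" using nD y r by force
        then show ?thesis unfolding s_def using False y \<alpha> r by (intro v_const[symmetric]) auto
      qed
      have disj: "{\<alpha><..<\<alpha> + r} \<inter> U r = {}"
      proof -
        have "y \<notin> {p - r<..<p + r}" if "y \<in> {\<alpha><..<\<alpha> + r}" "p \<in> D" for y p
          using away[OF that(2)] that(1) \<alpha> by auto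
        then show ?thesis unfolding U_def by blast
      qed
      have EJ: "Eon \<epsilon> z {\<alpha><..<\<alpha> + r} \<le> \<eta>" using outside_energy[OF e(1) z(1) disj] out by simp
      obtain x' where x': "x' \<in> {\<alpha><..<\<alpha> + r}" "\<bar>Gam (?u x') - Gam s\<bar> \<le> Cw * (4 * \<epsilon> * \<eta> / (\<alpha> + r - \<alpha>))"
      proof (rule good_point[OF e(1) z(1) \<alpha>(1) _ \<alpha>(2) s vs z(2) _ \<eta>0 EJ])
      qed (use r \<delta>r in auto)
      have Ex: "\<bar>Gam (?u x) - Gam (?u x')\<bar> \<le> \<eta>"
      proof (cases "x' \<le> x")
        case True
        have "\<bar>Gam (?u x) - Gam (?u x')\<bar> \<le> Eon \<epsilon> z {x'<..<x}"
          using True x' xab \<alpha> by (intro Gam_le_Eon[OF e(1) z(1)]) auto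
        also have "\<dots> \<le> Eon \<epsilon> z {\<alpha><..<\<alpha> + r}" using x' \<alpha> by (intro Eon_mono[OF e(1) z(1)]) auto
        finally show ?thesis using EJ by simp
      next
        case False
        have "\<bar>Gam (?u x') - Gam (?u x)\<bar> \<le> Eon \<epsilon> z {x<..<x'}"
          using False x' xab \<alpha> by (intro Gam_le_Eon[OF e(1) z(1)]) auto
        also have "\<dots> \<le> Eon \<epsilon> z {\<alpha><..<\<alpha> + r}" using x' \<alpha> by (intro Eon_mono[OF e(1) z(1)]) auto
        finally show ?thesis using EJ by (simp add: abs_minus_commute)
      qed
      have "\<bar>Gam (?u x) - Gam s\<bar> \<le> \<eta> + q" using Ex x'(2) unfolding q_def by simp
      then show False using g(2)[OF s xK] small by simp
    qed
    \<comment> \<open>The shift j selects the flanks: j = 0 gives crossing points within 2 r of the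
      jump, where the interface is to be found, and j = r gives points beyond 2 r, which enclose any
      interface point close to the jump.\<close>
    have cross: "\<exists>xl xr s. s \<in> {-1, 1} \<and> p - 2 * r - j < xl \<and> xl < p - r - j \<and> p + r + j < xr \<and> xr < p + 2 * r + j \<and>
      \<bar>Gam (?u xl) - Gam s\<bar> \<le> q \<and> \<bar>Gam (?u xr) - Gam (- s)\<bar> \<le> q" if p: "p \<in> D" and j: "0 \<le> j" "j \<le> r" for p j
    proof -
      have Uj: "E \<epsilon> z - Eon \<epsilon> z (U (r + j)) \<le> \<eta>"
      proof -
        have "U r \<subseteq> U (r + j)" unfolding U_def using j by (intro UN_mono) auto
        then have "Eon \<epsilon> z (U r) \<le> Eon \<epsilon> z (U (r + j))" by (intro Eon_mono[OF e(1) z(1)] U_sets)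
        then show ?thesis using out by simp
      qed
      have d: "2 * r + j - (r + j) = r" by simp
      have c: "0 \<le> r + j" "r + j < 2 * r + j" "2 * r + j \<le> r0" "4 * \<delta> \<le> 2 * r + j - (r + j)"
        using r j \<delta>r by auto
      obtain xl xr s where x: "s \<in> {-1, 1}" "p - (2 * r + j) < xl" "xl < p - (r + j)" "p + (r + j) < xr" "xr < p + (2 * r + j)"
        "\<bar>Gam (?u xl) - Gam s\<bar> \<le> Cw * (4 * \<epsilon> * \<eta> / (2 * r + j - (r + j)))"
        "\<bar>Gam (?u xr) - Gam (- s)\<bar> \<le> Cw * (4 * \<epsilon> * \<eta> / (2 * r + j - (r + j)))"
        by (rule crossing_points[OF e(1) z(1) c(1,2,3) z(2) c(4) \<eta>0 Uj p])
      show ?thesis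
        using x unfolding d q_def[symmetric] by (intro exI[of _ xl] exI[of _ xr] exI[of _ s]) auto
    qed
    have in_iface: "\<exists>x\<in>interface a b K ?u. \<bar>x - p\<bar> < 2 * r" if p: "p \<in> D" and \<kappa>: "\<kappa> \<in> K" "-1 < \<kappa>" "\<kappa> < 1" for p \<kappa>
    proof -
      obtain xl xr s where x: "s \<in> {-1, 1}" "p - 2 * r < xl" "xl < p - r" "p + r < xr" "xr < p + 2 * r"
        "\<bar>Gam (?u xl) - Gam s\<bar> \<le> q" "\<bar>Gam (?u xr) - Gam (- s)\<bar> \<le> q"
        using cross[OF p, of 0] r by auto
      have G1: "Gam (-1) + g \<le> Gam \<kappa>" using g(2)[of "-1" \<kappa>] \<kappa> Gam_strict_mono[of "-1" \<kappa>] by simp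
      have G2: "Gam \<kappa> + g \<le> Gam 1" using g(2)[of 1 \<kappa>] \<kappa> Gam_strict_mono[of \<kappa> 1] by simp
      have xx: "xl \<le> xr" using x r by simp
      have xab: "{xl..xr} \<subseteq> {a..b}" using x D_inside[OF p] r by auto
      have cu: "continuous_on {xl..xr} ?u" by (rule continuous_on_subset[OF X_D(5)[OF z(1)] xab])
      have "\<exists>x\<ge>xl. x \<le> xr \<and> ?u x = \<kappa>"
      proof (cases "s = 1")
        case True
        have "Gam \<kappa> < Gam (?u xl)" "Gam (?u xr) < Gam \<kappa>" using x(6,7) True G1 G2 qg by auto
        then show ?thesis using IVT2'[of ?u xr \<kappa> xl] xx cu by (auto simp: Gam_less_iff)
      next
        case False
        then have "s = -1" using x(1) by simp
        then have "Gam \<kappa> > Gam (?u xl)" "Gam (?u xr) > Gam \<kappa>" using x(6,7) G1 G2 qg by auto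
        then show ?thesis using IVT'[of ?u xl \<kappa> xr] xx cu by (auto simp: Gam_less_iff)
      qed
      then obtain x0 where x0: "xl \<le> x0" "x0 \<le> xr" "?u x0 = \<kappa>" by blast
      then have "x0 \<in> interface a b K ?u" using xab \<kappa> by (auto simp: interface_def)
      moreover have "\<bar>x0 - p\<bar> < 2 * r" using x0 x by auto
      ultimately show ?thesis by blast
    qed
    have no_iface: "interface a b K ?u = {}" if K0: "K \<inter> {-1<..<1} = {}"
    proof (rule ccontr)
      assume "interface a b K ?u \<noteq> {}"
      then obtain x where x: "x \<in> interface a b K ?u" by blast
      obtain p where p: "p \<in> D" "\<bar>x - p\<bar> < 2 * r" using far[OF x] by blast
      have xK: "?u x \<in> K" using x by (simp add: interface_def)
      have over: "Gam (?u x) \<ge> Gam 1 + g \<or> Gam (?u x) \<le> Gam (-1) - g"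
      proof -
        have "?u x \<noteq> 1" "?u x \<noteq> -1" using xK K by auto
        moreover have "?u x \<notin> {-1<..<1}" using xK K0 by blast
        ultimately have "?u x > 1 \<or> ?u x < -1" by auto
        then have "Gam (?u x) > Gam 1 \<or> Gam (?u x) < Gam (-1)" by (simp add: Gam_less_iff)
        moreover have "Gam (-1) < Gam 1" by (simp add: Gam_less_iff)
        ultimately show ?thesis using g(2)[of 1 "?u x"] g(2)[of "-1" "?u x"] xK by auto
      qed
      \<comment> \<open>At the jump p near x the path from one well to the other passes through u x,
        beyond a well by at least g in terms of G; this detour is traversed out and back, hence 2
        g.\<close>
      have piece: "c0 - 2 * q + (if p' = p then 2 * g else 0) \<le> Eon \<epsilon> z {p' - 3 * r<..<p' + 3 * r}" if p': "p' \<in> D" for p'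
      proof -
        obtain xl xr s where y: "s \<in> {-1, 1}" "p' - 2 * r - r < xl" "xl < p' - r - r" "p' + r + r < xr" "xr < p' + 2 * r + r"
          "\<bar>Gam (?u xl) - Gam s\<bar> \<le> q" "\<bar>Gam (?u xr) - Gam (- s)\<bar> \<le> q"
          using cross[OF p', of r] r by auto
        have inn: "a \<le> xl" "xr \<le> b" using y D_inside[OF p'] r by auto
        have sub: "Eon \<epsilon> z {xl<..<xr} \<le> Eon \<epsilon> z {p' - 3 * r<..<p' + 3 * r}"
          using y by (intro Eon_mono[OF e(1) z(1)]) auto
        show ?thesis
        proof (cases "p' = p")
          case True
          have lt: "xl < x" "x < xr" using p(2) y True by auto
          have "\<bar>Gam (?u x) - Gam (?u xl)\<bar> + \<bar>Gam (?u xr) - Gam (?u x)\<bar> \<le> Eon \<epsilon> z {xl<..<x} + Eon \<epsilon> z {x<..<xr}"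
            using lt inn by (intro add_mono Gam_le_Eon[OF e(1) z(1)]) auto
          also have "\<dots> \<le> Eon \<epsilon> z {xl<..<xr}"
            using lt by (intro Eon_two[OF e(1) z(1)]) auto
          finally have "\<bar>Gam (?u x) - Gam (?u xl)\<bar> + \<bar>Gam (?u xr) - Gam (?u x)\<bar> \<le> Eon \<epsilon> z {xl<..<xr}" .
          moreover have "c0 + 2 * g - 2 * q \<le> \<bar>Gam (?u x) - Gam (?u xl)\<bar> + \<bar>Gam (?u xr) - Gam (?u x)\<bar>"
            using y(1,6,7) over c0_pos unfolding c0_def by auto
          ultimately show ?thesis using sub True by simp
        next
          case False
          have "c0 - 2 * q \<le> \<bar>Gam (?u xr) - Gam (?u xl)\<bar>" using y(1,6,7) unfolding c0_def by auto
          also have "\<dots> \<le> Eon \<epsilon> z {xl<..<xr}" using y inn r by (intro Gam_le_Eon[OF e(1) z(1)]) auto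
          finally show ?thesis using sub False by simp
        qed
      qed
      have "(\<Sum>p'\<in>D. c0 - 2 * q + (if p' = p then 2 * g else 0)) = real (card D) * (c0 - 2 * q) + 2 * g"
        using finD p(1) by (simp add: sum.distrib)
      moreover have "(\<Sum>p'\<in>D. c0 - 2 * q + (if p' = p then 2 * g else 0)) \<le> (\<Sum>p'\<in>D. Eon \<epsilon> z {p' - 3 * r<..<p' + 3 * r})"
        by (intro sum_mono piece)
      moreover have "(\<Sum>p'\<in>D. Eon \<epsilon> z {p' - 3 * r<..<p' + 3 * r}) \<le> Eon \<epsilon> z UNIV"
      proof (rule Eon_sum[OF e(1) z(1) finD])
        show "disjoint_family_on (\<lambda>p. {p - 3 * r<..<p + 3 * r}) D"
          unfolding disjoint_family_on_def
        proof (intro ballI impI)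
          fix p q assume "p \<in> D" "q \<in> D" "p \<noteq> q"
          from D_sep[OF this] show "{p - 3 * r<..<p + 3 * r} \<inter> {q - 3 * r<..<q + 3 * r} = {}" using r by (auto simp: abs_if split: if_splits)
        qed
      qed auto
      ultimately have "real (card D) * (c0 - 2 * q) + 2 * g \<le> real (card D) * c0 + C * \<epsilon> ^ k"
        using en energy_Eon[OF e(1) z(1)] by simp
      then have "2 * g \<le> 2 * (real (card D) * q) + C * \<epsilon> ^ k" by (simp add: algebra_simps)
      also have "\<dots> \<le> 2 * (real (card D) * (M * \<epsilon>)) + M * \<epsilon>"
      proof (intro add_mono mult_left_mono qM)
        have "C * \<epsilon> ^ k \<le> \<eta>" using A(1) e by (simp add: \<eta>_def distrib_right)
        then show "C * \<epsilon> ^ k \<le> M * \<epsilon>" using \<eta>M by simp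
      qed auto
      also have "\<dots> = (2 * (real (card D) * M) + M) * \<epsilon>" by (simp add: algebra_simps)
      also have "\<dots> \<le> B * \<epsilon>" using B(3) e by (intro mult_right_mono) auto
      finally show False using BE g(1) by simp
    qed
    have "Eon \<epsilon> z (U r) \<le> E \<epsilon> z"
      unfolding energy_Eon[OF e(1) z(1)] by (intro Eon_mono[OF e(1) z(1)] U_sets) auto
    then have first: "real (card D) * c0 - A * \<epsilon> ^ k \<le> E \<epsilon> z" using low by simp
    show ?thesis
    proof (cases "K \<inter> {-1<..<1} = {}")
      case True
      then show ?thesis using first no_iface by simp
    next
      case False
      then obtain \<kappa> where "\<kappa> \<in> K" "-1 < \<kappa>" "\<kappa> < 1" by auto
      then show ?thesis using False first far in_iface by auto
    qed
  qed
  show ?thesis by (rule that[OF A(1) \<epsilon>1 main])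
qed

end

section \<open>Structure of a two-valued piecewise constant function\<close>

section \<open>The jumps of the limit profile\<close>

text \<open>A continuous function with values in {-1, 1} cannot change on an interval, by the
  intermediate value theorem.\<close>

lemma piecewise_constant_constant:
  assumes val: "\<And>x. x \<in> {a<..<b} \<Longrightarrow> v x \<in> {-1, 1::real}"
    and xy: "a < x" "x \<le> y" "y < b" "{x..y} \<inter> discontinuities a b v = {}"
  shows "v x = v y"
proof (rule ccontr)
  assume n: "v x \<noteq> v y"
  have c: "continuous_on {x..y} v"
    using xy by (intro continuous_at_imp_continuous_on ballI) (auto simp: discontinuities_def)
  have "\<exists>t\<ge>x. t \<le> y \<and> v t = 0"
  proof (cases "v x = 1")
    case True
    then have "v y = -1" using n val[of y] xy by auto
    then show ?thesis using True IVT2'[of v y 0 x] c xy by auto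
  next
    case False
    then have "v x = -1" "v y = 1" using n val[of x] val[of y] xy by auto
    then show ?thesis using IVT'[of v x 0 y] c xy by auto
  qed
  then obtain t where "x \<le> t" "t \<le> y" "v t = 0" by blast
  then show False using val[of t] xy by auto
qed

text \<open>If v had the same sign on both sides of z, both one-sided limits would agree, one-sided
  continuity would give v z the same value, and z would be a point of continuity.\<close>

lemma piecewise_constant_jump:
  assumes val: "\<And>x. x \<in> {a<..<b} \<Longrightarrow> v x \<in> {-1, 1::real}" and pc: "piecewise_constant_on a b v"
    and z: "z \<in> discontinuities a b v" and ab: "a \<le> z - r" "z + r \<le> b"
    and sep: "\<And>z'. z' \<in> discontinuities a b v \<Longrightarrow> z' \<noteq> z \<Longrightarrow> r \<le> \<bar>z - z'\<bar>"
    and x: "z - r < x" "x < z" and y: "z < y" "y < z + r"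
  shows "v y = - v x"
proof (rule ccontr)
  assume "v y \<noteq> - v x"
  then have eq: "v y = v x" using val[of x] val[of y] x y ab by auto
  define c where "c = v x"
  have nd: "t \<notin> discontinuities a b v" if "\<bar>t - z\<bar> < r" "t \<noteq> z" for t
    using sep[of t] that by (auto simp: abs_minus_commute)
  have left: "v t = c" if t: "z - r < t" "t < z" for t
  proof (cases "t \<le> x")
    case True
    have "{t..x} \<inter> discontinuities a b v = {}" using nd t x by fastforce
    then show ?thesis unfolding c_def using t x ab y True by (intro piecewise_constant_constant[OF val]) auto
  next
    case False
    have "{x..t} \<inter> discontinuities a b v = {}" using nd t x by fastforce
    then show ?thesis unfolding c_def using t x ab y False by (intro piecewise_constant_constant[OF val, symmetric]) auto
  qed
  have right: "v t = c" if t: "z < t" "t < z + r" for t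
  proof (cases "t \<le> y")
    case True
    have "{t..y} \<inter> discontinuities a b v = {}" using nd t y by fastforce
    then have "v t = v y" using t x ab y True by (intro piecewise_constant_constant[OF val]) auto
    then show ?thesis using eq by (simp add: c_def)
  next
    case False
    have "{y..t} \<inter> discontinuities a b v = {}" using nd t y by fastforce
    then have "v y = v t" using t x ab y False by (intro piecewise_constant_constant[OF val]) auto
    then show ?thesis using eq by (simp add: c_def)
  qed
  have r: "r > 0" using x by simp
  have evl: "\<forall>\<^sub>F t in at_left z. v t = c" and evr: "\<forall>\<^sub>F t in at_right z. v t = c"
    using eventually_at_left_real[of "z - r" z] eventually_at_right_real[of z "z + r"] r left right
    by (auto elim: eventually_mono)
  have zab: "z \<in> {a<..<b}" using z by (simp add: discontinuities_def)
  have vz: "v z = c"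
  proof -
    have "(v \<longlongrightarrow> v z) (at_left z) \<or> (v \<longlongrightarrow> v z) (at_right z)"
      using pc zab unfolding piecewise_constant_on_def continuous_within by blast
    moreover have "(v \<longlongrightarrow> c) (at_left z)" "(v \<longlongrightarrow> c) (at_right z)"
      using evl evr by (auto intro: tendsto_eventually)
    ultimately show ?thesis using tendsto_unique[of "at_left z" v] tendsto_unique[of "at_right z" v] by auto
  qed
  have "\<forall>\<^sub>F t in at z. v t = c" using evl evr by (simp add: eventually_at_split)
  then have "(v \<longlongrightarrow> c) (at z)" by (rule tendsto_eventually)
  then have "isCont v z" using vz by (simp add: isCont_def)
  then show False using z by (simp add: discontinuities_def)
qed

lemma piecewise_constant_measurable:
  assumes "finite (discontinuities a b v)"
  shows "v \<in> borel_measurable (Mab a b)"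
proof -
  let ?g = "\<lambda>x. if x \<in> {a<..<b} then v x else (0::real)"
  have "?g \<in> borel_measurable borel"
  proof (rule borel_measurable_continuous_countable_exceptions[where X = "discontinuities a b v \<union> {a, b}"])
    show "countable (discontinuities a b v \<union> {a, b})" using assms by (simp add: countable_finite)
    show "continuous_on (- (discontinuities a b v \<union> {a, b})) ?g"
    proof (rule continuous_at_imp_continuous_on, rule ballI)
      fix x assume x: "x \<in> - (discontinuities a b v \<union> {a, b})"
      consider "x \<in> {a<..<b}" | "x \<in> - {a..b}" using x by force
      then show "isCont ?g x"
      proof cases
        case 1
        then have "isCont v x" using x by (auto simp: discontinuities_def)
        moreover have "\<forall>\<^sub>F y in nhds x. ?g y = v y"
          by (rule eventually_mono[OF eventually_nhds_in_open[OF _ 1]]) auto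
        ultimately show ?thesis by (subst isCont_cong)
      next
        case 2
        have "\<forall>\<^sub>F y in nhds x. ?g y = 0"
          by (rule eventually_mono[OF eventually_nhds_in_open[OF _ 2]]) auto
        then show ?thesis by (subst isCont_cong) auto
      qed
    qed
  qed
  then have "?g \<in> borel_measurable (Mab a b)"
    by (intro measurable_restrict_space1 measurable_completion) simp
  then show ?thesis by (rule measurable_cong[THEN iffD1, rotated]) auto
qed

lemma finite_separation:
  fixes D :: "real set"
  assumes D: "finite D" "D \<noteq> {}" "D \<subseteq> {a<..<b}"
  obtains r where "r > 0" "\<And>z. z \<in> D \<Longrightarrow> a \<le> z - r \<and> z + r \<le> b" "\<And>z z'. z \<in> D \<Longrightarrow> z' \<in> D \<Longrightarrow> z \<noteq> z' \<Longrightarrow> 2 * r \<le> \<bar>z - z'\<bar>"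
proof -
  define S where "S = (\<lambda>z. z - a) ` D \<union> (\<lambda>z. b - z) ` D \<union> (\<lambda>(z, z'). \<bar>z - z'\<bar> / 2) ` {p \<in> D \<times> D. fst p \<noteq> snd p}"
  have S: "finite S" "S \<noteq> {}" using D by (auto simp: S_def)
  have pos: "\<And>s. s \<in> S \<Longrightarrow> s > 0" using D(3) by (auto simp: S_def)
  have le: "\<And>s. s \<in> S \<Longrightarrow> Min S \<le> s" using S by simp
  show ?thesis
  proof (rule that[of "Min S"])
    show "Min S > 0" using S pos by (simp add: Min_gr_iff)
    show "a \<le> z - Min S \<and> z + Min S \<le> b" if "z \<in> D" for z
      using le[of "z - a"] le[of "b - z"] that by (force simp: S_def)
    show "2 * Min S \<le> \<bar>z - z'\<bar>" if z: "z \<in> D" "z' \<in> D" "z \<noteq> z'" for z z'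
    proof -
      have "\<bar>z - z'\<bar> / 2 \<in> S" unfolding S_def using z by (intro UnI2 image_eqI[of _ _ "(z, z')"]) auto
      from le[OF this] show ?thesis by simp
    qed
  qed
qed

text \<open>The criterion also covers two empty sets, at distance 0, which is what occurs when K has
  no value in (-1,1).\<close>

lemma hausdorff_dist_le:
  assumes "\<And>x. x \<in> A \<Longrightarrow> \<exists>y\<in>B. \<bar>x - y\<bar> \<le> d" "\<And>y. y \<in> B \<Longrightarrow> \<exists>x\<in>A. \<bar>y - x\<bar> \<le> d"
  shows "hausdorff_dist A B \<le> ennreal d"
proof -
  have pd: "point_dist x C \<le> ennreal d" if "y \<in> C" "\<bar>x - y\<bar> \<le> d" for x y C
    unfolding point_dist_def using that by (intro INF_lower2[of y]) (auto intro: ennreal_leI)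
  show ?thesis
    unfolding hausdorff_dist_def
    using assms by (intro max.boundedI SUP_least) (meson pd)+
qed

lemma antiderivative_exists:
  fixes h :: "real \<Rightarrow> real"
  assumes "continuous_on UNIV h"
  obtains H where "\<And>x. (H has_real_derivative h x) (at x)"
proof -
  have "\<exists>H. \<forall>x::real. -\<infinity> < ereal x \<longrightarrow> ereal x < \<infinity> \<longrightarrow> (H has_vector_derivative h x) (at x)"
    using assms by (intro einterval_antiderivative) (auto simp: continuous_on_eq_continuous_at)
  then show ?thesis using that by (auto simp: has_real_derivative_iff_has_vector_derivative)
qed

section \<open>Continuation argument on the long time interval\<close>

section \<open>Slow motion of the interface\<close>

text \<open>To exceed \<theta> the function would first have to equal it, and at such a time
  \<open>step\<close> makes it strictly smaller.\<close>

lemma bootstrap: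
  fixes D :: "real \<Rightarrow> real"
  assumes c: "continuous_on {0..T} D" and D0: "D 0 < \<theta>"
    and step: "\<And>t. t \<in> {0..T} \<Longrightarrow> D t \<le> \<theta> \<Longrightarrow> D t < \<theta>" and t: "t \<in> {0..T}"
  shows "D t \<le> \<theta>"
proof (rule ccontr)
  assume "\<not> D t \<le> \<theta>"
  moreover have "continuous_on {0..t} D" using c t by (auto elim: continuous_on_subset)
  ultimately obtain s where "0 \<le> s" "s \<le> t" "D s = \<theta>"
    using IVT'[of D 0 \<theta> t] D0 t by auto
  then show False using step[of s] t by auto
qed

lemma locally_lipschitz_continuous: "locally_lipschitz g \<Longrightarrow> continuous_on UNIV g"
proof (rule continuous_at_imp_continuous_on, rule ballI)
  fix s assume "locally_lipschitz g"
  then obtain r L where "r > 0" "L-lipschitz_on (ball s r) g" unfolding locally_lipschitz_def by blast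
  then have "continuous_on (ball s r) g" "s \<in> ball s r" using lipschitz_on_continuous_on by auto
  then show "isCont g s" by (simp add: continuous_on_eq_continuous_at)
qed

theorem theorem4:
  fixes a b \<tau> \<sigma> c\<^sub>0 :: real
    and f g F v :: "real \<Rightarrow> real"
    and N k :: nat
    and u0 u1 :: "real \<Rightarrow> real \<Rightarrow> real"
    and y :: "real \<Rightarrow> real \<Rightarrow> state"
    and K :: "real set"
  assumes "a < b" and "\<tau> > 0"
    and "locally_lipschitz g" and "\<sigma> > 0" and "\<And>s. g s \<ge> \<sigma>"
    and "\<And>s. f s = - deriv F s"
    and "C3 F" and "filterlim F at_top at_top" and "filterlim F at_top at_bot"
    and "F 1 = 0" and "F (-1) = 0" and "deriv F 1 = 0" and "deriv F (-1) = 0"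
    and "deriv (deriv F) (-1) > 0" and "deriv (deriv F) 1 > 0"
    and "{s. deriv F s = 0 \<and> F s \<le> 0} = {-1, 1}"
    and "N \<ge> 1"
    and "\<And>x. x \<in> {a<..<b} \<Longrightarrow> v x \<in> {-1, 1}"
    and "piecewise_constant_on a b v" and "card (discontinuities a b v) = N"
    and "c\<^sub>0 = sqrt 2 * integral {-1..1} (\<lambda>s. sqrt (F s))"
    and "k \<ge> 1"
    and "\<forall>\<^sub>F \<epsilon> in at_right 0. (u0 \<epsilon>, u1 \<epsilon>) \<in> X a b"
    and "((\<lambda>\<epsilon>. LINT x|lebesgue_on {a<..<b}. \<bar>u0 \<epsilon> x - v x\<bar>) \<longlongrightarrow> 0) (at_right 0)"
    and "\<exists>C>0. \<forall>\<^sub>F \<epsilon> in at_right 0.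
           energy a b \<tau> \<epsilon> F (u0 \<epsilon>, u1 \<epsilon>) \<le> real N * c\<^sub>0 + C * \<epsilon> ^ k"
    and "\<forall>\<^sub>F \<epsilon> in at_right 0. mild_solution a b \<tau> \<epsilon> f g (u0 \<epsilon>, u1 \<epsilon>) (y \<epsilon>)"
    and "closed K" and "K \<subseteq> UNIV - {-1, 1}"
  shows "\<exists>\<delta>\<^sub>0>0. \<forall>\<delta>\<^sub>1. 0 < \<delta>\<^sub>1 \<and> \<delta>\<^sub>1 < \<delta>\<^sub>0 \<longrightarrow>
    (\<forall>m>0. \<exists>\<epsilon>\<^sub>0>0. \<forall>\<epsilon>. 0 < \<epsilon> \<and> \<epsilon> < \<epsilon>\<^sub>0 \<longrightarrow>
       exit_time a b K (u0 \<epsilon>) (\<lambda>t. fst (y \<epsilon> t)) \<delta>\<^sub>1 > ennreal (m / \<epsilon> ^ k))"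
proof -
  note asm = assms
  define D where "D = discontinuities a b v"
  have finD: "finite D" and D_ne: "D \<noteq> {}"
    using asm(17,20) card_ge_0_finite[of D] by (auto simp: D_def)
  define f' where "f' = (\<lambda>s. - deriv (deriv F) s)"
  have f_eq: "f = (\<lambda>s. - deriv F s)" using asm(6) by (simp add: fun_eq_iff)
  have diff: "F differentiable (at x)" "deriv F differentiable (at x)" "deriv (deriv F) differentiable (at x)" for x
  proof -
    have "(deriv ^^ n) F differentiable (at x)" if "n < 3" for n using asm(7) that by (simp add: C3_def)
    from this[of 0] this[of 1] this[of 2]
    show "F differentiable (at x)" "deriv F differentiable (at x)" "deriv (deriv F) differentiable (at x)"
      by (simp_all add: numeral_2_eq_2)
  qed
  have DF: "(F has_real_derivative - f s) (at s)" for s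
    using diff(1)[of s] by (simp add: f_eq DERIV_deriv_iff_real_differentiable)
  have Df: "(f has_real_derivative f' s) (at s)" for s
    unfolding f_eq f'_def using diff(2)[of s] by (intro DERIV_minus) (simp add: DERIV_deriv_iff_real_differentiable)
  have cf': "continuous_on UNIV f'"
    unfolding f'_def using diff(3)
    by (intro continuous_on_minus continuous_at_imp_continuous_on ballI differentiable_imp_continuous_within)
  have cg: "continuous_on UNIV g" using asm(3) by (rule locally_lipschitz_continuous)
  have cF: "continuous_on UNIV F" by (rule DERIV_continuous_on[OF has_field_derivative_at_within[OF DF]])
  have "continuous_on UNIV (\<lambda>s. sqrt (2 * F s))" by (intro continuous_intros cF)
  then obtain Gam where Gam: "\<And>s. (Gam has_real_derivative sqrt (2 * F s)) (at s)"
    using antiderivative_exists by blast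
  have crit: "{s. f s = 0 \<and> F s \<le> 0} = {-1, 1}" using asm(16) by (simp add: f_eq)
  interpret dw: double_well F f f' Gam
    by unfold_locales (use DF Df cf' asm(8-15) crit Gam in \<open>auto simp: f_eq f'_def\<close>)
  obtain Cw where Cw: "Cw > 0" "\<And>p s. p \<in> {-1, 1} \<Longrightarrow> \<bar>s - p\<bar> \<le> 1/2 \<Longrightarrow> \<bar>Gam s - Gam p\<bar> \<le> Cw * F s"
    using dw.Gam_near_well by blast
  have Dab: "D \<subseteq> {a<..<b}" by (auto simp: D_def discontinuities_def)
  obtain r0 where r0: "r0 > 0" "\<And>z. z \<in> D \<Longrightarrow> a \<le> z - r0 \<and> z + r0 \<le> b"
    "\<And>z z'. z \<in> D \<Longrightarrow> z' \<in> D \<Longrightarrow> z \<noteq> z' \<Longrightarrow> 2 * r0 \<le> \<bar>z - z'\<bar>"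
    using finite_separation[OF finD D_ne Dab] by blast
  have jump: "v y = - v x" if "z \<in> D" "z - r0 < x" "x < z" "z < y" "y < z + r0" for x y z
  proof (rule piecewise_constant_jump[OF asm(18,19), of z r0])
    show "r0 \<le> \<bar>z - z'\<bar>" if "z' \<in> discontinuities a b v" "z' \<noteq> z" for z'
      using r0(1) r0(3)[of z z'] that \<open>z \<in> D\<close> by (simp add: D_def)
  qed (use that r0(2)[of z] in \<open>auto simp: D_def\<close>)
  interpret ly: layers F f f' Gam Cw a b \<tau> r0 v D
  proof unfold_locales
    show "v x = v y" if "a < x" "x \<le> y" "y < b" "{x..y} \<inter> D = {}" for x y
      using that unfolding D_def by (intro piecewise_constant_constant[OF asm(18)])
    show "v \<in> borel_measurable (Mab a b)" using finD unfolding D_def by (rule piecewise_constant_measurable)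
  qed (use Cw asm(1,2,18) finD D_ne r0 jump in auto)
  have c0: "c\<^sub>0 = ly.c0"
  proof -
    have "((\<lambda>s. sqrt (2 * F s)) has_integral (Gam 1 - Gam (-1))) {-1..1}"
      using has_field_derivative_at_within[OF Gam]
      by (intro fundamental_theorem_of_calculus) (auto simp: has_real_derivative_iff_has_vector_derivative)
    then have "integral {-1..1} (\<lambda>s. sqrt (2 * F s)) = ly.c0"
      unfolding ly.c0_def by (rule integral_unique)
    then show ?thesis using asm(21) by (simp add: real_sqrt_mult)
  qed
  have cardD: "card D = N" using asm(20) by (simp add: D_def)
  obtain C where C: "C > 0" "\<forall>\<^sub>F \<epsilon> in at_right 0. energy a b \<tau> \<epsilon> F (u0 \<epsilon>, u1 \<epsilon>) \<le> real N * c\<^sub>0 + C * \<epsilon> ^ k"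
    using asm(25) by blast
  have main: "\<exists>\<epsilon>\<^sub>0>0. \<forall>\<epsilon>. 0 < \<epsilon> \<and> \<epsilon> < \<epsilon>\<^sub>0 \<longrightarrow>
       exit_time a b K (u0 \<epsilon>) (\<lambda>t. fst (y \<epsilon> t)) \<delta>\<^sub>1 > ennreal (m / \<epsilon> ^ k)"
    if \<delta>1: "0 < \<delta>\<^sub>1" and m: "m > 0" for \<delta>\<^sub>1 m
  proof -
    \<comment> \<open>Two interface points within 2 r of the same jump are less than 4 r apart,
      which is at most \<open>\<delta>\<^sub>1\<close>; the bound r0 / 4 leaves room for the windows
      of \<open>interface_location\<close>.\<close>
    define r where "r = min (\<delta>\<^sub>1 / 4) (r0 / 4)"
    have r: "0 < r" "4 * r \<le> r0" "4 * r \<le> \<delta>\<^sub>1" using \<delta>1 r0(1) by (auto simp: r_def)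
    define \<delta> where "\<delta> = r / real (Suc k) / 4"
    have "4 * (s / 4) = s" for s :: real by simp
    from this[of "r / real (Suc k)"] have \<delta>: "\<delta> > 0" "4 * \<delta> \<le> r / real (Suc k)"
      using r(1) by (simp_all only: \<delta>_def order_refl) simp
    obtain A \<epsilon>1 where A: "A \<ge> 0" "0 < \<epsilon>1" "\<epsilon>1 \<le> 1"
      "\<And>\<epsilon> z. 0 < \<epsilon> \<Longrightarrow> \<epsilon> < \<epsilon>1 \<Longrightarrow> z \<in> X a b \<Longrightarrow> ly.L1dist z \<le> \<delta> \<Longrightarrow> ly.E \<epsilon> z \<le> real (card D) * ly.c0 + C * \<epsilon> ^ k \<Longrightarrow>
        real (card D) * ly.c0 - A * \<epsilon> ^ k \<le> ly.E \<epsilon> z \<and>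
        (if K \<inter> {-1<..<1} = {} then interface a b K (fst z) = {}
         else (\<forall>x\<in>interface a b K (fst z). \<exists>p\<in>D. \<bar>x - p\<bar> < 2 * r) \<and>
              (\<forall>p\<in>D. \<exists>x\<in>interface a b K (fst z). \<bar>x - p\<bar> < 2 * r))"
      using ly.interface_location[OF asm(27,28,22) r(1,2) C(1) \<delta>(2)] by metis
    \<comment> \<open>Chosen so that B \<epsilon> < \<delta>^2 is exactly the inequality (C + A)
      \<epsilon>^(k+1) < \<sigma> \<theta> that closes the bootstrap, with \<open>T\<close> and
      \<open>\<theta>\<close> as below.\<close>
    define B where "B = 16 * m * (C + A) * (b - a) / \<sigma>"
    have B: "B > 0" using m C(1) A(1) asm(1,4) by (simp add: B_def)
    have "((\<lambda>\<epsilon>. LINT x|Mab a b. \<bar>u0 \<epsilon> x - v x\<bar>) \<longlongrightarrow> 0) (at_right 0)" by (rule asm(24))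
    then have "\<forall>\<^sub>F \<epsilon> in at_right 0. (LINT x|Mab a b. \<bar>u0 \<epsilon> x - v x\<bar>) < \<delta> / 2"
      using \<delta>(1) by (intro order_tendstoD) auto
    moreover have "\<forall>\<^sub>F \<epsilon> in at_right 0. 0 < \<epsilon> \<and> \<epsilon> < min \<epsilon>1 (\<delta>\<^sup>2 / B)"
      using A(2) B \<delta>(1) eventually_at_right_real[of 0 "min \<epsilon>1 (\<delta>\<^sup>2 / B)"] by (auto elim: eventually_mono)
    ultimately have "\<forall>\<^sub>F \<epsilon> in at_right 0. exit_time a b K (u0 \<epsilon>) (\<lambda>t. fst (y \<epsilon> t)) \<delta>\<^sub>1 > ennreal (m / \<epsilon> ^ k)"
      using asm(23,26) C(2)
    proof eventually_elim
      case (elim \<epsilon>)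
      have \<epsilon>: "0 < \<epsilon>" "\<epsilon> < \<epsilon>1" "B * \<epsilon> < \<delta>\<^sup>2" using elim(2) B by (auto simp: field_simps)
      define z0 where "z0 = (u0 \<epsilon>, u1 \<epsilon>)"
      interpret w: damped_wave a b \<tau> \<epsilon> f f' g F \<sigma>
        by unfold_locales (use asm(1,2,5) \<epsilon>(1) DF Df cf' cg in auto)
      have z0X: "z0 \<in> X a b" using elim by (simp add: z0_def)
      have mild: "mild_solution a b \<tau> \<epsilon> f g z0 (y \<epsilon>)" using elim by (simp add: z0_def)
      have E0: "ly.E \<epsilon> z0 \<le> real (card D) * ly.c0 + C * \<epsilon> ^ k" using elim by (simp add: z0_def cardD c0)
      have d0: "ly.L1dist z0 < \<delta> / 2" using elim by (simp add: z0_def ly.L1dist_def)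
      note sol = w.mild_solution_energy[OF mild z0X]
      \<comment> \<open>Twice the required time: the argument yields only that the exit time is at
        least T, and the conclusion is strict.\<close>
      define T where "T = 2 * m / \<epsilon> ^ k"
      have T: "T > 0" using m \<epsilon>(1) by (simp add: T_def)
      define I where "I = (\<lambda>t. integral {0..t} (\<lambda>s. (w.N2 (snd (y \<epsilon> s)))\<^sup>2))"
      \<comment> \<open>The dissipation that is tolerated: together with the weight \<mu> below it
        limits the L1 displacement up to time T to \<delta> / 4 + \<delta> / 8, on top of the
        initial distance \<delta> / 2.\<close>
      define \<theta> where "\<theta> = \<delta>\<^sup>2 / (8 * (b - a) * T)"
      have \<theta>: "\<theta> > 0" using \<delta>(1) T asm(1) by (simp add: \<theta>_def)
      have I0: "0 \<le> I t" for t
        unfolding I_def by (intro integral_nonneg integrable_continuous_real sol(3)) auto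
      have Et: "ly.E \<epsilon> (y \<epsilon> t) \<le> real (card D) * ly.c0 + C * \<epsilon> ^ k"
        "\<epsilon> * ly.E \<epsilon> (y \<epsilon> t) + \<sigma> * I t \<le> \<epsilon> * ly.E \<epsilon> z0" if "0 \<le> t" for t
      proof -
        show e: "\<epsilon> * ly.E \<epsilon> (y \<epsilon> t) + \<sigma> * I t \<le> \<epsilon> * ly.E \<epsilon> z0"
          using sol(4)[OF that] w.Gen_energy[OF sol(1)[OF that]] w.Gen_energy[OF z0X] by (simp add: I_def)
        moreover have "0 \<le> \<sigma> * I t" using I0 asm(4) by simp
        ultimately have "\<epsilon> * ly.E \<epsilon> (y \<epsilon> t) \<le> \<epsilon> * ly.E \<epsilon> z0" by linarith
        then show "ly.E \<epsilon> (y \<epsilon> t) \<le> real (card D) * ly.c0 + C * \<epsilon> ^ k" using E0 \<epsilon>(1) by simp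
      qed
      have close: "ly.L1dist (y \<epsilon> t) \<le> \<delta>" if t: "t \<in> {0..T}" and It: "I t \<le> \<theta>" for t
      proof -
        have t0: "0 \<le> t" using t by simp
        \<comment> \<open>With this weight the dissipation term of the displacement bound
          contributes \<delta> / 4 and the time term \<delta> / 8.\<close>
        define \<mu> where "\<mu> = 4 * sqrt (b - a) * T / \<delta>"
        have \<mu>: "\<mu> > 0" using asm(1) T \<delta>(1) by (simp add: \<mu>_def)
        have L: "fst (y \<epsilon> t) \<in> L2 a b" "fst z0 \<in> L2 a b" using X_D(2)[OF sol(1)[OF t0]] X_D(2)[OF z0X] by auto
        have vL: "v \<in> L2 a b" by (rule bounded_L2[OF ly.v_meas, of 1]) (use asm(18) in force)
        have i: "integrable (Mab a b) (\<lambda>x. \<bar>fst (y \<epsilon> t) x - fst z0 x\<bar>)" "integrable (Mab a b) (\<lambda>x. \<bar>fst z0 x - v x\<bar>)"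
          "integrable (Mab a b) (\<lambda>x. \<bar>fst (y \<epsilon> t) x - v x\<bar>)"
          using L2_integrable_abs[OF l2.V_diff[OF L]] L2_integrable_abs[OF l2.V_diff[OF L(2) vL]]
            L2_integrable_abs[OF l2.V_diff[OF L(1) vL]] by simp_all
        have "ly.L1dist (y \<epsilon> t) \<le> (LINT x|Mab a b. \<bar>fst (y \<epsilon> t) x - fst z0 x\<bar> + \<bar>fst z0 x - v x\<bar>)"
          unfolding ly.L1dist_def using i by (intro integral_mono) auto
        also have "\<dots> = (LINT x|Mab a b. \<bar>(fst (y \<epsilon> t) - fst z0) x\<bar>) + ly.L1dist z0"
          unfolding ly.L1dist_def using i by simp
        also have "\<dots> \<le> sqrt (b - a) * w.N2 (fst (y \<epsilon> t) - fst z0) + \<delta> / 2"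
          using L1_le_l2nm[OF l2.V_diff[OF L] asm(1)] d0 by (intro add_mono) auto
        also have "\<dots> \<le> sqrt (b - a) * (\<mu> / 2 * \<theta> + T / (2 * \<mu>)) + \<delta> / 2"
        proof (intro add_right_mono mult_left_mono)
          have "w.N2 (fst (y \<epsilon> t) - fst z0) \<le> \<mu> / 2 * I t + t / (2 * \<mu>)"
            unfolding I_def by (rule sol(5)[OF t0 \<mu>])
          also have "\<dots> \<le> \<mu> / 2 * \<theta> + T / (2 * \<mu>)"
            using It t \<mu> by (intro add_mono mult_left_mono divide_right_mono) auto
          finally show "w.N2 (fst (y \<epsilon> t) - fst z0) \<le> \<mu> / 2 * \<theta> + T / (2 * \<mu>)" .
        qed (use asm(1) in simp)
        also have "\<dots> = \<delta> / 4 + \<delta> / 8 + \<delta> / 2"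
        proof -
          define S where "S = sqrt (b - a)"
          have S: "S > 0" "b - a = S * S" using asm(1) by (auto simp: S_def)
          have "S * (\<mu> / 2 * \<theta>) = \<delta> / 4" "S * (T / (2 * \<mu>)) = \<delta> / 8"
            unfolding \<mu>_def \<theta>_def S_def[symmetric] S(2) using S(1) T \<delta>(1)
            by (simp_all add: field_simps power2_eq_square)
          then show ?thesis unfolding S_def[symmetric] by (simp add: distrib_left)
        qed
        also have "\<dots> \<le> \<delta>" using \<delta>(1) by simp
        finally show ?thesis .
      qed
      \<comment> \<open>The circle closes here: small dissipation keeps u close to v, closeness
        bounds the energy from below, and the lower bound makes the dissipation strictly smaller
        than \<theta>.\<close>
      have It: "I t \<le> \<theta>" if t: "t \<in> {0..T}" for t
      proof (rule bootstrap[OF _ _ _ t])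
        show "continuous_on {0..T} I" unfolding I_def
          by (intro indefinite_integral_continuous_1 integrable_continuous_real sol(3))
        show "I 0 < \<theta>" using \<theta> by (simp add: I_def)
        fix t assume t: "t \<in> {0..T}" "I t \<le> \<theta>"
        have t0: "0 \<le> t" using t by simp
        have "real (card D) * ly.c0 - A * \<epsilon> ^ k \<le> ly.E \<epsilon> (y \<epsilon> t)"
          using A(4)[OF \<epsilon>(1,2) sol(1)[OF t0] close[OF t] Et(1)[OF t0]] by blast
        then have "ly.E \<epsilon> z0 - ly.E \<epsilon> (y \<epsilon> t) \<le> (C + A) * \<epsilon> ^ k" using E0 by (simp add: distrib_right)
        then have "\<epsilon> * (ly.E \<epsilon> z0 - ly.E \<epsilon> (y \<epsilon> t)) \<le> \<epsilon> * ((C + A) * \<epsilon> ^ k)" using \<epsilon>(1) by (intro mult_left_mono) auto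
        then have "\<sigma> * I t \<le> \<epsilon> * ((C + A) * \<epsilon> ^ k)" using Et(2)[OF t0] by (simp add: right_diff_distrib)
        also have "\<dots> < \<sigma> * \<theta>"
        proof -
          have eq: "\<sigma> * \<theta> = \<delta>\<^sup>2 * (\<sigma> * \<epsilon> ^ k / (16 * m * (b - a)))"
          proof -
            have "\<sigma> * (\<delta>\<^sup>2 / (8 * L * (2 * m / e))) = \<delta>\<^sup>2 * (\<sigma> * e / (16 * m * L))" if "L > 0" "e > 0" for L e
              using that m by (simp add: field_simps)
            from this[of "b - a" "\<epsilon> ^ k"] show ?thesis using \<epsilon>(1) asm(1) by (simp only: \<theta>_def T_def) simp
          qed
          have "\<epsilon> * ((C + A) * \<epsilon> ^ k) = (B * \<epsilon>) * (\<sigma> * \<epsilon> ^ k / (16 * m * (b - a)))"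
            unfolding B_def using m asm(1,4) by simp
          also have "\<dots> < \<delta>\<^sup>2 * (\<sigma> * \<epsilon> ^ k / (16 * m * (b - a)))"
            using \<epsilon>(1,3) m asm(1,4) by (intro mult_strict_right_mono) auto
          finally show ?thesis unfolding eq .
        qed
        finally show "I t < \<theta>" using asm(4) by simp
      qed
      have haus: "hausdorff_dist (interface a b K (fst (y \<epsilon> t))) (interface a b K (u0 \<epsilon>)) \<le> ennreal \<delta>\<^sub>1"
        if t: "t \<in> {0..T}" for t
      proof -
        have t0: "0 \<le> t" using t by simp
        have d0': "ly.L1dist z0 \<le> \<delta>" using d0 \<delta>(1) by simp
        note P = A(4)[OF \<epsilon>(1,2) sol(1)[OF t0] close[OF t It[OF t]] Et(1)[OF t0], THEN conjunct2]
          and Q = A(4)[OF \<epsilon>(1,2) z0X d0' E0, THEN conjunct2, unfolded z0_def fst_conv]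
        show ?thesis
        proof (cases "K \<inter> {-1<..<1} = {}")
          case True
          then show ?thesis using P Q by (intro hausdorff_dist_le) auto
        next
          case False
          have near: "\<exists>y\<in>B'. \<bar>x - y\<bar> \<le> \<delta>\<^sub>1"
            if h: "x \<in> A'" "\<forall>x\<in>A'. \<exists>p\<in>D. \<bar>x - p\<bar> < 2 * r" "\<forall>p\<in>D. \<exists>x\<in>B'. \<bar>x - p\<bar> < 2 * r" for x A' B'
          proof -
            obtain p where p: "p \<in> D" "\<bar>x - p\<bar> < 2 * r" using h by blast
            then obtain x' where "x' \<in> B'" "\<bar>x' - p\<bar> < 2 * r" using h(3) by blast
            moreover from this p have "\<bar>x - x'\<bar> \<le> \<delta>\<^sub>1" using r(3) by linarith
            ultimately show ?thesis by blast
          qed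
          show ?thesis
            using P Q False by (intro hausdorff_dist_le near) auto
        qed
      qed
      have "ennreal T \<le> exit_time a b K (u0 \<epsilon>) (\<lambda>t. fst (y \<epsilon> t)) \<delta>\<^sub>1"
        unfolding exit_time_def
      proof (rule INF_greatest)
        fix t assume "t \<in> {t. 0 \<le> t \<and> ennreal \<delta>\<^sub>1 < hausdorff_dist (interface a b K (fst (y \<epsilon> t))) (interface a b K (u0 \<epsilon>))}"
        then have "0 \<le> t" "\<not> t \<le> T" using haus[of t] by (auto simp: not_le[symmetric])
        then show "ennreal T \<le> ennreal t" by (intro ennreal_leI) simp
      qed
      moreover have "ennreal (m / \<epsilon> ^ k) < ennreal T"
        using m \<epsilon>(1) T by (intro ennreal_lessI) (auto simp: T_def divide_strict_right_mono)
      ultimately show ?case by (rule less_le_trans[rotated])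
    qed
    then show ?thesis unfolding eventually_at_right[OF zero_less_one] by auto
  qed
  \<comment> \<open>The estimate holds for every positive \<open>\<delta>\<^sub>1\<close>, because r
    is capped by r0 / 4; the threshold 1 is an arbitrary choice.\<close>
  show ?thesis by (intro exI[of _ 1] conjI allI impI main) auto
qed

end
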